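(* Let $q\in[1,2)$ and $\delta\in(0,1)$, and let $$\mathcal F_{q,\delta}:=\Big\{f\in\mathcal W_q[0,1]:\|f\|_{[q]}\le1,\ \int_0^1f^2(x)\,dx>\delta\Big\}.$$ Let $\widehat\beta_n(f)$ be the least squares estimator of $\beta\in\mathbb R$ in the regression model $Y_j=\beta f(j/n)+X_j$, $j=1,\dots,n$, where $X_1,X_2,\dots$ is a short-memory linear process $X_i=\sum_{j=0}^\infty\psi_j\eta_{i-j}$. Then there exists a version of a Gaussian process $\nu_1$ indexed by $\mathcal F_{q,\delta}$ with values in a separable subset of $\ell^\infty(\mathcal F_{q,\delta})$, which is measurable for the Borel sets on its range, and $$\sqrt n\,(\widehat\beta_n-\beta)\xrightarrow{\mathscr D^*}\sigma_\eta A_\psi\,\nu_1\qquad\text{in }\ell^\infty(\mathcal F_{q,\delta})\text{ as }n\to\infty .$$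
   Context: Short-memory linear process: $(\eta_j)_{j\in\mathbb Z}$ are i.i.d. real random variables on a probability space $(\Omega,\mathcal A,\mathsf P)$ with mean zero and finite variance $\sigma_\eta^2=\mathsf E\eta_1^2\neq0$ ($\sigma_\eta>0$); $(\psi_j)_{j\ge0}$ are real numbers with $\sum_{j\ge0}|\psi_j|<\infty$ and $A_\psi:=\sum_{j\ge0}\psi_j\ne0$; and $X_i=\sum_{j=0}^\infty\psi_j\eta_{i-j}$ for $i\in\mathbb Z$. Least squares estimator: for $f:[0,1]\to\mathbb R$ and $Y_j=\beta f(j/n)+X_j$, $\widehat\beta_n(f)=\big(\sum_{j=1}^nf^2(j/n)\big)^{-1}\sum_{j=1}^nY_jf(j/n)$, so that $\sum_{j=1}^nf^2(j/n)\,[\widehat\beta_n(f)-\beta]=\sum_{j=1}^nX_jf(j/n)$. The process $\sqrt n(\widehat\beta_n-\beta)$ is $f\mapsto\sqrt n(\widehat\beta_n(f)-\beta)$, $f\in\mathcal F_{q,\delta}$; the statement is asymptotic and concerns $n$ large enough that $\inf_{f\in\mathcal F_{q,\delta}}\frac1n\sum_{j=1}^nf^2(j/n)>0$ (so that this is an element of $\ell^\infty(\mathcal F_{q,\delta})$). $q$-variation: $v_q(g)=\sup\{\sum_{i=1}^m|g(t_i)-g(t_{i-1})|^q:0=t_0<\dots<t_m=1,\ m\ge1\}$; $\mathcal W_q[0,1]$ is the set of $g:[0,1]\to\mathbb R$ with $v_q(g)<\infty$, with norm $\|g\|_{[q]}=\sup_{t\in[0,1]}|g(t)|+v_q(g)^{1/q}$.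 $\ell^\infty(\mathcal F)$: the Banach space of bounded functions $\mu:\mathcal F\to\mathbb R$ with norm $\|\mu\|_{\mathcal F}=\sup_{f\in\mathcal F}|\mu(f)|$. Convergence in outer distribution: let $\mathbb E$ be a metric space, let $Z_n$ be (arbitrary) functions from probability spaces $(\Omega_n,\mathcal A_n,P_n)$ into $\mathbb E$, $n\ge0$, where $Z_0$ takes values in a separable subset of $\mathbb E$ and is measurable for the Borel sets on its range. Then $Z_n\xrightarrow{\mathscr D^*}Z_0$ means $\lim_{n\to\infty}E^*h(Z_n)=Eh(Z_0)$ for every bounded continuous $h:\mathbb E\to\mathbb R$, where $E^*T=\inf\{EU:U\text{ measurable},\ EU\text{ exists},\ U\ge T\}$ is the outer integral. *)

theory Defs
  imports "HOL-Probability.Probability"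
begin

section \<open>Functions of bounded q-variation on the unit interval\<close>

definition q_variation :: "real \<Rightarrow> (real \<Rightarrow> real) \<Rightarrow> ereal" where
  "q_variation q g =
     Sup {ereal (\<Sum>i=1..m. \<bar>g (t i) - g (t (i - 1))\<bar> powr q) | (m::nat) (t::nat \<Rightarrow> real).
            m \<ge> 1 \<and> t 0 = 0 \<and> t m = 1 \<and> (\<forall>i\<in>{1..m}. t (i - 1) < t i)}"

text \<open>A function on \<open>[0,1]\<close> is a total function that is \<open>undefined\<close> outside \<open>[0,1]\<close>, so that
  equality of elements is equality on \<open>[0,1]\<close>.\<close>

definition bounded_q_variation :: "real \<Rightarrow> (real \<Rightarrow> real) set" where
  "bounded_q_variation q = {g \<in> extensional {0..1}. q_variation q g < \<infinity>}"

text \<open>Meaningful on \<^term>\<open>bounded_q_variation q\<close> with \<open>q \<ge> 1\<close>, where both terms are finite.\<close>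

definition q_variation_norm :: "real \<Rightarrow> (real \<Rightarrow> real) \<Rightarrow> real" where
  "q_variation_norm q g =
     (SUP t\<in>{0..1}. \<bar>g t\<bar>) + real_of_ereal (q_variation q g) powr (1 / q)"

definition regressors :: "real \<Rightarrow> real \<Rightarrow> (real \<Rightarrow> real) set" where
  "regressors q \<delta> =
     {f \<in> bounded_q_variation q. q_variation_norm q f \<le> 1 \<and> integral {0..1} (\<lambda>x. (f x)\<^sup>2) > \<delta>}"


section \<open>The space of bounded functions on a set\<close>

definition linf_space :: "'i set \<Rightarrow> ('i \<Rightarrow> real) set" where
  "linf_space F = {\<mu> \<in> extensional F. bounded (\<mu> ` F)}"

text \<open>The distance of the norm \<open>sup\<^sub>f |\<mu> f|\<close>. The case distinction is there because
  \<^locale>\<open>Metric_space\<close> wants a symmetric nonnegative function on the whole type, and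
  because the supremum of the empty set of reals is unspecified.\<close>

definition linf_dist :: "'i set \<Rightarrow> ('i \<Rightarrow> real) \<Rightarrow> ('i \<Rightarrow> real) \<Rightarrow> real" where
  "linf_dist F \<mu> \<nu> =
     (if \<mu> \<in> linf_space F \<and> \<nu> \<in> linf_space F \<and> F \<noteq> {} then SUP f\<in>F. \<bar>\<mu> f - \<nu> f\<bar> else 0)"

definition linf :: "'i set \<Rightarrow> ('i \<Rightarrow> real) metric" where
  "linf F = metric (linf_space F, linf_dist F)"

lemma Metric_space_linf: "Metric_space (linf_space F) (linf_dist F)"
proof (cases "F = {}")
  case True
  then show ?thesis
    by (auto simp: Metric_space_def linf_dist_def linf_space_def)
next
  case False
  have bdd: "bdd_above ((\<lambda>f. \<bar>\<mu> f - \<nu> f\<bar>) ` F)"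
    if "\<mu> \<in> linf_space F" "\<nu> \<in> linf_space F" for \<mu> \<nu>
  proof -
    have "bounded (\<mu> ` F)" "bounded (\<nu> ` F)"
      using that by (simp_all add: linf_space_def)
    then obtain a b where ab: "\<forall>f\<in>F. \<bar>\<mu> f\<bar> \<le> a" "\<forall>f\<in>F. \<bar>\<nu> f\<bar> \<le> b"
      unfolding bounded_iff by (metis image_eqI real_norm_def)
    show ?thesis
    proof (intro bdd_aboveI[of _ "a + b"])
      fix x assume "x \<in> (\<lambda>f. \<bar>\<mu> f - \<nu> f\<bar>) ` F"
      then obtain f where f: "f \<in> F" "x = \<bar>\<mu> f - \<nu> f\<bar>" by blast
      show "x \<le> a + b"
        using bspec[OF ab(1) f(1)] bspec[OF ab(2) f(1)] f(2) by linarith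
    qed
  qed
  have ge: "\<bar>\<mu> f - \<nu> f\<bar> \<le> linf_dist F \<mu> \<nu>"
    if "\<mu> \<in> linf_space F" "\<nu> \<in> linf_space F" "f \<in> F" for \<mu> \<nu> f
    using cSUP_upper[OF that(3) bdd[OF that(1,2)]] False that by (simp add: linf_dist_def)
  have le: "linf_dist F \<mu> \<nu> \<le> c"
    if "\<mu> \<in> linf_space F" "\<nu> \<in> linf_space F" "\<And>f. f \<in> F \<Longrightarrow> \<bar>\<mu> f - \<nu> f\<bar> \<le> c" for \<mu> \<nu> c
    using cSUP_least[OF False that(3)] False that(1,2) by (simp add: linf_dist_def)
  obtain f0 where f0: "f0 \<in> F" using False by blast
  show ?thesis
  proof
    fix \<mu> \<nu> :: "'a \<Rightarrow> real"
    show "linf_dist F \<mu> \<nu> = linf_dist F \<nu> \<mu>"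
      by (auto simp: linf_dist_def abs_minus_commute)
    show "0 \<le> linf_dist F \<mu> \<nu>"
    proof (cases "\<mu> \<in> linf_space F \<and> \<nu> \<in> linf_space F")
      case True
      then show ?thesis using ge[of \<mu> \<nu> f0] f0 by linarith
    qed (auto simp: linf_dist_def)
  next
    fix \<mu> \<nu> assume in_space: "\<mu> \<in> linf_space F" "\<nu> \<in> linf_space F"
    show "linf_dist F \<mu> \<nu> = 0 \<longleftrightarrow> \<mu> = \<nu>"
    proof
      assume "linf_dist F \<mu> \<nu> = 0"
      then have "\<mu> f = \<nu> f" if "f \<in> F" for f
        using ge[OF in_space that] by simp
      then show "\<mu> = \<nu>"
        using in_space by (auto simp: linf_space_def intro: extensionalityI)
    next
      assume "\<mu> = \<nu>"
      then show "linf_dist F \<mu> \<nu> = 0"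
        using False by (simp add: linf_dist_def)
    qed
  next
    fix \<mu> \<nu> \<kappa> assume "\<mu> \<in> linf_space F" "\<nu> \<in> linf_space F" "\<kappa> \<in> linf_space F"
    then show "linf_dist F \<mu> \<kappa> \<le> linf_dist F \<mu> \<nu> + linf_dist F \<nu> \<kappa>"
    proof (intro le)
      fix f assume "f \<in> F"
      then have "\<bar>\<mu> f - \<nu> f\<bar> \<le> linf_dist F \<mu> \<nu>" "\<bar>\<nu> f - \<kappa> f\<bar> \<le> linf_dist F \<nu> \<kappa>"
        using \<open>\<mu> \<in> _\<close> \<open>\<nu> \<in> _\<close> \<open>\<kappa> \<in> _\<close> ge by blast+
      then show "\<bar>\<mu> f - \<kappa> f\<bar> \<le> linf_dist F \<mu> \<nu> + linf_dist F \<nu> \<kappa>"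
        by linarith
    qed
  qed
qed

lemma mspace_linf [simp]: "mspace (linf F) = linf_space F"
  and mdist_linf [simp]: "mdist (linf F) = linf_dist F"
  by (simp_all add: linf_def Metric_space.mspace_metric Metric_space.mdist_metric Metric_space_linf)


section \<open>Convergence in outer distribution\<close>

text \<open>The expectation of an extended-real random variable exists when its positive part or its
  negative part has finite integral; \<^const>\<open>e2ennreal\<close> truncates at \<open>0\<close> from below.\<close>

definition ereal_expectation_exists :: "'a measure \<Rightarrow> ('a \<Rightarrow> ereal) \<Rightarrow> bool" where
  "ereal_expectation_exists M U \<longleftrightarrow>
     (\<integral>\<^sup>+\<omega>. e2ennreal (U \<omega>) \<partial>M) \<noteq> \<infinity> \<or> (\<integral>\<^sup>+\<omega>. e2ennreal (- U \<omega>) \<partial>M) \<noteq> \<infinity>"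

definition ereal_expectation :: "'a measure \<Rightarrow> ('a \<Rightarrow> ereal) \<Rightarrow> ereal" where
  "ereal_expectation M U =
     enn2ereal (\<integral>\<^sup>+\<omega>. e2ennreal (U \<omega>) \<partial>M) - enn2ereal (\<integral>\<^sup>+\<omega>. e2ennreal (- U \<omega>) \<partial>M)"

definition outer_expectation :: "'a measure \<Rightarrow> ('a \<Rightarrow> ereal) \<Rightarrow> ereal" where
  "outer_expectation M T =
     Inf {ereal_expectation M U | U.
            U \<in> borel_measurable M \<and> ereal_expectation_exists M U \<and> (\<forall>\<omega>\<in>space M. T \<omega> \<le> U \<omega>)}"

definition borel_of_topology :: "'e topology \<Rightarrow> 'e measure" where
  "borel_of_topology X = sigma (topspace X) {U. openin X U}"

definition separably_valued :: "'e metric \<Rightarrow> 'a measure \<Rightarrow> ('a \<Rightarrow> 'e) \<Rightarrow> bool" where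
  "separably_valued E M Z \<longleftrightarrow>
     (\<exists>S \<subseteq> mspace E. separable_space (subtopology (mtopology_of E) S) \<and> Z \<in> space M \<rightarrow> S)"

definition borel_on_range :: "'e metric \<Rightarrow> 'a measure \<Rightarrow> ('a \<Rightarrow> 'e) \<Rightarrow> bool" where
  "borel_on_range E M Z \<longleftrightarrow>
     Z \<in> M \<rightarrow>\<^sub>M borel_of_topology (subtopology (mtopology_of E) (Z ` space M))"

text \<open>The \<open>Z n\<close> need not be measurable, and only their tail has to take values in \<open>E\<close>: the limit
  does not depend on finitely many of them.\<close>

definition converges_in_outer_distribution ::
    "'e metric \<Rightarrow> (nat \<Rightarrow> 'a measure) \<Rightarrow> (nat \<Rightarrow> 'a \<Rightarrow> 'e) \<Rightarrow> 'b measure \<Rightarrow> ('b \<Rightarrow> 'e) \<Rightarrow> bool" where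
  "converges_in_outer_distribution E M Z M0 Z0 \<longleftrightarrow>
     (\<forall>n. prob_space (M n)) \<and> prob_space M0 \<and>
     separably_valued E M0 Z0 \<and> borel_on_range E M0 Z0 \<and>
     (\<forall>\<^sub>F n in sequentially. Z n \<in> space (M n) \<rightarrow> mspace E) \<and>
     (\<forall>h. continuous_map (mtopology_of E) euclideanreal h \<and> bounded (h ` mspace E) \<longrightarrow>
        (\<lambda>n. outer_expectation (M n) (\<lambda>\<omega>. ereal (h (Z n \<omega>))))
          \<longlonglongrightarrow> ereal (\<integral>\<omega>. h (Z0 \<omega>) \<partial>M0))"


section \<open>Gaussian processes\<close>

text \<open>Point masses count as normal laws (\<open>s = 0\<close>).\<close>

definition normal_law :: "real \<Rightarrow> real \<Rightarrow> real measure" where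
  "normal_law m s = (if s = 0 then return borel m else density lborel (normal_density m s))"

text \<open>All finite-dimensional marginals are multivariate normal, i.e. all linear combinations of
  finitely many coordinates are normal.\<close>

definition gaussian_process :: "'b measure \<Rightarrow> 'i set \<Rightarrow> ('b \<Rightarrow> 'i \<Rightarrow> real) \<Rightarrow> bool" where
  "gaussian_process M F G \<longleftrightarrow>
     prob_space M \<and> (\<forall>f\<in>F. (\<lambda>\<omega>. G \<omega> f) \<in> borel_measurable M) \<and>
     (\<forall>S c. finite S \<and> S \<subseteq> F \<longrightarrow>
        (\<exists>m s. s \<ge> 0 \<and> distr M borel (\<lambda>\<omega>. \<Sum>f\<in>S. c f * G \<omega> f) = normal_law m s))"


section \<open>The regression model\<close>

text \<open>For square-integrable identically distributed \<open>\<eta>\<close> and absolutely summable \<open>\<psi>\<close> the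
  series converges almost surely; elsewhere the value is an arbitrary real number.\<close>

definition linear_process ::
    "(nat \<Rightarrow> real) \<Rightarrow> (int \<Rightarrow> 'a \<Rightarrow> real) \<Rightarrow> int \<Rightarrow> 'a \<Rightarrow> real" where
  "linear_process \<psi> \<eta> i \<omega> = (\<Sum>j. \<psi> j * \<eta> (i - int j) \<omega>)"

definition least_squares :: "nat \<Rightarrow> (nat \<Rightarrow> real) \<Rightarrow> (real \<Rightarrow> real) \<Rightarrow> real" where
  "least_squares n Y f =
     inverse (\<Sum>j=1..n. (f (real j / real n))\<^sup>2) * (\<Sum>j=1..n. Y j * f (real j / real n))"

text \<open>\<open>\<surd>n (\<beta>\<^sub>n - \<beta>)\<close> as a random function on \<open>F\<close>; the responses depend on the regressor \<open>f\<close>.\<close>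

definition regression_process ::
    "(real \<Rightarrow> real) set \<Rightarrow> real \<Rightarrow> (int \<Rightarrow> 'a \<Rightarrow> real) \<Rightarrow> nat \<Rightarrow> 'a \<Rightarrow> (real \<Rightarrow> real) \<Rightarrow> real" where
  "regression_process F \<beta> X n \<omega> =
     (\<lambda>f\<in>F. sqrt (real n) *
        (least_squares n (\<lambda>j. \<beta> * f (real j / real n) + X (int j) \<omega>) f - \<beta>))"

end

theory Submission
  imports Defs
begin

text \<open>Everything rests on a comparison of weighted sums \<open>\<Sum> f(j/n) (s\<^sub>j\<^sub>+\<^sub>1 - s\<^sub>j)\<close> of two paths that are
  uniformly close. A path is approximated at scale \<open>\<epsilon>\<close> by its greedy \<open>\<epsilon>\<close>-step function (the
  \<open>anchor\<close>), whose number of jumps is at most \<open>\<epsilon>\<^sup>-\<^sup>2\<close> times its energy, the sum of its squared jumps.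
  For partial sums of independent centred variables the expected energy is at most the variance, at
  every scale. Summation by parts against \<open>f\<close> of \<open>q\<close>-variation at most 1 and chaining over the scales
  \<open>\<epsilon> / 2^r\<close> leave a geometric series in \<open>(\<epsilon> / 2^r) powr (2/q - 1)\<close>, which converges because \<open>q < 2\<close>;
  so second moments suffice, uniformly in \<open>f\<close>.

  Consequently a shift of the innovations changes the weighted sums negligibly, and the linear process
  may be replaced by \<open>A\<^sub>\<psi> \<eta>\<close>; and \<open>\<eta>\<close> may be replaced by its sums over the \<open>2^k\<close> blocks of a dyadic
  grid. The central limit theorem applies to finitely many blocks. The limit integrates \<open>f\<close> against
  Brownian motion, built as a uniform limit of dyadic sums whose level-\<open>k\<close> increments arise from iid
  normal variables by Haar rotations. Finally, approximation uniformly in \<open>f\<close> and in probability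
  transfers convergence to outer expectations, first of Lipschitz functions and then, by monotone
  Lipschitz regularisation, of all bounded continuous ones.\<close>

section \<open>Weighted increments along a path\<close>

definition normed_variation :: "real \<Rightarrow> nat \<Rightarrow> (nat \<Rightarrow> real) \<Rightarrow> bool" where
  "normed_variation q n g \<longleftrightarrow> (\<forall>j\<le>n. \<bar>g j\<bar> \<le> 1) \<and>
     (\<forall>m t. (\<forall>i<m. t i < t (Suc i)) \<and> t 0 = 0 \<and> t m = n \<longrightarrow>
        (\<Sum>i<m. \<bar>g (t (Suc i)) - g (t i)\<bar> powr q) \<le> 1)"

lemma sum_le_linear_of_sum_powr_le:
  fixes d :: "nat \<Rightarrow> real"
  assumes "1 \<le> q" "b > 0" "\<And>i. i < m \<Longrightarrow> 0 \<le> d i" "(\<Sum>i<m. d i powr q) \<le> 1"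
  shows "(\<Sum>i<m. d i) \<le> real m * b + b powr (1 - q)"
proof -
  have *: "y \<le> b + y powr q * b powr (1 - q)" if "0 \<le> y" for y :: real
  proof (cases "y \<le> b")
    case True
    then show ?thesis by (simp add: add_increasing2)
  next
    case False
    then have "y > 0" "b \<le> y" using assms by auto
    have "y = y powr q * y powr (1 - q)"
      using \<open>y > 0\<close> by (simp flip: powr_add)
    also have "\<dots> \<le> y powr q * b powr (1 - q)"
      using assms \<open>b \<le> y\<close> by (intro mult_left_mono powr_mono2') auto
    finally show ?thesis using assms by linarith
  qed
  have "(\<Sum>i<m. d i) \<le> (\<Sum>i<m. b + d i powr q * b powr (1 - q))"
    by (intro sum_mono) (use * assms in auto)
  also have "\<dots> = real m * b + (\<Sum>i<m. d i powr q) * b powr (1 - q)"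
    by (simp add: sum.distrib sum_distrib_right)
  also have "\<dots> \<le> real m * b + 1 * b powr (1 - q)"
    by (intro add_left_mono mult_right_mono) (use assms in auto)
  finally show ?thesis by simp
qed

lemma strict_chain_mono:
  fixes t :: "nat \<Rightarrow> 'b::linorder"
  assumes "\<And>i. i < m \<Longrightarrow> t i < t (Suc i)" "i \<le> j" "j \<le> m"
  shows "t i \<le> t j"
  using assms(2,3)
proof (induction j)
  case (Suc j)
  show ?case
  proof (cases "i = Suc j")
    case False
    then have "t i \<le> t j" using Suc by auto
    also have "t j < t (Suc j)" using assms Suc by auto
    finally show ?thesis by simp
  qed simp
qed auto

lemma sum_chain_blocks:
  fixes t :: "nat \<Rightarrow> nat" and \<phi> :: "nat \<Rightarrow> real"
  assumes "\<And>i. i < m \<Longrightarrow> t i \<le> t (Suc i)"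
  shows "(\<Sum>j\<in>{t 0..<t m}. \<phi> j) = (\<Sum>i<m. \<Sum>j\<in>{t i..<t (Suc i)}. \<phi> j)"
  using assms
proof (induction m)
  case (Suc m)
  note step = Suc.prems
  have "t 0 \<le> t j" if "j \<le> m" for j
    using that
  proof (induction j)
    case (Suc j)
    then show ?case using step[of j] by simp
  qed simp
  from this[of m] have "t 0 \<le> t m" by simp
  then have "(\<Sum>j\<in>{t 0..<t (Suc m)}. \<phi> j) = (\<Sum>j\<in>{t 0..<t m}. \<phi> j) + (\<Sum>j\<in>{t m..<t (Suc m)}. \<phi> j)"
    using sum.atLeastLessThan_concat[of "t 0" "t m" "t (Suc m)" \<phi>] Suc.prems[of m] by simp
  then show ?case using Suc.IH Suc.prems by simp
qed simp

lemma finite_set_enumeration: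
  fixes P :: "nat set"
  assumes "finite P" "0 \<in> P" "n \<in> P" "\<And>p. p \<in> P \<Longrightarrow> p \<le> n"
  shows "\<exists>t. (\<forall>i<card P - 1. t i < t (Suc i)) \<and> t 0 = 0 \<and> t (card P - 1) = n \<and> P = t ` {..card P - 1}"
proof -
  define xs where "xs = sorted_list_of_set P"
  have xs: "set xs = P" "sorted xs" "distinct xs" "length xs = card P"
    using assms by (auto simp: xs_def)
  have pos: "card P > 0" using assms card_gt_0_iff by blast
  have lt: "xs ! i < xs ! j" if "i < j" "j < length xs" for i j
    using xs that by (meson sorted_wrt_nth_less strict_sorted_iff)
  have P: "P = (!) xs ` {..card P - 1}"
  proof -
    have "P = (!) xs ` {..<length xs}" using xs by (auto simp: set_conv_nth)
    moreover have "{..<length xs} = {..card P - 1}" using pos xs by auto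
    ultimately show ?thesis by metis
  qed
  obtain i where i: "i \<le> card P - 1" "xs ! i = 0" using assms P by (metis (no_types, lifting) atMost_iff imageE)
  obtain j where j: "j \<le> card P - 1" "xs ! j = n" using assms P by (metis (no_types, lifting) atMost_iff imageE)
  have "\<forall>i<card P - 1. xs ! i < xs ! Suc i" using xs by (intro allI impI lt) auto
  moreover have "xs ! 0 = 0"
  proof -
    have "i < length xs" using i pos xs by linarith
    then show "xs ! 0 = 0" using i lt[of 0 i] by (cases "i = 0") auto
  qed
  moreover have "xs ! (card P - 1) = n"
  proof -
    have "xs ! (card P - 1) \<in> P" using xs pos by (metis diff_less nth_mem zero_less_one)
    then have "xs ! (card P - 1) \<le> n" by (rule assms(4))
    moreover have "j < card P - 1 \<Longrightarrow> n < xs ! (card P - 1)" using j lt[of j "card P - 1"] xs pos by auto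
    ultimately show ?thesis using j by (cases "j = card P - 1") auto
  qed
  ultimately show ?thesis using P by blast
qed

lemma sum_against_step_le:
  fixes u g :: "nat \<Rightarrow> real"
  assumes g: "normed_variation q n g" and q: "1 \<le> q" and b: "b > 0" and n: "n \<ge> 1"
    and u: "\<And>j. j \<le> n \<Longrightarrow> \<bar>u j\<bar> \<le> c"
  shows "\<bar>\<Sum>j<n. u j * (g (Suc j) - g j)\<bar> \<le>
           c * ((1 + real (card {j. j < n \<and> u (Suc j) \<noteq> u j})) * b + b powr (1 - q))"
proof -
  define P where "P = insert 0 (insert n (Suc ` {j. Suc j < n \<and> u (Suc j) \<noteq> u j}))"
  have c: "c \<ge> 0" using u[of 0] by auto
  have fin: "finite {j. Suc j < n \<and> u (Suc j) \<noteq> u j}"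
    by (rule finite_subset[of _ "{..n}"]) auto
  then have "finite P" by (simp add: P_def)
  moreover have "0 \<in> P" "n \<in> P" "\<And>p. p \<in> P \<Longrightarrow> p \<le> n" by (auto simp: P_def)
  ultimately obtain t where t': "\<forall>i<card P - 1. t i < t (Suc i)" "t 0 = 0" "t (card P - 1) = n"
    "P = t ` {..card P - 1}"
    using finite_set_enumeration[of P n] by blast
  define m where "m = card P - 1"
  have t: "m = card P - 1" "\<And>i. i < m \<Longrightarrow> t i < t (Suc i)" "t 0 = 0" "t m = n" "P = t ` {..m}"
    using t' by (auto simp: m_def)
  have m: "real m \<le> 1 + real (card {j. j < n \<and> u (Suc j) \<noteq> u j})"
  proof -
    have "card P \<le> Suc (Suc (card (Suc ` {j. Suc j < n \<and> u (Suc j) \<noteq> u j})))"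
      using fin by (simp add: P_def card_insert_if)
    also have "card (Suc ` {j. Suc j < n \<and> u (Suc j) \<noteq> u j}) \<le> card {j. j < n \<and> u (Suc j) \<noteq> u j}"
      by (rule order_trans[OF card_image_le[OF fin]]) (auto intro!: card_mono)
    finally show ?thesis using t(1) by linarith
  qed
  have "\<forall>i<m. t i < t (Suc i)" using t(2) by blast
  then have var: "(\<Sum>i<m. \<bar>g (t (Suc i)) - g (t i)\<bar> powr q) \<le> 1"
    using g t(3,4) unfolding normed_variation_def by blast
  have const: "u j = u (t i)" if "i < m" "t i \<le> j" "j < t (Suc i)" for i j
    using that(2,3)
  proof (induction j rule: dec_induct)
    case (step j)
    have "Suc j \<notin> P"
    proof
      assume "Suc j \<in> P"
      then obtain k where k: "k \<le> m" "Suc j = t k" using t(5) by auto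
      show False
      proof (cases "k \<le> i")
        case True
        then have "t k \<le> t i" using strict_chain_mono[of m t k i] t(2) that by auto
        then show ?thesis using k step by auto
      next
        case False
        then have "t (Suc i) \<le> t k" using strict_chain_mono[of m t "Suc i" k] t(2) k by auto
        then show ?thesis using k step by auto
      qed
    qed
    moreover have "t (Suc i) \<le> n" using strict_chain_mono[of m t "Suc i" m] t(2,4) that by auto
    ultimately have "u (Suc j) = u j" using step unfolding P_def by auto
    then show ?case using step by simp
  qed simp
  have "(\<Sum>j<n. u j * (g (Suc j) - g j)) = (\<Sum>j\<in>{t 0..<t m}. u j * (g (Suc j) - g j))"
    by (simp add: t(3,4) atLeast0LessThan)
  also have "\<dots> = (\<Sum>i<m. \<Sum>j\<in>{t i..<t (Suc i)}. u j * (g (Suc j) - g j))"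
    by (rule sum_chain_blocks) (simp add: t(2) less_imp_le)
  also have "\<dots> = (\<Sum>i<m. u (t i) * (g (t (Suc i)) - g (t i)))"
  proof (rule sum.cong[OF refl])
    fix i assume "i \<in> {..<m}"
    then have "(\<Sum>j\<in>{t i..<t (Suc i)}. u j * (g (Suc j) - g j)) =
      (\<Sum>j\<in>{t i..<t (Suc i)}. u (t i) * (g (Suc j) - g j))"
      by (intro sum.cong refl arg_cong2[where f = "(*)"] const) auto
    also have "\<dots> = u (t i) * (g (t (Suc i)) - g (t i))"
      using t(2)[of i] \<open>i \<in> _\<close> by (simp flip: sum_distrib_left add: sum_Suc_diff' less_imp_le)
    finally show "(\<Sum>j\<in>{t i..<t (Suc i)}. u j * (g (Suc j) - g j)) = u (t i) * (g (t (Suc i)) - g (t i))" .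
  qed
  finally have *: "\<bar>\<Sum>j<n. u j * (g (Suc j) - g j)\<bar> \<le> (\<Sum>i<m. \<bar>u (t i) * (g (t (Suc i)) - g (t i))\<bar>)"
    by (simp add: sum_abs)
  note *
  also have "(\<Sum>i<m. \<bar>u (t i) * (g (t (Suc i)) - g (t i))\<bar>) \<le> (\<Sum>i<m. c * \<bar>g (t (Suc i)) - g (t i)\<bar>)"
  proof (rule sum_mono)
    fix i assume "i \<in> {..<m}"
    then have "t i \<le> n" using strict_chain_mono[of m t i m] t(2,4) by auto
    then show "\<bar>u (t i) * (g (t (Suc i)) - g (t i))\<bar> \<le> c * \<bar>g (t (Suc i)) - g (t i)\<bar>"
      using u by (simp add: abs_mult mult_right_mono)
  qed
  also have "\<dots> = c * (\<Sum>i<m. \<bar>g (t (Suc i)) - g (t i)\<bar>)"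
    by (simp add: sum_distrib_left)
  also have "\<dots> \<le> c * (real m * b + b powr (1 - q))"
    by (intro mult_left_mono sum_le_linear_of_sum_powr_le q b c var abs_ge_zero)
  also have "\<dots> \<le> c * ((1 + real (card {j. j < n \<and> u (Suc j) \<noteq> u j})) * b + b powr (1 - q))"
    by (intro mult_left_mono add_right_mono mult_right_mono m c less_imp_le[OF b])
  finally show ?thesis .
qed

fun anchor :: "real \<Rightarrow> (nat \<Rightarrow> real) \<Rightarrow> nat \<Rightarrow> real" where
  "anchor \<epsilon> s 0 = s 0"
| "anchor \<epsilon> s (Suc j) = (if \<bar>s (Suc j) - anchor \<epsilon> s j\<bar> \<ge> \<epsilon> then s (Suc j) else anchor \<epsilon> s j)"

declare anchor.simps(2) [simp del]

definition energy :: "real \<Rightarrow> (nat \<Rightarrow> real) \<Rightarrow> nat \<Rightarrow> real" where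
  "energy \<epsilon> s n = (\<Sum>j<n. (anchor \<epsilon> s (Suc j) - anchor \<epsilon> s j)\<^sup>2)"

lemma energy_nonneg: "0 \<le> energy \<epsilon> s n"
  by (simp add: energy_def sum_nonneg)

lemma anchor_close: "\<epsilon> > 0 \<Longrightarrow> \<bar>s j - anchor \<epsilon> s j\<bar> < \<epsilon>"
  by (cases j) (auto simp: anchor.simps(2))

lemma anchor_jump: "anchor \<epsilon> s (Suc j) \<noteq> anchor \<epsilon> s j \<Longrightarrow> \<bar>anchor \<epsilon> s (Suc j) - anchor \<epsilon> s j\<bar> \<ge> \<epsilon>"
  by (auto simp: anchor.simps(2) split: if_splits)

lemma card_anchor_jumps:
  assumes "\<epsilon> > 0"
  shows "\<epsilon>\<^sup>2 * real (card {j. j < n \<and> anchor \<epsilon> s (Suc j) \<noteq> anchor \<epsilon> s j}) \<le> energy \<epsilon> s n"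
proof -
  let ?A = "{j. j < n \<and> anchor \<epsilon> s (Suc j) \<noteq> anchor \<epsilon> s j}"
  have "\<epsilon>\<^sup>2 * real (card ?A) = (\<Sum>j\<in>?A. \<epsilon>\<^sup>2)" by simp
  also have "\<dots> \<le> (\<Sum>j\<in>?A. (anchor \<epsilon> s (Suc j) - anchor \<epsilon> s j)\<^sup>2)"
  proof (rule sum_mono)
    fix j assume "j \<in> ?A"
    then have "\<epsilon> \<le> \<bar>anchor \<epsilon> s (Suc j) - anchor \<epsilon> s j\<bar>" using anchor_jump by blast
    then show "\<epsilon>\<^sup>2 \<le> (anchor \<epsilon> s (Suc j) - anchor \<epsilon> s j)\<^sup>2"
      using power_mono[of \<epsilon> _ 2] assms by fastforce
  qed
  also have "\<dots> \<le> energy \<epsilon> s n"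
    unfolding energy_def by (intro sum_mono2) auto
  finally show ?thesis .
qed

lemma sum_against_anchor_diff_le:
  assumes g: "normed_variation q n g" and q: "1 \<le> q" and n: "n \<ge> 1" and \<epsilon>: "0 < \<epsilon>" "\<epsilon> \<le> 1"
    and \<epsilon>': "0 < \<epsilon>'" and \<mu>: "0 < \<mu>"
    and close: "\<And>j. j \<le> n \<Longrightarrow> \<bar>anchor \<epsilon>' s j - anchor \<mu> s' j\<bar> \<le> c * \<epsilon>"
  shows "\<bar>\<Sum>j<n. (anchor \<epsilon>' s j - anchor \<mu> s' j) * (g (Suc j) - g j)\<bar> \<le>
     c * \<epsilon> powr (2/q - 1) * (2 + (\<epsilon>/\<epsilon>')\<^sup>2 * energy \<epsilon>' s n + (\<epsilon>/\<mu>)\<^sup>2 * energy \<mu> s' n)"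
proof -
  let ?u = "\<lambda>j. anchor \<epsilon>' s j - anchor \<mu> s' j"
  let ?A = "{j. j < n \<and> anchor \<epsilon>' s (Suc j) \<noteq> anchor \<epsilon>' s j}"
  let ?B = "{j. j < n \<and> anchor \<mu> s' (Suc j) \<noteq> anchor \<mu> s' j}"
  let ?C = "{j. j < n \<and> ?u (Suc j) \<noteq> ?u j}"
  let ?b = "\<epsilon> powr (2/q)"
  have c: "0 \<le> c * \<epsilon>" using close[of 0] by linarith
  have c0: "0 \<le> c" using c \<epsilon> by (simp add: zero_le_mult_iff)
  have "card ?C \<le> card (?A \<union> ?B)" by (rule card_mono) auto
  also have "\<dots> \<le> card ?A + card ?B" by (rule card_Un_le)
  finally have "real (card ?C) \<le> real (card ?A) + real (card ?B)" by linarith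
  then have "\<epsilon>\<^sup>2 * real (card ?C) \<le> \<epsilon>\<^sup>2 * real (card ?A) + \<epsilon>\<^sup>2 * real (card ?B)"
    using mult_left_mono[of "real (card ?C)" "real (card ?A) + real (card ?B)" "\<epsilon>\<^sup>2"] by (simp add: distrib_left)
  also have "\<epsilon>\<^sup>2 * real (card ?A) = (\<epsilon>/\<epsilon>')\<^sup>2 * (\<epsilon>'\<^sup>2 * real (card ?A))"
    using \<epsilon>' by (simp add: power_divide)
  also have "\<epsilon>\<^sup>2 * real (card ?B) = (\<epsilon>/\<mu>)\<^sup>2 * (\<mu>\<^sup>2 * real (card ?B))"
    using \<mu> by (simp add: power_divide)
  also have "(\<epsilon>/\<epsilon>')\<^sup>2 * (\<epsilon>'\<^sup>2 * real (card ?A)) + (\<epsilon>/\<mu>)\<^sup>2 * (\<mu>\<^sup>2 * real (card ?B)) \<le>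
     (\<epsilon>/\<epsilon>')\<^sup>2 * energy \<epsilon>' s n + (\<epsilon>/\<mu>)\<^sup>2 * energy \<mu> s' n"
    by (intro add_mono mult_left_mono card_anchor_jumps \<epsilon>' \<mu>) auto
  finally have C: "\<epsilon>\<^sup>2 * real (card ?C) \<le> (\<epsilon>/\<epsilon>')\<^sup>2 * energy \<epsilon>' s n + (\<epsilon>/\<mu>)\<^sup>2 * energy \<mu> s' n" .
  have p: "\<epsilon> * ?b = \<epsilon> powr (2/q - 1) * \<epsilon>\<^sup>2" "\<epsilon> * ?b powr (1 - q) = \<epsilon> powr (2/q - 1)"
  proof -
    have "\<epsilon> * ?b = \<epsilon> powr 1 * ?b" using \<epsilon> by simp
    also have "\<dots> = \<epsilon> powr (2/q - 1) * \<epsilon> powr 2" unfolding powr_add[symmetric] by simp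
    finally show "\<epsilon> * ?b = \<epsilon> powr (2/q - 1) * \<epsilon>\<^sup>2" using \<epsilon> by simp
    have "\<epsilon> * ?b powr (1 - q) = \<epsilon> powr 1 * \<epsilon> powr ((2/q) * (1 - q))" using \<epsilon> by (simp add: powr_powr)
    also have "\<dots> = \<epsilon> powr (1 + (2/q) * (1 - q))" unfolding powr_add[symmetric] by simp
    also have "1 + (2/q) * (1 - q) = 2/q - 1" using q by (simp add: field_simps)
    finally show "\<epsilon> * ?b powr (1 - q) = \<epsilon> powr (2/q - 1)" .
  qed
  have "\<bar>\<Sum>j<n. ?u j * (g (Suc j) - g j)\<bar> \<le> (c * \<epsilon>) * ((1 + real (card ?C)) * ?b + ?b powr (1 - q))"
    by (rule sum_against_step_le[OF g q _ n close]) (use \<epsilon> in auto)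
  also have "\<dots> = c * ((1 + real (card ?C)) * (\<epsilon> * ?b) + \<epsilon> * ?b powr (1 - q))"
    by (simp add: algebra_simps)
  also have "\<dots> = c * \<epsilon> powr (2/q - 1) * (\<epsilon>\<^sup>2 + \<epsilon>\<^sup>2 * real (card ?C) + 1)"
    unfolding p by (simp only: distrib_left distrib_right mult_1_left mult_1_right ac_simps)
  also have "\<dots> \<le> c * \<epsilon> powr (2/q - 1) * (2 + (\<epsilon>/\<epsilon>')\<^sup>2 * energy \<epsilon>' s n + (\<epsilon>/\<mu>)\<^sup>2 * energy \<mu> s' n)"
    using C power_le_one[of \<epsilon> 2] \<epsilon>
    by (intro mult_left_mono mult_nonneg_nonneg c0 powr_ge_zero) linarith
  finally show ?thesis .
qed

text \<open>The first summand bounds the scales beyond \<open>2n\<close>, where the trivial estimate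
  \<open>n * 2 * \<epsilon> / 4^n \<le> \<epsilon>\<close> suffices.\<close>

definition chain_bound :: "real \<Rightarrow> real \<Rightarrow> nat \<Rightarrow> (nat \<Rightarrow> real) \<Rightarrow> real" where
  "chain_bound q \<epsilon> n s = \<epsilon> + (\<Sum>r<2*n. 2 * (\<epsilon>/2^r) powr (2/q - 1) *
      (2 + energy (\<epsilon>/2^r) s n + 4 * energy (\<epsilon>/2^Suc r) s n))"

lemma chain_bound_nonneg: "0 < \<epsilon> \<Longrightarrow> 0 \<le> chain_bound q \<epsilon> n s"
  unfolding chain_bound_def
  by (intro add_nonneg_nonneg sum_nonneg mult_nonneg_nonneg) (auto simp: energy_nonneg)

lemma sum_against_minus_anchor_le:
  assumes g: "normed_variation q n g" and q: "1 \<le> q" and n: "n \<ge> 1" and \<epsilon>: "0 < \<epsilon>" "\<epsilon> \<le> 1"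
  shows "\<bar>\<Sum>j<n. (s j - anchor \<epsilon> s j) * (g (Suc j) - g j)\<bar> \<le> chain_bound q \<epsilon> n s"
proof -
  define l where "l r = \<epsilon>/2^r" for r :: nat
  have l: "0 < l r" "l r \<le> 1" for r
  proof -
    show "0 < l r" using \<epsilon> by (simp add: l_def)
    have "\<epsilon> \<le> 1 * 2^r" using \<epsilon> one_le_power[of "2::real" r] by linarith
    then show "l r \<le> 1" by (simp add: l_def divide_le_eq)
  qed
  have rem: "\<bar>\<Sum>j<n. (s j - anchor (l r) s j) * (g (Suc j) - g j)\<bar> \<le> l r * (2 * n)" for r
  proof -
    have "\<bar>\<Sum>j<n. (s j - anchor (l r) s j) * (g (Suc j) - g j)\<bar> \<le>
       (\<Sum>j<n. \<bar>(s j - anchor (l r) s j) * (g (Suc j) - g j)\<bar>)" by (rule sum_abs)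
    also have "\<dots> \<le> (\<Sum>j<n. l r * 2)"
    proof (rule sum_mono)
      fix j assume "j \<in> {..<n}"
      then have "\<bar>g (Suc j)\<bar> \<le> 1" "\<bar>g j\<bar> \<le> 1" using g by (auto simp: normed_variation_def)
      then have "\<bar>g (Suc j) - g j\<bar> \<le> 2" by linarith
      then show "\<bar>(s j - anchor (l r) s j) * (g (Suc j) - g j)\<bar> \<le> l r * 2"
        unfolding abs_mult using anchor_close[OF l(1), of s j r] l(1)[of r] by (intro mult_mono) auto
    qed
    finally show ?thesis by (simp add: mult_ac)
  qed
  have step: "\<bar>\<Sum>j<n. (anchor (l (Suc r)) s j - anchor (l r) s j) * (g (Suc j) - g j)\<bar> \<le>
      2 * l r powr (2/q - 1) * (2 + energy (l r) s n + 4 * energy (l (Suc r)) s n)" for r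
  proof -
    have "\<bar>anchor (l (Suc r)) s j - anchor (l r) s j\<bar> \<le> 2 * l r" for j
      using anchor_close[OF l(1), of s j r] anchor_close[OF l(1), of s j "Suc r"] l(1)[of r]
      by (auto simp: l_def)
    note sum_against_anchor_diff_le[OF g q n l[of r] l(1)[of "Suc r"] l(1)[of r], OF this]
    moreover have "(l r / l (Suc r))\<^sup>2 = 4" "(l r / l r)\<^sup>2 = 1" using \<epsilon> by (auto simp: l_def)
    ultimately show ?thesis by (simp add: algebra_simps)
  qed
  have "\<bar>\<Sum>j<n. (s j - anchor \<epsilon> s j) * (g (Suc j) - g j)\<bar> \<le>
     (\<Sum>r<R. 2 * l r powr (2/q - 1) * (2 + energy (l r) s n + 4 * energy (l (Suc r)) s n)) + l R * (2 * n)" for R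
  proof -
    have *: "(\<Sum>j<n. (s j - anchor \<epsilon> s j) * (g (Suc j) - g j)) =
      (\<Sum>r<R. \<Sum>j<n. (anchor (l (Suc r)) s j - anchor (l r) s j) * (g (Suc j) - g j)) +
      (\<Sum>j<n. (s j - anchor (l R) s j) * (g (Suc j) - g j))"
    proof (induction R)
      case 0
      show ?case by (simp add: l_def)
    next
      case (Suc R)
      have "(\<Sum>j<n. (s j - anchor (l R) s j) * (g (Suc j) - g j)) =
        (\<Sum>j<n. (anchor (l (Suc R)) s j - anchor (l R) s j) * (g (Suc j) - g j)) +
        (\<Sum>j<n. (s j - anchor (l (Suc R)) s j) * (g (Suc j) - g j))"
        unfolding sum.distrib[symmetric] by (intro sum.cong) (auto simp: algebra_simps)
      then show ?case using Suc by simp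
    qed
    have "\<bar>\<Sum>j<n. (s j - anchor \<epsilon> s j) * (g (Suc j) - g j)\<bar> \<le> \<bar>\<Sum>r<R. \<Sum>j<n. (anchor (l (Suc r)) s j - anchor (l r) s j) * (g (Suc j) - g j)\<bar> +
      \<bar>\<Sum>j<n. (s j - anchor (l R) s j) * (g (Suc j) - g j)\<bar>" unfolding * by (rule abs_triangle_ineq)
    also have "\<dots> \<le> (\<Sum>r<R. 2 * l r powr (2/q - 1) * (2 + energy (l r) s n + 4 * energy (l (Suc r)) s n)) + l R * (2 * n)"
    proof (rule add_mono[OF _ rem])
      show "\<bar>\<Sum>r<R. \<Sum>j<n. (anchor (l (Suc r)) s j - anchor (l r) s j) * (g (Suc j) - g j)\<bar> \<le>
        (\<Sum>r<R. 2 * l r powr (2/q - 1) * (2 + energy (l r) s n + 4 * energy (l (Suc r)) s n))"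
        by (rule order_trans[OF sum_abs]) (rule sum_mono, rule step)
    qed
    finally show ?thesis .
  qed
  from this[of "2*n"] show ?thesis
  proof (rule order_trans)
    have "real (2*n) \<le> 2^(2*n)" by (metis less_imp_le of_nat_less_two_power)
    then have "l (2*n) * (2*n) \<le> \<epsilon>" using \<epsilon> by (simp add: l_def field_simps)
    then show "(\<Sum>r<2*n. 2 * l r powr (2/q - 1) * (2 + energy (l r) s n + 4 * energy (l (Suc r)) s n)) + l (2*n) * (2*n)
       \<le> chain_bound q \<epsilon> n s"
      unfolding chain_bound_def l_def by simp
  qed
qed

lemma sum_by_parts:
  fixes u g :: "nat \<Rightarrow> real"
  shows "(\<Sum>j<n. g (Suc j) * (u (Suc j) - u j)) = g n * u n - g 0 * u 0 - (\<Sum>j<n. u j * (g (Suc j) - g j))"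
  by (induction n) (auto simp: algebra_simps)

definition comparison_bound :: "real \<Rightarrow> real \<Rightarrow> nat \<Rightarrow> (nat \<Rightarrow> real) \<Rightarrow> (nat \<Rightarrow> real) \<Rightarrow> real" where
  "comparison_bound q \<epsilon> n s s' = \<epsilon> + chain_bound q \<epsilon> n s + chain_bound q \<epsilon> n s' +
     3 * \<epsilon> powr (2/q - 1) * (2 + energy \<epsilon> s n + energy \<epsilon> s' n)"

lemma weighted_increments_comparison:
  assumes g: "normed_variation q n g" and q: "1 \<le> q" and n: "n \<ge> 1" and \<epsilon>: "0 < \<epsilon>" "\<epsilon> \<le> 1"
    and s0: "s 0 = 0" "s' 0 = 0" and close: "\<And>j. j \<le> n \<Longrightarrow> \<bar>s j - s' j\<bar> \<le> \<epsilon>"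
  shows "\<bar>(\<Sum>j<n. g (Suc j) * (s (Suc j) - s j)) - (\<Sum>j<n. g (Suc j) * (s' (Suc j) - s' j))\<bar> \<le>
    comparison_bound q \<epsilon> n s s'"
proof -
  let ?a = "anchor \<epsilon> s" and ?a' = "anchor \<epsilon> s'"
  let ?K = "\<lambda>u. \<Sum>j<n. u j * (g (Suc j) - g j)"
  have "\<bar>?a j - ?a' j\<bar> \<le> 3 * \<epsilon>" if "j \<le> n" for j
    using anchor_close[OF \<epsilon>(1), of s j] anchor_close[OF \<epsilon>(1), of s' j] close[OF that] by linarith
  note sum_against_anchor_diff_le[OF g q n \<epsilon> \<epsilon>(1) \<epsilon>(1), OF this]
  then have 1: "\<bar>?K (\<lambda>j. ?a j - ?a' j)\<bar> \<le> 3 * \<epsilon> powr (2/q - 1) * (2 + energy \<epsilon> s n + energy \<epsilon> s' n)"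
    using \<epsilon> by simp
  have 2: "\<bar>?K (\<lambda>j. s j - ?a j)\<bar> \<le> chain_bound q \<epsilon> n s" "\<bar>?K (\<lambda>j. s' j - ?a' j)\<bar> \<le> chain_bound q \<epsilon> n s'"
    by (rule sum_against_minus_anchor_le[OF g q n \<epsilon>])+
  have "(\<Sum>j<n. g (Suc j) * (s (Suc j) - s j)) - (\<Sum>j<n. g (Suc j) * (s' (Suc j) - s' j)) =
    g n * (s n - s' n) - ?K (\<lambda>j. s j - ?a j) + ?K (\<lambda>j. s' j - ?a' j) - ?K (\<lambda>j. ?a j - ?a' j)"
    unfolding sum_by_parts s0 by (simp add: algebra_simps sum.distrib sum_subtractf)
  moreover have "\<bar>g n * (s n - s' n)\<bar> \<le> 1 * \<epsilon>"
    unfolding abs_mult using g close[of n] by (intro mult_mono) (auto simp: normed_variation_def)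
  ultimately show ?thesis unfolding comparison_bound_def using 1 2 by linarith
qed

lemma weighted_increments_bound:
  assumes g: "normed_variation q n g" and q: "1 \<le> q" and n: "n \<ge> 1" and s0: "s 0 = 0"
  shows "\<bar>\<Sum>j<n. g (Suc j) * (s (Suc j) - s j)\<bar> \<le> energy 1 s n + 1 + chain_bound q 1 n s"
proof -
  let ?a = "anchor 1 s"
  let ?K = "\<lambda>u. \<Sum>j<n. u j * (g (Suc j) - g j)"
  have 1: "\<bar>?K (\<lambda>j. s j - ?a j)\<bar> \<le> chain_bound q 1 n s"
    by (rule sum_against_minus_anchor_le[OF g q n]) auto
  have "\<bar>\<Sum>j<n. g (Suc j) * (?a (Suc j) - ?a j)\<bar> \<le> (\<Sum>j<n. \<bar>g (Suc j) * (?a (Suc j) - ?a j)\<bar>)"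
    by (rule sum_abs)
  also have "\<dots> \<le> (\<Sum>j<n. (?a (Suc j) - ?a j)\<^sup>2)"
  proof (rule sum_mono)
    fix j assume j: "j \<in> {..<n}"
    have "\<bar>g (Suc j) * (?a (Suc j) - ?a j)\<bar> \<le> 1 * \<bar>?a (Suc j) - ?a j\<bar>"
      unfolding abs_mult using g j by (intro mult_right_mono) (auto simp: normed_variation_def)
    also have "\<dots> \<le> \<bar>?a (Suc j) - ?a j\<bar>\<^sup>2"
    proof (cases "?a (Suc j) = ?a j")
      case False
      then have "1 \<le> \<bar>?a (Suc j) - ?a j\<bar>" using anchor_jump by blast
      then show ?thesis using power_increasing[of 1 2 "\<bar>?a (Suc j) - ?a j\<bar>"] by simp
    qed simp
    finally show "\<bar>g (Suc j) * (?a (Suc j) - ?a j)\<bar> \<le> (?a (Suc j) - ?a j)\<^sup>2" by simp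
  qed
  finally have 2: "\<bar>\<Sum>j<n. g (Suc j) * (?a (Suc j) - ?a j)\<bar> \<le> energy 1 s n" by (simp add: energy_def)
  have "(\<Sum>j<n. g (Suc j) * (s (Suc j) - s j)) =
    (\<Sum>j<n. g (Suc j) * (?a (Suc j) - ?a j)) + g n * (s n - ?a n) - ?K (\<lambda>j. s j - ?a j)"
    unfolding sum_by_parts using s0 by (simp add: algebra_simps sum.distrib sum_subtractf)
  moreover have "\<bar>g n * (s n - ?a n)\<bar> \<le> 1 * 1"
    unfolding abs_mult using g anchor_close[of 1 s n] by (intro mult_mono) (auto simp: normed_variation_def)
  ultimately show ?thesis using 1 2 by linarith
qed

section \<open>Second moments and maximal inequalities\<close>

lemma (in prob_space) indep_vars_block_sums:
  fixes \<zeta> :: "'i \<Rightarrow> 'a \<Rightarrow> real"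
  assumes "indep_vars (\<lambda>_. borel) \<zeta> I" "\<And>l. l \<in> L \<Longrightarrow> finite (B l)" "\<And>l. l \<in> L \<Longrightarrow> B l \<subseteq> I"
    "disjoint_family_on B L"
  shows "indep_vars (\<lambda>_. borel) (\<lambda>l \<omega>. \<Sum>i\<in>B l. \<zeta> i \<omega>) L"
proof -
  have "indep_vars (\<lambda>j. PiM (B j) (\<lambda>_. borel)) (\<lambda>j \<omega>. restrict (\<lambda>i. \<zeta> i \<omega>) (B j)) L"
    by (rule indep_vars_restrict[OF assms(1) assms(3,4)])
  then have "indep_vars (\<lambda>_. borel) (\<lambda>j \<omega>. (\<lambda>f. \<Sum>i\<in>B j. f i) (restrict (\<lambda>i. \<zeta> i \<omega>) (B j))) L"
    by (rule indep_vars_compose2[where Y = "\<lambda>j f. \<Sum>i\<in>B j. f i"])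
      (auto intro!: borel_measurable_sum measurable_component_singleton)
  then show ?thesis by (simp cong: sum.cong)
qed

lemma (in prob_space) indep_state:
  fixes \<xi> :: "nat \<Rightarrow> 'a \<Rightarrow> real" and y :: "nat \<Rightarrow> 'a \<Rightarrow> real"
  assumes ind: "indep_vars (\<lambda>_. borel) \<xi> UNIV"
    and \<Phi>: "case_prod \<Phi> \<in> borel_measurable (borel \<Otimes>\<^sub>M borel)"
    and y: "\<And>\<omega>. y 0 \<omega> = c" "\<And>j \<omega>. y (Suc j) \<omega> = \<Phi> (y j \<omega>) (\<xi> j \<omega>)"
  shows "indep_var borel (y j) borel (\<xi> j)"
proof -
  define G where "G j x = rec_nat c (\<lambda>i r. \<Phi> r (x i)) j" for j and x :: "nat \<Rightarrow> real"
  have G: "G 0 x = c" "G (Suc j) x = \<Phi> (G j x) (x j)" for j x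
    by (simp_all add: G_def)
  have "G i \<in> borel_measurable (PiM {..<j} (\<lambda>_. borel))" if "i \<le> j" for i
    using that
  proof (induction i)
    case 0
    then show ?case by (simp add: G(1)[abs_def])
  next
    case (Suc i)
    then have [measurable]: "G i \<in> borel_measurable (PiM {..<j} (\<lambda>_. borel))"
      "(\<lambda>x. x i) \<in> borel_measurable (PiM {..<j} (\<lambda>_. borel :: real measure))"
      by (auto intro!: measurable_component_singleton)
    have "(\<lambda>x. case_prod \<Phi> (G i x, x i)) \<in> borel_measurable (PiM {..<j} (\<lambda>_. borel))"
      by (rule measurable_compose[OF _ \<Phi>]) measurable
    then show ?case by (simp add: G(2)[abs_def])
  qed
  then have Gm: "G j \<in> borel_measurable (PiM {..<j} (\<lambda>_. borel))" by simp
  have yG: "y i \<omega> = G i (restrict (\<lambda>i. \<xi> i \<omega>) {..<j})" if "i \<le> j" for i \<omega>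
    using that by (induction i) (auto simp: G y)
  have "indep_var borel (G j \<circ> (\<lambda>\<omega>. restrict (\<lambda>i. \<xi> i \<omega>) {..<j}))
      borel ((\<lambda>x. x j) \<circ> (\<lambda>\<omega>. restrict (\<lambda>i. \<xi> i \<omega>) {j}))"
    by (rule indep_var_compose[OF indep_var_restrict[OF ind] Gm]) auto
  moreover have "G j \<circ> (\<lambda>\<omega>. restrict (\<lambda>i. \<xi> i \<omega>) {..<j}) = y j"
    by (auto simp: yG)
  moreover have "(\<lambda>x. x j) \<circ> (\<lambda>\<omega>. restrict (\<lambda>i. \<xi> i \<omega>) {j}) = \<xi> j" by auto
  ultimately show ?thesis by simp
qed

definition anchor_gap :: "real \<Rightarrow> (nat \<Rightarrow> 'a \<Rightarrow> real) \<Rightarrow> nat \<Rightarrow> 'a \<Rightarrow> real" where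
  "anchor_gap \<epsilon> \<xi> j \<omega> = (\<Sum>i<j. \<xi> i \<omega>) - anchor \<epsilon> (\<lambda>j. \<Sum>i<j. \<xi> i \<omega>) j"

lemma anchor_gap_simps:
  "anchor_gap \<epsilon> \<xi> 0 \<omega> = 0"
  "anchor_gap \<epsilon> \<xi> (Suc j) \<omega> =
    (if \<bar>anchor_gap \<epsilon> \<xi> j \<omega> + \<xi> j \<omega>\<bar> \<ge> \<epsilon> then 0 else anchor_gap \<epsilon> \<xi> j \<omega> + \<xi> j \<omega>)"
  by (auto simp: anchor_gap_def anchor.simps(2) algebra_simps)

lemma anchor_increment:
  "anchor \<epsilon> (\<lambda>j. \<Sum>i<j. \<xi> i \<omega>) (Suc j) - anchor \<epsilon> (\<lambda>j. \<Sum>i<j. \<xi> i \<omega>) j =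
     (if \<bar>anchor_gap \<epsilon> \<xi> j \<omega> + \<xi> j \<omega>\<bar> \<ge> \<epsilon> then anchor_gap \<epsilon> \<xi> j \<omega> + \<xi> j \<omega> else 0)"
  by (auto simp: anchor_gap_def anchor.simps(2) algebra_simps)

lemma (in prob_space) indep_anchor_gap:
  assumes "indep_vars (\<lambda>_. borel) \<xi> UNIV"
  shows "indep_var borel (anchor_gap \<epsilon> \<xi> j) borel (\<xi> j)"
  by (rule indep_state[OF assms, where \<Phi> = "\<lambda>a b. if \<bar>a + b\<bar> \<ge> \<epsilon> then 0 else a + b" and c = 0])
    (auto simp: anchor_gap_simps case_prod_beta)

lemma (in prob_space) measurable_anchor_gap:
  assumes "\<And>j. \<xi> j \<in> borel_measurable M"
  shows "anchor_gap \<epsilon> \<xi> j \<in> borel_measurable M"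
proof (induction j)
  case (Suc j)
  note [measurable] = assms Suc
  show ?case unfolding anchor_gap_simps(2)[abs_def] by measurable
qed (simp add: anchor_gap_simps(1)[abs_def])

lemma (in prob_space) energy_expectation:
  fixes \<xi> :: "nat \<Rightarrow> 'a \<Rightarrow> real"
  assumes ind: "indep_vars (\<lambda>_. borel) \<xi> UNIV"
    and sq: "\<And>j. integrable M (\<lambda>\<omega>. (\<xi> j \<omega>)\<^sup>2)" and mean: "\<And>j. expectation (\<xi> j) = 0"
  shows "integrable M (\<lambda>\<omega>. (anchor_gap \<epsilon> \<xi> n \<omega>)\<^sup>2)" (is "?A n")
    and "integrable M (\<lambda>\<omega>. energy \<epsilon> (\<lambda>j. \<Sum>i<j. \<xi> i \<omega>) n)" (is "?B n")
    and "expectation (\<lambda>\<omega>. (anchor_gap \<epsilon> \<xi> n \<omega>)\<^sup>2) +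
         expectation (\<lambda>\<omega>. energy \<epsilon> (\<lambda>j. \<Sum>i<j. \<xi> i \<omega>) n) = (\<Sum>j<n. expectation (\<lambda>\<omega>. (\<xi> j \<omega>)\<^sup>2))" (is "?C n")
proof -
  have [measurable]: "\<xi> j \<in> borel_measurable M" for j using ind by (auto simp: indep_vars_def)
  have [measurable]: "anchor_gap \<epsilon> \<xi> j \<in> borel_measurable M" for j by (rule measurable_anchor_gap) measurable
  have "?A n \<and> ?B n \<and> ?C n"
  proof (induction n)
    case 0
    show ?case by (simp add: anchor_gap_simps energy_def)
  next
    case (Suc n)
    let ?d = "anchor_gap \<epsilon> \<xi>"
    let ?e = "\<lambda>n \<omega>. energy \<epsilon> (\<lambda>j. \<Sum>i<j. \<xi> i \<omega>) n"
    let ?J = "\<lambda>\<omega>. (anchor \<epsilon> (\<lambda>j. \<Sum>i<j. \<xi> i \<omega>) (Suc n) - anchor \<epsilon> (\<lambda>j. \<Sum>i<j. \<xi> i \<omega>) n)\<^sup>2"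
    have d: "integrable M (?d n)" "integrable M (\<xi> n)"
      using Suc sq by (auto intro: square_integrable_imp_integrable)
    have prod: "integrable M (\<lambda>\<omega>. ?d n \<omega> * \<xi> n \<omega>)" "expectation (\<lambda>\<omega>. ?d n \<omega> * \<xi> n \<omega>) = 0"
      using indep_var_integrable[OF indep_anchor_gap[OF ind] d]
        indep_var_lebesgue_integral[OF indep_anchor_gap[OF ind] d] mean by auto
    have eq: "(?d n \<omega> + \<xi> n \<omega>)\<^sup>2 = (?d n \<omega>)\<^sup>2 + 2 * (?d n \<omega> * \<xi> n \<omega>) + (\<xi> n \<omega>)\<^sup>2" for \<omega>
      by (simp add: power2_eq_square algebra_simps)
    have int: "integrable M (\<lambda>\<omega>. (?d n \<omega> + \<xi> n \<omega>)\<^sup>2)"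
      "expectation (\<lambda>\<omega>. (?d n \<omega> + \<xi> n \<omega>)\<^sup>2) = expectation (\<lambda>\<omega>. (?d n \<omega>)\<^sup>2) + expectation (\<lambda>\<omega>. (\<xi> n \<omega>)\<^sup>2)"
      unfolding eq using Suc sq prod by simp_all
    have J: "?J = (\<lambda>\<omega>. if \<bar>?d n \<omega> + \<xi> n \<omega>\<bar> \<ge> \<epsilon> then (?d n \<omega> + \<xi> n \<omega>)\<^sup>2 else 0)"
      unfolding anchor_increment by (simp add: fun_eq_iff)
    have [measurable]: "?J \<in> borel_measurable M" unfolding J by measurable
    have A: "?A (Suc n)" by (rule Bochner_Integration.integrable_bound[OF int(1)]) (auto simp: anchor_gap_simps)
    have J': "integrable M ?J" unfolding J by (rule Bochner_Integration.integrable_bound[OF int(1)]) auto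
    have e: "?e (Suc n) = (\<lambda>\<omega>. ?e n \<omega> + ?J \<omega>)" by (simp add: energy_def fun_eq_iff)
    have B: "?B (Suc n)" unfolding e using Suc J' by simp
    have "expectation (\<lambda>\<omega>. (?d (Suc n) \<omega>)\<^sup>2) + expectation ?J = expectation (\<lambda>\<omega>. (?d (Suc n) \<omega>)\<^sup>2 + ?J \<omega>)"
      using A J' by simp
    also have "(\<lambda>\<omega>. (?d (Suc n) \<omega>)\<^sup>2 + ?J \<omega>) = (\<lambda>\<omega>. (?d n \<omega> + \<xi> n \<omega>)\<^sup>2)"
      by (simp add: anchor_increment anchor_gap_simps fun_eq_iff)
    finally have "expectation (\<lambda>\<omega>. (?d (Suc n) \<omega>)\<^sup>2) + expectation ?J =
       expectation (\<lambda>\<omega>. (?d n \<omega>)\<^sup>2) + expectation (\<lambda>\<omega>. (\<xi> n \<omega>)\<^sup>2)" using int by simp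
    moreover have "expectation (?e (Suc n)) = expectation (?e n) + expectation ?J"
      unfolding e using Suc J' by simp
    ultimately have "?C (Suc n)" using Suc by simp
    then show ?case using A B by blast
  qed
  then show "?A n" "?B n" "?C n" by blast+
qed

lemma (in prob_space) quartic_expectation:
  fixes \<xi> :: "nat \<Rightarrow> 'a \<Rightarrow> real"
  assumes ind: "indep_vars (\<lambda>_. borel) \<xi> UNIV" and \<epsilon>: "\<epsilon> > 0"
    and T: "\<And>j \<omega>. \<bar>\<xi> j \<omega>\<bar> \<le> T" and mean: "\<And>j. expectation (\<xi> j) = 0"
    and V: "(\<Sum>j<n. expectation (\<lambda>\<omega>. (\<xi> j \<omega>)\<^sup>2)) = V"
  defines "Q m \<omega> \<equiv> \<Sum>j<m. (anchor \<epsilon> (\<lambda>j. \<Sum>i<j. \<xi> i \<omega>) (Suc j) - anchor \<epsilon> (\<lambda>j. \<Sum>i<j. \<xi> i \<omega>) j)^4"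
  shows "integrable M (Q n)" "expectation (Q n) \<le> 8 * V\<^sup>2 + 3 * T\<^sup>2 * V"
proof -
  let ?d = "anchor_gap \<epsilon> \<xi>"
  have [measurable]: "\<xi> j \<in> borel_measurable M" for j using ind by (auto simp: indep_vars_def)
  have [measurable]: "?d j \<in> borel_measurable M" for j by (rule measurable_anchor_gap) measurable
  have d\<epsilon>: "\<bar>?d j \<omega>\<bar> \<le> \<epsilon>" for j \<omega>
    using anchor_close[OF \<epsilon>, of "\<lambda>j. \<Sum>i<j. \<xi> i \<omega>" j] by (simp add: anchor_gap_def less_imp_le)
  have bnd: "integrable M (\<lambda>\<omega>. (?d j \<omega>)^k * (\<xi> j \<omega>)^l)" for j k l
  proof (rule integrable_const_bound)
    show "AE \<omega> in M. norm ((?d j \<omega>)^k * (\<xi> j \<omega>)^l) \<le> \<epsilon>^k * T^l"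
      using d\<epsilon>[of j] T[of j] \<epsilon> by (intro AE_I2) (auto simp: abs_mult power_abs intro!: mult_mono power_mono)
  qed measurable
  have bnd1: "integrable M (\<lambda>\<omega>. (?d j \<omega>)^k)" "integrable M (\<lambda>\<omega>. (\<xi> j \<omega>)^k)" for j k
    using bnd[of j k 0] bnd[of j 0 k] by simp_all
  have ind': "indep_var borel (\<lambda>\<omega>. (?d j \<omega>)^k) borel (\<lambda>\<omega>. (\<xi> j \<omega>)^l)" for j k l
    using indep_var_compose[OF indep_anchor_gap[OF ind], of "\<lambda>x. x^k" borel "\<lambda>x. x^l" borel]
    by (simp add: comp_def)
  have E: "expectation (\<lambda>\<omega>. (?d j \<omega>)^k * (\<xi> j \<omega>)^l) = expectation (\<lambda>\<omega>. (?d j \<omega>)^k) * expectation (\<lambda>\<omega>. (\<xi> j \<omega>)^l)" for j k l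
    by (rule indep_var_lebesgue_integral[OF ind' bnd1])
  have v0: "0 \<le> expectation (\<lambda>\<omega>. (\<xi> j \<omega>)\<^sup>2)" for j by simp
  have dV: "expectation (\<lambda>\<omega>. (?d j \<omega>)\<^sup>2) \<le> V" if "j < n" for j
  proof -
    have "expectation (\<lambda>\<omega>. (?d j \<omega>)\<^sup>2) \<le> (\<Sum>j<j. expectation (\<lambda>\<omega>. (\<xi> j \<omega>)\<^sup>2))"
    proof -
      have "0 \<le> expectation (\<lambda>\<omega>. energy \<epsilon> (\<lambda>j. \<Sum>i<j. \<xi> i \<omega>) j)" by (simp add: energy_nonneg)
      then show ?thesis using energy_expectation(3)[OF ind bnd1(2) mean, of \<epsilon> j] by linarith
    qed
    also have "\<dots> \<le> V" unfolding V[symmetric] by (rule sum_mono2) (use that in auto)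
    finally show ?thesis .
  qed
  have "integrable M (Q m) \<and> expectation (\<lambda>\<omega>. (?d m \<omega>)^4) + expectation (Q m) \<le>
    (\<Sum>j<m. 8 * V * expectation (\<lambda>\<omega>. (\<xi> j \<omega>)\<^sup>2) + 3 * T\<^sup>2 * expectation (\<lambda>\<omega>. (\<xi> j \<omega>)\<^sup>2))" if "m \<le> n" for m
    using that
  proof (induction m)
    case 0
    show ?case by (simp add: anchor_gap_simps Q_def)
  next
    case (Suc m)
    let ?J = "\<lambda>\<omega>. (anchor \<epsilon> (\<lambda>j. \<Sum>i<j. \<xi> i \<omega>) (Suc m) - anchor \<epsilon> (\<lambda>j. \<Sum>i<j. \<xi> i \<omega>) m)^4"
    let ?U = "\<lambda>\<omega>. (?d m \<omega>)^4 + 4 * ((?d m \<omega>)^3 * (\<xi> m \<omega>)^1) + 8 * ((?d m \<omega>)^2 * (\<xi> m \<omega>)^2) + 3 * T\<^sup>2 * (\<xi> m \<omega>)^2"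
    have Q: "Q (Suc m) = (\<lambda>\<omega>. Q m \<omega> + ?J \<omega>)" by (simp add: Q_def fun_eq_iff)
    have J: "?J = (\<lambda>\<omega>. if \<bar>?d m \<omega> + \<xi> m \<omega>\<bar> \<ge> \<epsilon> then (?d m \<omega> + \<xi> m \<omega>)^4 else 0)"
      unfolding anchor_increment by (simp add: fun_eq_iff)
    have [measurable]: "?J \<in> borel_measurable M" unfolding J by measurable
    have U: "integrable M ?U" by (intro Bochner_Integration.integrable_add integrable_mult_right bnd bnd1)
    have le: "(?d m \<omega> + \<xi> m \<omega>)^4 \<le> ?U \<omega>" for \<omega>
    proof -
      have poly: "(a + b)^4 + 2 * (b * (a - b))\<^sup>2 = a^4 + 4 * (a^3 * b^1) + 8 * (a^2 * b^2) + 3 * b^4" for a b :: real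
        by (simp add: power4_eq_xxxx power3_eq_cube power2_eq_square algebra_simps)
      have "(\<xi> m \<omega>)^2 * (\<xi> m \<omega>)^2 \<le> T^2 * (\<xi> m \<omega>)^2"
        using T[of m \<omega>] by (intro mult_right_mono) (auto simp: abs_le_square_iff[symmetric])
      then have "(\<xi> m \<omega>)^4 \<le> T^2 * (\<xi> m \<omega>)^2" by (simp add: power4_eq_xxxx power2_eq_square mult_ac)
      then show ?thesis using poly[of "?d m \<omega>" "\<xi> m \<omega>"] zero_le_power2[of "\<xi> m \<omega> * (?d m \<omega> - \<xi> m \<omega>)"] by linarith
    qed
    have J': "integrable M ?J"
    proof (rule Bochner_Integration.integrable_bound[OF U])
      show "AE \<omega> in M. norm (?J \<omega>) \<le> norm (?U \<omega>)"
      proof (rule AE_I2)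
        fix \<omega>
        have "0 \<le> ?J \<omega>" "?J \<omega> \<le> (?d m \<omega> + \<xi> m \<omega>)^4" by (simp_all add: anchor_increment)
        then show "norm (?J \<omega>) \<le> norm (?U \<omega>)" using le[of \<omega>] by simp
      qed
    qed measurable
    have "expectation (\<lambda>\<omega>. (?d (Suc m) \<omega>)^4) + expectation ?J = expectation (\<lambda>\<omega>. (?d (Suc m) \<omega>)^4 + ?J \<omega>)"
      by (intro Bochner_Integration.integral_add[symmetric] bnd1 J')
    also have "\<dots> \<le> expectation ?U"
    proof (rule integral_mono[OF _ U])
      show "integrable M (\<lambda>\<omega>. (?d (Suc m) \<omega>)^4 + ?J \<omega>)"
        by (intro Bochner_Integration.integrable_add bnd1 J')
      show "(?d (Suc m) \<omega>)^4 + ?J \<omega> \<le> ?U \<omega>" for \<omega>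
        using le[of \<omega>] by (simp add: anchor_increment anchor_gap_simps)
    qed
    also have "\<dots> = expectation (\<lambda>\<omega>. (?d m \<omega>)^4) + 4 * expectation (\<lambda>\<omega>. (?d m \<omega>)^3 * (\<xi> m \<omega>)^1) +
      8 * expectation (\<lambda>\<omega>. (?d m \<omega>)^2 * (\<xi> m \<omega>)^2) + 3 * T\<^sup>2 * expectation (\<lambda>\<omega>. (\<xi> m \<omega>)^2)"
      using bnd[of m 3 1] bnd[of m 2 2] bnd1(1)[of m 4] bnd1(2)[of m 2] by simp
    also have "\<dots> = expectation (\<lambda>\<omega>. (?d m \<omega>)^4) + 8 * (expectation (\<lambda>\<omega>. (?d m \<omega>)^2) * expectation (\<lambda>\<omega>. (\<xi> m \<omega>)^2))
       + 3 * T\<^sup>2 * expectation (\<lambda>\<omega>. (\<xi> m \<omega>)^2)"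
      unfolding E using mean[of m] by simp
    also have "\<dots> \<le> expectation (\<lambda>\<omega>. (?d m \<omega>)^4) + 8 * (V * expectation (\<lambda>\<omega>. (\<xi> m \<omega>)^2))
       + 3 * T\<^sup>2 * expectation (\<lambda>\<omega>. (\<xi> m \<omega>)^2)"
      using dV[of m] Suc.prems v0 by (intro add_mono mult_left_mono mult_right_mono) auto
    finally have step: "expectation (\<lambda>\<omega>. (?d (Suc m) \<omega>)^4) + expectation ?J \<le> \<dots>" .
    have "integrable M (Q (Suc m))" "expectation (Q (Suc m)) = expectation (Q m) + expectation ?J"
      unfolding Q using Suc J' by simp_all
    then show ?case using step Suc by simp
  qed
  from this[of n] have *: "integrable M (Q n)" "expectation (\<lambda>\<omega>. (?d n \<omega>)^4) + expectation (Q n) \<le>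
    (\<Sum>j<n. 8 * V * expectation (\<lambda>\<omega>. (\<xi> j \<omega>)\<^sup>2) + 3 * T\<^sup>2 * expectation (\<lambda>\<omega>. (\<xi> j \<omega>)\<^sup>2))" by auto
  show "integrable M (Q n)" by fact
  have "(\<Sum>j<n. 8 * V * expectation (\<lambda>\<omega>. (\<xi> j \<omega>)\<^sup>2) + 3 * T\<^sup>2 * expectation (\<lambda>\<omega>. (\<xi> j \<omega>)\<^sup>2)) = 8 * V\<^sup>2 + 3 * T\<^sup>2 * V"
    unfolding sum.distrib sum_distrib_left[symmetric] V by (simp add: power2_eq_square)
  moreover have "0 \<le> expectation (\<lambda>\<omega>. (?d n \<omega>)^4)" by simp
  ultimately show "expectation (Q n) \<le> 8 * V\<^sup>2 + 3 * T\<^sup>2 * V"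
    using *(2) by linarith
qed

lemma large_value_imp_anchor_jump:
  assumes "\<epsilon> > 0" "s 0 = 0" "j \<le> n" "\<epsilon> \<le> \<bar>s j\<bar>"
  shows "\<exists>i<n. \<epsilon> \<le> \<bar>anchor \<epsilon> s (Suc i) - anchor \<epsilon> s i\<bar>"
proof (rule ccontr)
  assume "\<not> ?thesis"
  then have "anchor \<epsilon> s (Suc i) = anchor \<epsilon> s i" if "i < n" for i
    using anchor_jump[of \<epsilon> s i] that by force
  then have "anchor \<epsilon> s i = 0" if "i \<le> n" for i
    using that
  proof (induction i)
    case (Suc i)
    then show ?case using \<open>\<And>i. i < n \<Longrightarrow> anchor \<epsilon> s (Suc i) = anchor \<epsilon> s i\<close>[of i] by simp
  qed (simp add: assms)
  then show False using anchor_close[of \<epsilon> s j] assms by force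
qed

lemma (in prob_space) markov_on_event:
  assumes "integrable M X" "\<And>\<omega>. \<omega> \<in> space M \<Longrightarrow> 0 \<le> X \<omega>" "expectation X \<le> b" "c > 0"
    "A \<in> events" "\<And>\<omega>. \<omega> \<in> A \<Longrightarrow> c \<le> X \<omega>"
  shows "prob A \<le> b / c"
proof -
  have "A \<subseteq> {\<omega> \<in> space M. c \<le> X \<omega>}" using assms(6) sets.sets_into_space[OF assms(5)] by auto
  then have "prob A \<le> prob {\<omega> \<in> space M. c \<le> X \<omega>}"
    using assms(1) by (intro finite_measure_mono) auto
  also have "\<dots> \<le> expectation X / c"
    by (rule integral_Markov_inequality_measure[OF assms(1)]) (use assms in auto)
  also have "\<dots> \<le> b / c" using assms by (simp add: divide_right_mono)
  finally show ?thesis .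
qed

lemma (in prob_space) maximal_inequality_variance:
  fixes \<xi> :: "nat \<Rightarrow> 'a \<Rightarrow> real"
  assumes ind: "indep_vars (\<lambda>_. borel) \<xi> UNIV"
    and sq: "\<And>j. integrable M (\<lambda>\<omega>. (\<xi> j \<omega>)\<^sup>2)" and mean: "\<And>j. expectation (\<xi> j) = 0" and \<epsilon>: "\<epsilon> > 0"
  shows "prob {\<omega>\<in>space M. \<exists>j\<le>n. \<epsilon> \<le> \<bar>\<Sum>i<j. \<xi> i \<omega>\<bar>} \<le> (\<Sum>j<n. expectation (\<lambda>\<omega>. (\<xi> j \<omega>)\<^sup>2)) / \<epsilon>\<^sup>2"
proof (rule markov_on_event)
  have [measurable]: "\<xi> j \<in> borel_measurable M" for j using ind by (auto simp: indep_vars_def)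
  show "integrable M (\<lambda>\<omega>. energy \<epsilon> (\<lambda>j. \<Sum>i<j. \<xi> i \<omega>) n)"
    by (rule energy_expectation[OF ind sq mean])
  show "expectation (\<lambda>\<omega>. energy \<epsilon> (\<lambda>j. \<Sum>i<j. \<xi> i \<omega>) n) \<le> (\<Sum>j<n. expectation (\<lambda>\<omega>. (\<xi> j \<omega>)\<^sup>2))"
  proof -
    have "0 \<le> expectation (\<lambda>\<omega>. (anchor_gap \<epsilon> \<xi> n \<omega>)\<^sup>2)" by simp
    then show ?thesis using energy_expectation(3)[OF ind sq mean, of \<epsilon> n] by linarith
  qed
  show "{\<omega>\<in>space M. \<exists>j\<le>n. \<epsilon> \<le> \<bar>\<Sum>i<j. \<xi> i \<omega>\<bar>} \<in> events" by measurable
  fix \<omega> assume "\<omega> \<in> {\<omega>\<in>space M. \<exists>j\<le>n. \<epsilon> \<le> \<bar>\<Sum>i<j. \<xi> i \<omega>\<bar>}"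
  then obtain i where i: "i < n" "\<epsilon> \<le> \<bar>anchor \<epsilon> (\<lambda>j. \<Sum>i<j. \<xi> i \<omega>) (Suc i) - anchor \<epsilon> (\<lambda>j. \<Sum>i<j. \<xi> i \<omega>) i\<bar>"
    using large_value_imp_anchor_jump[OF \<epsilon>, of "\<lambda>j. \<Sum>i<j. \<xi> i \<omega>"] by auto
  have "\<epsilon>\<^sup>2 \<le> (anchor \<epsilon> (\<lambda>j. \<Sum>i<j. \<xi> i \<omega>) (Suc i) - anchor \<epsilon> (\<lambda>j. \<Sum>i<j. \<xi> i \<omega>) i)\<^sup>2"
    using i \<epsilon> by (simp add: abs_le_square_iff[symmetric])
  also have "\<dots> \<le> energy \<epsilon> (\<lambda>j. \<Sum>i<j. \<xi> i \<omega>) n"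
    unfolding energy_def by (rule member_le_sum) (use i in auto)
  finally show "\<epsilon>\<^sup>2 \<le> energy \<epsilon> (\<lambda>j. \<Sum>i<j. \<xi> i \<omega>) n" .
qed (use \<epsilon> in \<open>auto simp: energy_nonneg\<close>)

lemma (in prob_space) maximal_inequality_bounded:
  fixes \<xi> :: "nat \<Rightarrow> 'a \<Rightarrow> real"
  assumes ind: "indep_vars (\<lambda>_. borel) \<xi> UNIV" and \<epsilon>: "\<epsilon> > 0"
    and T: "\<And>j \<omega>. \<bar>\<xi> j \<omega>\<bar> \<le> T" and mean: "\<And>j. expectation (\<xi> j) = 0"
    and V: "(\<Sum>j<n. expectation (\<lambda>\<omega>. (\<xi> j \<omega>)\<^sup>2)) = V"
  shows "prob {\<omega>\<in>space M. \<exists>j\<le>n. \<epsilon> \<le> \<bar>\<Sum>i<j. \<xi> i \<omega>\<bar>} \<le> (8 * V\<^sup>2 + 3 * T\<^sup>2 * V) / \<epsilon>^4"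
proof (rule markov_on_event[OF quartic_expectation(1)[OF ind \<epsilon> T mean V] _ quartic_expectation(2)[OF ind \<epsilon> T mean V]])
  have [measurable]: "\<xi> j \<in> borel_measurable M" for j using ind by (auto simp: indep_vars_def)
  show "{\<omega>\<in>space M. \<exists>j\<le>n. \<epsilon> \<le> \<bar>\<Sum>i<j. \<xi> i \<omega>\<bar>} \<in> events" by measurable
  fix \<omega> assume "\<omega> \<in> {\<omega>\<in>space M. \<exists>j\<le>n. \<epsilon> \<le> \<bar>\<Sum>i<j. \<xi> i \<omega>\<bar>}"
  then obtain i where i: "i < n" "\<epsilon> \<le> \<bar>anchor \<epsilon> (\<lambda>j. \<Sum>i<j. \<xi> i \<omega>) (Suc i) - anchor \<epsilon> (\<lambda>j. \<Sum>i<j. \<xi> i \<omega>) i\<bar>"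
    using large_value_imp_anchor_jump[OF \<epsilon>, of "\<lambda>j. \<Sum>i<j. \<xi> i \<omega>"] by auto
  have "\<epsilon>^4 \<le> \<bar>anchor \<epsilon> (\<lambda>j. \<Sum>i<j. \<xi> i \<omega>) (Suc i) - anchor \<epsilon> (\<lambda>j. \<Sum>i<j. \<xi> i \<omega>) i\<bar>^4"
    using i \<epsilon> by (intro power_mono) auto
  also have "\<dots> = (anchor \<epsilon> (\<lambda>j. \<Sum>i<j. \<xi> i \<omega>) (Suc i) - anchor \<epsilon> (\<lambda>j. \<Sum>i<j. \<xi> i \<omega>) i)^4"
    by (rule power_even_abs) simp
  also have "\<dots> \<le> (\<Sum>j<n. (anchor \<epsilon> (\<lambda>j. \<Sum>i<j. \<xi> i \<omega>) (Suc j) - anchor \<epsilon> (\<lambda>j. \<Sum>i<j. \<xi> i \<omega>) j)^4)"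
    by (rule member_le_sum) (use i in auto)
  finally show "\<epsilon>^4 \<le> (\<Sum>j<n. (anchor \<epsilon> (\<lambda>j. \<Sum>i<j. \<xi> i \<omega>) (Suc j) - anchor \<epsilon> (\<lambda>j. \<Sum>i<j. \<xi> i \<omega>) j)^4)" .
qed (use \<epsilon> in \<open>auto intro!: sum_nonneg\<close>)

lemma (in prob_space) second_moment_indep_sum:
  fixes \<zeta> :: "'i \<Rightarrow> 'a \<Rightarrow> real"
  assumes "finite B" "indep_vars (\<lambda>_. borel) \<zeta> B"
    "\<And>i. i \<in> B \<Longrightarrow> integrable M (\<lambda>\<omega>. (\<zeta> i \<omega>)\<^sup>2)" "\<And>i. i \<in> B \<Longrightarrow> expectation (\<zeta> i) = 0"
  shows "integrable M (\<lambda>\<omega>. (\<Sum>i\<in>B. \<zeta> i \<omega>)\<^sup>2) \<and>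
    expectation (\<lambda>\<omega>. (\<Sum>i\<in>B. \<zeta> i \<omega>)\<^sup>2) = (\<Sum>i\<in>B. expectation (\<lambda>\<omega>. (\<zeta> i \<omega>)\<^sup>2))"
  using assms
proof (induction B rule: finite_induct)
  case (insert i B)
  have rv [measurable]: "\<zeta> k \<in> borel_measurable M" if "k \<in> insert i B" for k
    using insert.prems(1) that by (auto simp: indep_vars_def)
  have int: "integrable M (\<zeta> k)" if "k \<in> insert i B" for k
    using insert.prems(2)[OF that] rv[OF that] by (rule square_integrable_imp_integrable[rotated])
  have iB: "integrable M (\<lambda>\<omega>. \<Sum>i\<in>B. \<zeta> i \<omega>)" using int by auto
  note IH = insert.IH[OF indep_vars_subset[OF insert.prems(1) subset_insertI] insert.prems(2,3)]
  have ind: "indep_var borel (\<zeta> i) borel (\<lambda>\<omega>. \<Sum>i\<in>B. \<zeta> i \<omega>)"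
    by (rule indep_vars_sum[OF insert.hyps(1,2) insert.prems(1)])
  have p: "integrable M (\<lambda>\<omega>. \<zeta> i \<omega> * (\<Sum>i\<in>B. \<zeta> i \<omega>))" "expectation (\<lambda>\<omega>. \<zeta> i \<omega> * (\<Sum>i\<in>B. \<zeta> i \<omega>)) = 0"
    using indep_var_integrable[OF ind int[of i] iB] indep_var_lebesgue_integral[OF ind int[of i] iB]
      insert.prems(3)[of i] by auto
  have eq: "(\<Sum>i\<in>insert i B. \<zeta> i \<omega>)\<^sup>2 = (\<zeta> i \<omega>)\<^sup>2 + 2 * (\<zeta> i \<omega> * (\<Sum>i\<in>B. \<zeta> i \<omega>)) + (\<Sum>i\<in>B. \<zeta> i \<omega>)\<^sup>2" for \<omega>
    using insert.hyps by (simp add: power2_eq_square algebra_simps)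
  show ?case
    unfolding eq using IH p insert.prems(2)[of i] insert.hyps by simp
qed simp

definition energy_bounded :: "'a measure \<Rightarrow> ('a \<Rightarrow> nat \<Rightarrow> real) \<Rightarrow> nat \<Rightarrow> real \<Rightarrow> bool" where
  "energy_bounded M s n v \<longleftrightarrow> (\<forall>\<epsilon>. integrable M (\<lambda>\<omega>. energy \<epsilon> (s \<omega>) n) \<and> (\<integral>\<omega>. energy \<epsilon> (s \<omega>) n \<partial>M) \<le> v)"

lemma energy_bounded_nonneg:
  assumes "energy_bounded M s n v"
  shows "0 \<le> v"
proof -
  have "0 \<le> (\<integral>\<omega>. energy 1 (s \<omega>) n \<partial>M)" by (simp add: energy_nonneg)
  also have "\<dots> \<le> v" using assms by (simp add: energy_bounded_def)
  finally show ?thesis .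
qed

definition chain_const :: "real \<Rightarrow> real \<Rightarrow> real" where
  "chain_const q v = 1 + 2 * (2 + 5 * v) / (1 - 2 powr (1 - 2/q))"

lemma chain_const_pos: "1 \<le> q \<Longrightarrow> q < 2 \<Longrightarrow> 0 \<le> v \<Longrightarrow> 0 < chain_const q v"
proof -
  assume "1 \<le> q" "q < 2" "0 \<le> v"
  then have "(2::real) powr (1 - 2/q) < 2 powr 0" by (intro powr_less_mono) (auto simp: field_simps)
  then show ?thesis using \<open>0 \<le> v\<close> unfolding chain_const_def by (intro add_pos_nonneg divide_nonneg_pos) auto
qed

lemma chain_bound_expectation:
  assumes s: "energy_bounded M s n v" and q: "1 \<le> q" "q < 2" and \<epsilon>: "0 < \<epsilon>" "\<epsilon> \<le> 1"
    and M: "prob_space M"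
  shows "integrable M (\<lambda>\<omega>. chain_bound q \<epsilon> n (s \<omega>))" (is ?A)
    and "(\<integral>\<omega>. chain_bound q \<epsilon> n (s \<omega>) \<partial>M) \<le> chain_const q v * \<epsilon> powr (2/q - 1)" (is ?B)
proof -
  interpret prob_space M by fact
  let ?\<theta> = "2/q - 1"
  have int: "integrable M (\<lambda>\<omega>. energy \<epsilon> (s \<omega>) n)" "expectation (\<lambda>\<omega>. energy \<epsilon> (s \<omega>) n) \<le> v" for \<epsilon>
    using s by (auto simp: energy_bounded_def)
  show ?A unfolding chain_bound_def using int by auto
  have v: "0 \<le> v" by (rule energy_bounded_nonneg[OF s])
  define \<rho> where "\<rho> = (2::real) powr (- ?\<theta>)"
  have "\<rho> < 2 powr 0" unfolding \<rho>_def using q by (intro powr_less_mono) (auto simp: field_simps)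
  then have \<rho>: "0 < \<rho>" "\<rho> < 1" by (auto simp: \<rho>_def)
  have pow: "(\<epsilon>/2^r) powr ?\<theta> = \<epsilon> powr ?\<theta> * \<rho>^r" for r :: nat
  proof -
    have "(\<epsilon>/2^r) powr ?\<theta> = \<epsilon> powr ?\<theta> / (2^r) powr ?\<theta>" using \<epsilon> by (simp add: powr_divide)
    also have "((2::real)^r) powr ?\<theta> = 2 powr (real r * ?\<theta>)" by (simp add: powr_powr flip: powr_realpow)
    also have "\<epsilon> powr ?\<theta> / 2 powr (real r * ?\<theta>) = \<epsilon> powr ?\<theta> * 2 powr (- (real r * ?\<theta>))"
      by (simp only: powr_minus divide_inverse)
    also have "2 powr (- (real r * ?\<theta>)) = \<rho>^r"
      unfolding \<rho>_def by (subst powr_power) (simp_all only: mult_minus_right zero_neq_numeral not_False_eq_True)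
    finally show ?thesis .
  qed
  have "expectation (\<lambda>\<omega>. chain_bound q \<epsilon> n (s \<omega>)) =
    \<epsilon> + (\<Sum>r<2*n. 2 * (\<epsilon>/2^r) powr ?\<theta> * (2 + expectation (\<lambda>\<omega>. energy (\<epsilon>/2^r) (s \<omega>) n) + 4 * expectation (\<lambda>\<omega>. energy (\<epsilon>/2^Suc r) (s \<omega>) n)))"
    unfolding chain_bound_def using int by (simp add: prob_space)
  also have "\<dots> \<le> \<epsilon> + (\<Sum>r<2*n. 2 * (\<epsilon>/2^r) powr ?\<theta> * (2 + v + 4 * v))"
    by (intro add_left_mono sum_mono mult_left_mono add_mono int(2) order_refl) auto
  also have "\<dots> = \<epsilon> + 2 * (2 + 5 * v) * \<epsilon> powr ?\<theta> * (\<Sum>r<2*n. \<rho>^r)"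
    unfolding pow sum_distrib_left
    by (intro arg_cong2[where f = "(+)"] sum.cong refl) (simp add: algebra_simps)
  also have "\<dots> \<le> \<epsilon> powr ?\<theta> + 2 * (2 + 5 * v) * \<epsilon> powr ?\<theta> * (1 / (1 - \<rho>))"
  proof (intro add_mono mult_left_mono)
    have "(\<Sum>r<2*n. \<rho>^r) \<le> (\<Sum>r. \<rho>^r)" using \<rho> by (intro sum_le_suminf summable_geometric) auto
    then show "(\<Sum>r<2*n. \<rho>^r) \<le> 1 / (1 - \<rho>)" using \<rho> by (simp add: suminf_geometric)
    have "\<epsilon> powr 1 \<le> \<epsilon> powr ?\<theta>" using \<epsilon> q by (intro powr_mono') (auto simp: field_simps)
    then show "\<epsilon> \<le> \<epsilon> powr ?\<theta>" using \<epsilon> by simp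
  qed (use v in auto)
  also have "\<dots> = chain_const q v * \<epsilon> powr ?\<theta>"
    by (simp add: chain_const_def \<rho>_def algebra_simps add_divide_distrib)
  finally show ?B .
qed

lemma comparison_bound_expectation:
  assumes s: "energy_bounded M s n v" "energy_bounded M s' n v" and q: "1 \<le> q" "q < 2" and \<epsilon>: "0 < \<epsilon>" "\<epsilon> \<le> 1"
    and M: "prob_space M"
  shows "integrable M (\<lambda>\<omega>. comparison_bound q \<epsilon> n (s \<omega>) (s' \<omega>))"
    and "(\<integral>\<omega>. comparison_bound q \<epsilon> n (s \<omega>) (s' \<omega>) \<partial>M) \<le> (7 + 6 * v + 2 * chain_const q v) * \<epsilon> powr (2/q - 1)"
proof -
  interpret prob_space M by fact
  have int: "integrable M (\<lambda>\<omega>. energy \<epsilon> (s \<omega>) n)" "expectation (\<lambda>\<omega>. energy \<epsilon> (s \<omega>) n) \<le> v"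
    "integrable M (\<lambda>\<omega>. energy \<epsilon> (s' \<omega>) n)" "expectation (\<lambda>\<omega>. energy \<epsilon> (s' \<omega>) n) \<le> v"
    using s by (auto simp: energy_bounded_def)
  note ch = chain_bound_expectation[OF s(1) q \<epsilon> M] chain_bound_expectation[OF s(2) q \<epsilon> M]
  show "integrable M (\<lambda>\<omega>. comparison_bound q \<epsilon> n (s \<omega>) (s' \<omega>))"
    unfolding comparison_bound_def using int ch by auto
  have \<epsilon>': "\<epsilon> \<le> \<epsilon> powr (2/q - 1)"
  proof -
    have "\<epsilon> powr 1 \<le> \<epsilon> powr (2/q - 1)" using \<epsilon> q by (intro powr_mono') (auto simp: field_simps)
    then show ?thesis using \<epsilon> by simp
  qed
  have "expectation (\<lambda>\<omega>. comparison_bound q \<epsilon> n (s \<omega>) (s' \<omega>)) =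
    \<epsilon> + expectation (\<lambda>\<omega>. chain_bound q \<epsilon> n (s \<omega>)) + expectation (\<lambda>\<omega>. chain_bound q \<epsilon> n (s' \<omega>)) +
    3 * \<epsilon> powr (2/q - 1) * (2 + expectation (\<lambda>\<omega>. energy \<epsilon> (s \<omega>) n) + expectation (\<lambda>\<omega>. energy \<epsilon> (s' \<omega>) n))"
    unfolding comparison_bound_def using int ch by (simp add: prob_space)
  also have "\<dots> \<le> \<epsilon> powr (2/q - 1) + chain_const q v * \<epsilon> powr (2/q - 1) + chain_const q v * \<epsilon> powr (2/q - 1) +
    3 * \<epsilon> powr (2/q - 1) * (2 + v + v)"
    by (intro add_mono mult_left_mono int ch \<epsilon>' order_refl) auto
  also have "\<dots> = (7 + 6 * v + 2 * chain_const q v) * \<epsilon> powr (2/q - 1)" by (simp add: algebra_simps)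
  finally show "expectation (\<lambda>\<omega>. comparison_bound q \<epsilon> n (s \<omega>) (s' \<omega>)) \<le> (7 + 6 * v + 2 * chain_const q v) * \<epsilon> powr (2/q - 1)" .
qed

lemma weighted_bound_expectation:
  assumes s: "energy_bounded M s n v" and q: "1 \<le> q" "q < 2" and M: "prob_space M"
  shows "integrable M (\<lambda>\<omega>. energy 1 (s \<omega>) n + 1 + chain_bound q 1 n (s \<omega>))"
    and "(\<integral>\<omega>. energy 1 (s \<omega>) n + 1 + chain_bound q 1 n (s \<omega>) \<partial>M) \<le> v + 1 + chain_const q v"
proof -
  interpret prob_space M by fact
  have int: "integrable M (\<lambda>\<omega>. energy 1 (s \<omega>) n)" "expectation (\<lambda>\<omega>. energy 1 (s \<omega>) n) \<le> v"
    using s by (auto simp: energy_bounded_def)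
  note ch = chain_bound_expectation[OF s(1) q _ _ M, of 1, simplified]
  show "integrable M (\<lambda>\<omega>. energy 1 (s \<omega>) n + 1 + chain_bound q 1 n (s \<omega>))" using int ch by auto
  show "expectation (\<lambda>\<omega>. energy 1 (s \<omega>) n + 1 + chain_bound q 1 n (s \<omega>)) \<le> v + 1 + chain_const q v"
    using int ch by (simp add: prob_space)
qed

locale noise = prob_space M for M :: "'a measure" +
  fixes \<zeta> :: "nat \<Rightarrow> 'a \<Rightarrow> real" and v :: real
  assumes ind: "indep_vars (\<lambda>_. borel) \<zeta> UNIV"
    and same: "\<And>i. distr M borel (\<zeta> i) = distr M borel (\<zeta> 0)"
    and sq0: "integrable M (\<lambda>\<omega>. (\<zeta> 0 \<omega>)\<^sup>2)"
    and mean0: "expectation (\<zeta> 0) = 0"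
    and var0: "expectation (\<lambda>\<omega>. (\<zeta> 0 \<omega>)\<^sup>2) = v"
begin

lemma rv [measurable]: "\<zeta> i \<in> borel_measurable M"
  using ind by (auto simp: indep_vars_def)

lemma
  assumes [measurable]: "h \<in> borel_measurable borel"
  shows expectation_same: "expectation (\<lambda>\<omega>. h (\<zeta> i \<omega>) :: real) = expectation (\<lambda>\<omega>. h (\<zeta> 0 \<omega>))"
    and integrable_same: "integrable M (\<lambda>\<omega>. h (\<zeta> i \<omega>) :: real) \<longleftrightarrow> integrable M (\<lambda>\<omega>. h (\<zeta> 0 \<omega>))"
proof -
  show "expectation (\<lambda>\<omega>. h (\<zeta> i \<omega>)) = expectation (\<lambda>\<omega>. h (\<zeta> 0 \<omega>))"
    using integral_distr[of "\<zeta> i" M borel h] integral_distr[of "\<zeta> 0" M borel h] same[of i] by simp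
  show "integrable M (\<lambda>\<omega>. h (\<zeta> i \<omega>)) \<longleftrightarrow> integrable M (\<lambda>\<omega>. h (\<zeta> 0 \<omega>))"
    using integrable_distr_eq[of "\<zeta> i" M borel h] integrable_distr_eq[of "\<zeta> 0" M borel h] same[of i] by simp
qed

lemma sq: "integrable M (\<lambda>\<omega>. (\<zeta> i \<omega>)\<^sup>2)"
  using integrable_same[of "\<lambda>x. x\<^sup>2" i] sq0 by simp

lemma mean: "expectation (\<zeta> i) = 0"
  using expectation_same[of "\<lambda>x. x" i] mean0 by simp

lemma var: "expectation (\<lambda>\<omega>. (\<zeta> i \<omega>)\<^sup>2) = v"
  using expectation_same[of "\<lambda>x. x\<^sup>2" i] var0 by simp

lemma integrable_noise: "integrable M (\<zeta> i)"
  by (rule square_integrable_imp_integrable[OF rv sq])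

lemma v_nonneg: "0 \<le> v"
  using var0 Bochner_Integration.integral_nonneg[of M "\<lambda>\<omega>. (\<zeta> 0 \<omega>)\<^sup>2"] by auto

lemma energy_bounded_grid:
  assumes \<tau>: "mono \<tau>"
  shows "energy_bounded M (\<lambda>\<omega> l. c * (\<Sum>i\<in>{\<tau> 0..<\<tau> l}. \<zeta> i \<omega>)) n (c\<^sup>2 * v * real (\<tau> n - \<tau> 0))"
proof -
  let ?\<xi> = "\<lambda>l \<omega>. c * (\<Sum>i\<in>{\<tau> l..<\<tau> (Suc l)}. \<zeta> i \<omega>)"
  have "disjoint_family_on (\<lambda>l. {\<tau> l..<\<tau> (Suc l)}) UNIV"
  proof -
    have "{\<tau> l..<\<tau> (Suc l)} \<inter> {\<tau> k..<\<tau> (Suc k)} = {}" if "l < k" for k l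
      using monoD[OF \<tau>, of "Suc l" k] that by auto
    then show ?thesis unfolding disjoint_family_on_def by (metis inf_commute nat_neq_iff)
  qed
  from indep_vars_block_sums[OF ind _ _ this]
  have ind': "indep_vars (\<lambda>_. borel) ?\<xi> UNIV"
    by (intro indep_vars_compose2[where Y = "\<lambda>_ x. c * x" and M' = "\<lambda>_. borel"]) auto
  have B: "integrable M (\<lambda>\<omega>. (\<Sum>i\<in>{\<tau> l..<\<tau> (Suc l)}. \<zeta> i \<omega>)\<^sup>2)"
    "expectation (\<lambda>\<omega>. (\<Sum>i\<in>{\<tau> l..<\<tau> (Suc l)}. \<zeta> i \<omega>)\<^sup>2) = v * real (\<tau> (Suc l) - \<tau> l)" for l
    using second_moment_indep_sum[OF _ indep_vars_subset[OF ind], of "{\<tau> l..<\<tau> (Suc l)}"] sq mean var by auto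
  have sq': "integrable M (\<lambda>\<omega>. (?\<xi> l \<omega>)\<^sup>2)" for l using B by (simp add: power_mult_distrib)
  have mean': "expectation (?\<xi> l) = 0" for l using mean integrable_noise by simp
  have S: "(\<Sum>i<l. ?\<xi> i \<omega>) = c * (\<Sum>i\<in>{\<tau> 0..<\<tau> l}. \<zeta> i \<omega>)" for l \<omega>
    using sum_chain_blocks[of l \<tau> "\<lambda>i. \<zeta> i \<omega>"] monoD[OF \<tau>] by (simp add: sum_distrib_left)
  have "(\<Sum>j<n. expectation (\<lambda>\<omega>. (?\<xi> j \<omega>)\<^sup>2)) = (\<Sum>j<n. c\<^sup>2 * v * (real (\<tau> (Suc j)) - real (\<tau> j)))"
    using B monoD[OF \<tau>] by (simp add: power_mult_distrib of_nat_diff mult.assoc)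
  also have "\<dots> = c\<^sup>2 * v * (real (\<tau> n) - real (\<tau> 0))"
    unfolding sum_distrib_left[symmetric] sum_lessThan_telescope[of "\<lambda>j. real (\<tau> j)" n] ..
  finally have V: "(\<Sum>j<n. expectation (\<lambda>\<omega>. (?\<xi> j \<omega>)\<^sup>2)) = c\<^sup>2 * v * real (\<tau> n - \<tau> 0)"
    using monoD[OF \<tau>] by (simp add: of_nat_diff)
  show ?thesis
    unfolding energy_bounded_def
  proof
    fix \<epsilon>
    have "0 \<le> expectation (\<lambda>\<omega>. (anchor_gap \<epsilon> ?\<xi> n \<omega>)\<^sup>2)" by simp
    then have "expectation (\<lambda>\<omega>. energy \<epsilon> (\<lambda>j. \<Sum>i<j. ?\<xi> i \<omega>) n) \<le> c\<^sup>2 * v * real (\<tau> n - \<tau> 0)"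
      using energy_expectation(3)[OF ind' sq' mean', of \<epsilon> n] V by linarith
    with energy_expectation(2)[OF ind' sq' mean', of \<epsilon> n]
    show "integrable M (\<lambda>\<omega>. energy \<epsilon> (\<lambda>l. c * (\<Sum>i\<in>{\<tau> 0..<\<tau> l}. \<zeta> i \<omega>)) n) \<and>
        expectation (\<lambda>\<omega>. energy \<epsilon> (\<lambda>l. c * (\<Sum>i\<in>{\<tau> 0..<\<tau> l}. \<zeta> i \<omega>)) n) \<le> c\<^sup>2 * v * real (\<tau> n - \<tau> 0)"
      unfolding S by blast
  qed
qed

definition tail_moment :: "real \<Rightarrow> real" where
  "tail_moment T = expectation (\<lambda>\<omega>. if \<bar>\<zeta> 0 \<omega>\<bar> \<le> T then 0 else (\<zeta> 0 \<omega>)\<^sup>2)"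

lemma tail_moment_tendsto: "(\<lambda>k. tail_moment (real k)) \<longlonglongrightarrow> 0"
proof -
  have "(\<lambda>k. expectation (\<lambda>\<omega>. if \<bar>\<zeta> 0 \<omega>\<bar> \<le> real k then 0 else (\<zeta> 0 \<omega>)\<^sup>2)) \<longlonglongrightarrow> expectation (\<lambda>\<omega>. 0)"
  proof (rule integral_dominated_convergence[where w = "\<lambda>\<omega>. (\<zeta> 0 \<omega>)\<^sup>2"])
    show "AE \<omega> in M. (\<lambda>k. if \<bar>\<zeta> 0 \<omega>\<bar> \<le> real k then 0 else (\<zeta> 0 \<omega>)\<^sup>2) \<longlonglongrightarrow> 0"
    proof (rule AE_I2)
      fix \<omega>
      obtain k0 :: nat where "\<bar>\<zeta> 0 \<omega>\<bar> \<le> real k0" using real_arch_simple by blast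
      then have "\<forall>\<^sub>F k in sequentially. (if \<bar>\<zeta> 0 \<omega>\<bar> \<le> real k then 0 else (\<zeta> 0 \<omega>)\<^sup>2) = 0"
        by (auto simp: eventually_sequentially intro!: exI[of _ k0])
      then show "(\<lambda>k. if \<bar>\<zeta> 0 \<omega>\<bar> \<le> real k then 0 else (\<zeta> 0 \<omega>)\<^sup>2) \<longlonglongrightarrow> 0"
        by (rule tendsto_eventually)
    qed
  qed (auto simp: sq0)
  then show ?thesis by (simp add: tail_moment_def)
qed

lemma window_maximal:
  assumes \<epsilon>: "\<epsilon> > 0" and T: "T \<ge> 0"
  shows "prob {\<omega>\<in>space M. \<exists>j\<le>L. \<epsilon> \<le> \<bar>c * (\<Sum>i\<in>{a..<a+j}. \<zeta> i \<omega>)\<bar>} \<le>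
    (8 * (c\<^sup>2 * v * real L)\<^sup>2 + 3 * (2 * T * \<bar>c\<bar>)\<^sup>2 * (c\<^sup>2 * v * real L)) / (\<epsilon>/2)^4 + c\<^sup>2 * tail_moment T * real L / (\<epsilon>/2)\<^sup>2"
proof -
  define t where "t x = (if \<bar>x\<bar> \<le> T then x else 0)" for x :: real
  define m where "m = expectation (\<lambda>\<omega>. t (\<zeta> 0 \<omega>))"
  have [measurable]: "t \<in> borel_measurable borel" unfolding t_def by measurable
  have tT: "\<bar>t x\<bar> \<le> T" for x using T by (simp add: t_def)
  have intt: "integrable M (\<lambda>\<omega>. t (\<zeta> i \<omega>))" "integrable M (\<lambda>\<omega>. (t (\<zeta> i \<omega>))\<^sup>2)" for i
  proof -
    show "integrable M (\<lambda>\<omega>. t (\<zeta> i \<omega>))"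
      by (rule integrable_const_bound[of _ T]) (auto simp: tT)
    show "integrable M (\<lambda>\<omega>. (t (\<zeta> i \<omega>))\<^sup>2)"
    proof (rule integrable_const_bound[of _ "T\<^sup>2"])
      show "AE \<omega> in M. norm ((t (\<zeta> i \<omega>))\<^sup>2) \<le> T\<^sup>2"
        using power_mono[OF tT abs_ge_zero, where n = 2] by (intro AE_I2) simp
    qed measurable
  qed
  have Et: "expectation (\<lambda>\<omega>. t (\<zeta> i \<omega>)) = m" for i
    using expectation_same[of t i] by (simp add: m_def)
  have mT: "\<bar>m\<bar> \<le> T"
  proof -
    have "\<bar>m\<bar> \<le> expectation (\<lambda>\<omega>. \<bar>t (\<zeta> 0 \<omega>)\<bar>)" unfolding m_def by (rule integral_abs_bound)
    also have "\<dots> \<le> expectation (\<lambda>\<omega>. T)" by (intro integral_mono intt integrable_abs) (auto simp: tT)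
    finally show ?thesis by (simp add: prob_space)
  qed
  define \<xi>' where "\<xi>' j \<omega> = c * (t (\<zeta> (a+j) \<omega>) - m)" for j \<omega>
  define \<xi>'' where "\<xi>'' j \<omega> = c * (\<zeta> (a+j) \<omega> - (t (\<zeta> (a+j) \<omega>) - m))" for j \<omega>
  have ind0: "indep_vars (\<lambda>_. borel) (\<lambda>j. \<zeta> (a+j)) UNIV"
    using indep_vars_block_sums[OF ind, of UNIV "\<lambda>j. {a+j}"] by (simp add: disjoint_family_on_def)
  have ind': "indep_vars (\<lambda>_. borel) \<xi>' UNIV" unfolding \<xi>'_def
    by (rule indep_vars_compose2[OF ind0, where Y = "\<lambda>_ x. c * (t x - m)"]) measurable
  have ind'': "indep_vars (\<lambda>_. borel) \<xi>'' UNIV" unfolding \<xi>''_def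
    by (rule indep_vars_compose2[OF ind0, where Y = "\<lambda>_ x. c * (x - (t x - m))"]) measurable
  have mean': "expectation (\<xi>' j) = 0" "expectation (\<xi>'' j) = 0" for j
    unfolding \<xi>'_def \<xi>''_def using intt integrable_noise mean Et by (simp_all add: prob_space)
  have bound': "\<bar>\<xi>' j \<omega>\<bar> \<le> 2 * T * \<bar>c\<bar>" for j \<omega>
  proof -
    have "\<bar>t (\<zeta> (a+j) \<omega>) - m\<bar> \<le> 2 * T" using tT[of "\<zeta> (a+j) \<omega>"] mT by linarith
    then show ?thesis unfolding \<xi>'_def abs_mult by (metis abs_ge_zero mult.commute mult_right_mono)
  qed
  have E': "expectation (\<lambda>\<omega>. (\<xi>' j \<omega>)\<^sup>2) \<le> c\<^sup>2 * v" for j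
  proof -
    have "(\<xi>' j \<omega>)\<^sup>2 = c\<^sup>2 * ((t (\<zeta> (a+j) \<omega>))\<^sup>2 - 2 * m * t (\<zeta> (a+j) \<omega>) + m\<^sup>2)" for \<omega>
      by (simp add: \<xi>'_def power2_eq_square algebra_simps)
    then have "expectation (\<lambda>\<omega>. (\<xi>' j \<omega>)\<^sup>2) = c\<^sup>2 * (expectation (\<lambda>\<omega>. (t (\<zeta> (a+j) \<omega>))\<^sup>2) - m\<^sup>2)"
      using intt Et by (simp add: prob_space power2_eq_square)
    also have "\<dots> \<le> c\<^sup>2 * expectation (\<lambda>\<omega>. (\<zeta> (a+j) \<omega>)\<^sup>2)"
    proof (rule mult_left_mono)
      have "expectation (\<lambda>\<omega>. (t (\<zeta> (a+j) \<omega>))\<^sup>2) \<le> expectation (\<lambda>\<omega>. (\<zeta> (a+j) \<omega>)\<^sup>2)"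
        by (intro integral_mono intt sq) (auto simp: t_def)
      then show "expectation (\<lambda>\<omega>. (t (\<zeta> (a+j) \<omega>))\<^sup>2) - m\<^sup>2 \<le> expectation (\<lambda>\<omega>. (\<zeta> (a+j) \<omega>)\<^sup>2)"
        using zero_le_power2[of m] by linarith
    qed simp
    finally show ?thesis by (simp add: var)
  qed
  define r where "r x = (if \<bar>x\<bar> \<le> T then 0 else x)" for x :: real
  have [measurable]: "r \<in> borel_measurable borel" unfolding r_def by measurable
  have intr: "integrable M (\<lambda>\<omega>. r (\<zeta> i \<omega>))" "integrable M (\<lambda>\<omega>. (r (\<zeta> i \<omega>))\<^sup>2)" for i
  proof -
    show "integrable M (\<lambda>\<omega>. r (\<zeta> i \<omega>))"
      by (rule Bochner_Integration.integrable_bound[OF integrable_noise[of i]]) (auto simp: r_def)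
    show "integrable M (\<lambda>\<omega>. (r (\<zeta> i \<omega>))\<^sup>2)"
      by (rule Bochner_Integration.integrable_bound[OF sq[of i]]) (auto simp: r_def)
  qed
  have Er: "expectation (\<lambda>\<omega>. r (\<zeta> i \<omega>)) = - m" for i
  proof -
    have "expectation (\<lambda>\<omega>. r (\<zeta> i \<omega>)) = expectation (\<lambda>\<omega>. \<zeta> i \<omega> - t (\<zeta> i \<omega>))"
      by (rule Bochner_Integration.integral_cong) (auto simp: r_def t_def)
    then show ?thesis using integrable_noise intt mean Et by simp
  qed
  have Er2: "expectation (\<lambda>\<omega>. (r (\<zeta> i \<omega>))\<^sup>2) = tail_moment T" for i
  proof -
    have "expectation (\<lambda>\<omega>. (r (\<zeta> i \<omega>))\<^sup>2) = expectation (\<lambda>\<omega>. (r (\<zeta> 0 \<omega>))\<^sup>2)"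
      by (rule expectation_same[of "\<lambda>x. (r x)\<^sup>2"]) measurable
    also have "\<dots> = tail_moment T" unfolding tail_moment_def
      by (rule Bochner_Integration.integral_cong) (auto simp: r_def)
    finally show ?thesis .
  qed
  have eq'': "(\<xi>'' j \<omega>)\<^sup>2 = c\<^sup>2 * ((r (\<zeta> (a+j) \<omega>))\<^sup>2 + 2 * m * r (\<zeta> (a+j) \<omega>) + m\<^sup>2)" for j \<omega>
  proof -
    have "\<xi>'' j \<omega> = c * (r (\<zeta> (a+j) \<omega>) + m)" by (auto simp: \<xi>''_def r_def t_def)
    then show ?thesis by (simp add: power2_eq_square algebra_simps)
  qed
  have sq'': "integrable M (\<lambda>\<omega>. (\<xi>'' j \<omega>)\<^sup>2)" for j
    unfolding eq'' using intr by simp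
  have E'': "expectation (\<lambda>\<omega>. (\<xi>'' j \<omega>)\<^sup>2) \<le> c\<^sup>2 * tail_moment T" for j
  proof -
    have "expectation (\<lambda>\<omega>. (\<xi>'' j \<omega>)\<^sup>2) = c\<^sup>2 * (tail_moment T - m\<^sup>2)"
      unfolding eq'' using intr Er Er2 by (simp add: prob_space power2_eq_square)
    also have "\<dots> \<le> c\<^sup>2 * tail_moment T" by (intro mult_left_mono) auto
    finally show ?thesis .
  qed
  define V where "V = (\<Sum>j<L. expectation (\<lambda>\<omega>. (\<xi>' j \<omega>)\<^sup>2))"
  have V: "0 \<le> V" "V \<le> c\<^sup>2 * v * real L"
    using sum_bounded_above[of "{..<L}" "\<lambda>j. expectation (\<lambda>\<omega>. (\<xi>' j \<omega>)\<^sup>2)" "c\<^sup>2 * v"] E'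
    by (auto simp: V_def mult_ac intro!: sum_nonneg)
  have "prob {\<omega>\<in>space M. \<exists>j\<le>L. \<epsilon>/2 \<le> \<bar>\<Sum>i<j. \<xi>' i \<omega>\<bar>} \<le> (8 * V\<^sup>2 + 3 * (2 * T * \<bar>c\<bar>)\<^sup>2 * V) / (\<epsilon>/2)^4"
    by (rule maximal_inequality_bounded[OF ind' _ bound' mean'(1)]) (use \<epsilon> in \<open>auto simp: V_def\<close>)
  also have "\<dots> \<le> (8 * (c\<^sup>2 * v * real L)\<^sup>2 + 3 * (2 * T * \<bar>c\<bar>)\<^sup>2 * (c\<^sup>2 * v * real L)) / (\<epsilon>/2)^4"
    using V by (intro divide_right_mono add_mono mult_left_mono power_mono) auto
  finally have P1: "prob {\<omega>\<in>space M. \<exists>j\<le>L. \<epsilon>/2 \<le> \<bar>\<Sum>i<j. \<xi>' i \<omega>\<bar>} \<le> \<dots>" .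
  have "prob {\<omega>\<in>space M. \<exists>j\<le>L. \<epsilon>/2 \<le> \<bar>\<Sum>i<j. \<xi>'' i \<omega>\<bar>} \<le> (\<Sum>j<L. expectation (\<lambda>\<omega>. (\<xi>'' j \<omega>)\<^sup>2)) / (\<epsilon>/2)\<^sup>2"
    by (rule maximal_inequality_variance[OF ind'' sq'' mean'(2)]) (use \<epsilon> in auto)
  also have "\<dots> \<le> c\<^sup>2 * tail_moment T * real L / (\<epsilon>/2)\<^sup>2"
    using sum_bounded_above[of "{..<L}" "\<lambda>j. expectation (\<lambda>\<omega>. (\<xi>'' j \<omega>)\<^sup>2)" "c\<^sup>2 * tail_moment T"] E''
    by (intro divide_right_mono) (auto simp: mult_ac)
  finally have P2: "prob {\<omega>\<in>space M. \<exists>j\<le>L. \<epsilon>/2 \<le> \<bar>\<Sum>i<j. \<xi>'' i \<omega>\<bar>} \<le> \<dots>" .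
  have [measurable]: "\<xi>' j \<in> borel_measurable M" "\<xi>'' j \<in> borel_measurable M" for j
    unfolding \<xi>'_def \<xi>''_def by measurable
  have "{\<omega>\<in>space M. \<exists>j\<le>L. \<epsilon> \<le> \<bar>c * (\<Sum>i\<in>{a..<a+j}. \<zeta> i \<omega>)\<bar>} \<subseteq>
    {\<omega>\<in>space M. \<exists>j\<le>L. \<epsilon>/2 \<le> \<bar>\<Sum>i<j. \<xi>' i \<omega>\<bar>} \<union> {\<omega>\<in>space M. \<exists>j\<le>L. \<epsilon>/2 \<le> \<bar>\<Sum>i<j. \<xi>'' i \<omega>\<bar>}"
  proof safe
    fix \<omega> j
    assume j: "j \<le> L" "\<epsilon> \<le> \<bar>c * (\<Sum>i\<in>{a..<a+j}. \<zeta> i \<omega>)\<bar>" and no: "\<not> (\<exists>j\<le>L. \<epsilon>/2 \<le> \<bar>\<Sum>i<j. \<xi>'' i \<omega>\<bar>)"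
    have "c * (\<Sum>i\<in>{a..<a+j}. \<zeta> i \<omega>) = (\<Sum>i<j. \<xi>' i \<omega>) + (\<Sum>i<j. \<xi>'' i \<omega>)"
      by (simp add: sum.atLeastLessThan_shift_0[of _ a] atLeast0LessThan sum_distrib_left \<xi>'_def \<xi>''_def
          algebra_simps flip: sum.distrib)
    moreover have "\<bar>\<Sum>i<j. \<xi>'' i \<omega>\<bar> < \<epsilon>/2" using no j by force
    ultimately have "\<epsilon>/2 \<le> \<bar>\<Sum>i<j. \<xi>' i \<omega>\<bar>" using j(2) by linarith
    then show "\<exists>j\<le>L. \<epsilon>/2 \<le> \<bar>\<Sum>i<j. \<xi>' i \<omega>\<bar>" using j by blast
  qed
  then have "prob {\<omega>\<in>space M. \<exists>j\<le>L. \<epsilon> \<le> \<bar>c * (\<Sum>i\<in>{a..<a+j}. \<zeta> i \<omega>)\<bar>} \<le>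
    prob {\<omega>\<in>space M. \<exists>j\<le>L. \<epsilon>/2 \<le> \<bar>\<Sum>i<j. \<xi>' i \<omega>\<bar>} + prob {\<omega>\<in>space M. \<exists>j\<le>L. \<epsilon>/2 \<le> \<bar>\<Sum>i<j. \<xi>'' i \<omega>\<bar>}"
    by (intro order_trans[OF finite_measure_mono measure_Un_le]) auto
  then show ?thesis using P1 P2 by linarith
qed

definition partial_sum :: "nat \<Rightarrow> 'a \<Rightarrow> real" where
  "partial_sum j \<omega> = (\<Sum>i<j. \<zeta> i \<omega>)"

lemma partial_sum_measurable [measurable]: "partial_sum j \<in> borel_measurable M"
  unfolding partial_sum_def by measurable

lemma block_oscillation:
  assumes \<epsilon>: "\<epsilon> > 0" and \<eta>: "\<eta> > 0"
  shows "\<exists>K0\<ge>1. \<forall>K\<ge>K0. \<exists>n0\<ge>1. \<forall>n\<ge>n0. prob {\<omega>\<in>space M. \<exists>l\<le>n*K.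
    \<epsilon> \<le> \<bar>partial_sum (l div K) \<omega> / sqrt n - partial_sum (n * (l div n) div K) \<omega> / sqrt n\<bar>} \<le> \<eta>"
proof -
  have "\<forall>\<^sub>F k in sequentially. tail_moment (real k) < \<eta> / 3 * \<epsilon>\<^sup>2 / 8"
    by (rule order_tendstoD(2)[OF tail_moment_tendsto]) (use \<epsilon> \<eta> in simp)
  then obtain k where k: "tail_moment (real k) < \<eta> / 3 * \<epsilon>\<^sup>2 / 8" by (auto simp: eventually_sequentially)
  define T where "T = real k"
  have w0: "0 \<le> tail_moment T" unfolding tail_moment_def by simp
  obtain K0 :: nat where K0: "512 * v\<^sup>2 / \<epsilon>^4 / (\<eta>/3) \<le> real K0" using real_arch_simple by blast
  obtain n1 :: nat where n1: "384 * T\<^sup>2 * v / \<epsilon>^4 / (\<eta>/3) \<le> real n1" using real_arch_simple by blast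
  show ?thesis
  proof (rule exI[of _ "max 1 K0"], intro conjI allI impI)
    fix K assume K: "K \<ge> max 1 K0"
    show "\<exists>n0\<ge>1. \<forall>n\<ge>n0. prob {\<omega>\<in>space M. \<exists>l\<le>n*K.
      \<epsilon> \<le> \<bar>partial_sum (l div K) \<omega> / sqrt n - partial_sum (n * (l div n) div K) \<omega> / sqrt n\<bar>} \<le> \<eta>"
    proof (rule exI[of _ "max 1 (max n1 K)"], intro conjI allI impI)
      fix n assume n: "n \<ge> max 1 (max n1 K)"
      define c where "c = 1 / sqrt (real n)"
      define L where "L = n div K + 1"
      have c2: "c\<^sup>2 = 1 / real n" using n by (simp add: c_def power_divide)
      have L: "real L \<le> 2 * real n / real K"
      proof -
        have "1 \<le> n div K" using n K by (simp add: div_greater_zero_iff Suc_leI)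
        then have "real L \<le> 2 * real (n div K)" by (simp add: L_def)
        also have "real (n div K) \<le> real n / real K" by (rule of_nat_div_le_of_nat)
        finally show ?thesis by simp
      qed
      have kn: "real K > 0" "real n > 0" using K n by auto
      have Tc: "(2 * T * \<bar>c\<bar>)\<^sup>2 = 4 * T\<^sup>2 / real n" by (simp add: power_mult_distrib c2)
      have cvL: "0 \<le> c\<^sup>2 * v * real L" "c\<^sup>2 * v * real L \<le> 2 * v / real K"
      proof -
        show "0 \<le> c\<^sup>2 * v * real L" using v_nonneg by simp
        have "c\<^sup>2 * v * real L \<le> c\<^sup>2 * v * (2 * real n / real K)"
          using L v_nonneg by (intro mult_left_mono) auto
        then show "c\<^sup>2 * v * real L \<le> 2 * v / real K" using c2 kn by (simp add: mult.commute)
      qed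
      let ?A = "{\<omega>\<in>space M. \<exists>l\<le>n*K. \<epsilon> \<le> \<bar>partial_sum (l div K) \<omega> / sqrt n - partial_sum (n * (l div n) div K) \<omega> / sqrt n\<bar>}"
      let ?B = "\<lambda>i. {\<omega>\<in>space M. \<exists>j\<le>L. \<epsilon> \<le> \<bar>c * (\<Sum>i\<in>{n * i div K..<n * i div K + j}. \<zeta> i \<omega>)\<bar>}"
      have "?A \<subseteq> (\<Union>i<K. ?B i)"
      proof
        fix \<omega> assume "\<omega> \<in> ?A"
        then obtain l where \<omega>: "\<omega> \<in> space M" and l: "l \<le> n * K"
          "\<epsilon> \<le> \<bar>partial_sum (l div K) \<omega> / sqrt n - partial_sum (n * (l div n) div K) \<omega> / sqrt n\<bar>" by blast
        define i where "i = l div n"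
        have "l \<noteq> n * K" using l(2) \<epsilon> kn by auto
        then have i: "i < K" using l(1) by (simp add: i_def less_mult_imp_div_less mult.commute)
        have "l = n * i + l mod n" "l mod n < n" using kn by (simp_all add: i_def)
        then have le: "n * i \<le> l" "l < n * i + n" by linarith+
        have le1: "n * i div K \<le> l div K" using le(1) by (rule div_le_mono)
        have "l div K \<le> (n * i + n) div K" using le(2) by (intro div_le_mono) simp
        also have "\<dots> \<le> n * i div K + n div K + 1"
        proof -
          have "n * i mod K < K" "n mod K < K" using kn by simp_all
          then have "n * i mod K + n mod K < 2 * K" by linarith
          then have "(n * i mod K + n mod K) div K < 2" by (simp add: less_mult_imp_div_less)
          then show ?thesis by (simp add: div_add1_eq[of "n * i" n K])
        qed
        finally have le2: "l div K \<le> n * i div K + L" by (simp add: L_def)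
        define j where "j = l div K - n * i div K"
        have j: "j \<le> L" "l div K = n * i div K + j" using le1 le2 by (auto simp: j_def)
        have "partial_sum (l div K) \<omega> / sqrt n - partial_sum (n * (l div n) div K) \<omega> / sqrt n =
           c * (\<Sum>i\<in>{n * i div K..<n * i div K + j}. \<zeta> i \<omega>)"
          unfolding partial_sum_def i_def[symmetric] j(2) c_def
          using sum_diff_nat_ivl[of 0 "n * i div K" "n * i div K + j" "\<lambda>i. \<zeta> i \<omega>"]
          by (simp add: atLeast0LessThan diff_divide_distrib[symmetric])
        then show "\<omega> \<in> (\<Union>i<K. ?B i)" using \<omega> l(2) j(1) i by auto
      qed
      then have "prob ?A \<le> prob (\<Union>i<K. ?B i)" by (intro finite_measure_mono) auto
      also have "\<dots> \<le> (\<Sum>i<K. prob (?B i))" by (intro measure_UNION_le) auto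
      also have "\<dots> \<le> (\<Sum>i<K. (8 * (c\<^sup>2 * v * real L)\<^sup>2 + 3 * (2 * T * \<bar>c\<bar>)\<^sup>2 * (c\<^sup>2 * v * real L)) / (\<epsilon>/2)^4 + c\<^sup>2 * tail_moment T * real L / (\<epsilon>/2)\<^sup>2)"
        by (intro sum_mono window_maximal \<epsilon>) (simp add: T_def)
      also have "\<dots> \<le> (\<Sum>i<K. (8 * (2 * v / real K)\<^sup>2 + 3 * (2 * T * \<bar>c\<bar>)\<^sup>2 * (2 * v / real K)) / (\<epsilon>/2)^4 +
          1 / real n * tail_moment T * (2 * real n / real K) / (\<epsilon>/2)\<^sup>2)"
        unfolding c2[symmetric]
        by (intro sum_mono add_mono divide_right_mono mult_left_mono power_mono cvL L mult_nonneg_nonneg w0) auto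
      also have "\<dots> = 512 * v\<^sup>2 / \<epsilon>^4 / real K + 384 * T\<^sup>2 * v / \<epsilon>^4 / real n + 8 * tail_moment T / \<epsilon>\<^sup>2"
        unfolding Tc using kn \<epsilon> by (simp add: field_simps power2_eq_square power4_eq_xxxx)
      also have "\<dots> \<le> \<eta>/3 + \<eta>/3 + \<eta>/3"
      proof (intro add_mono)
        have "512 * v\<^sup>2 / \<epsilon>^4 / (\<eta>/3) \<le> real K" using K K0 by linarith
        then show "512 * v\<^sup>2 / \<epsilon>^4 / real K \<le> \<eta>/3" using kn \<eta> \<epsilon> zero_less_power[OF \<epsilon>, of 4] by (simp add: field_simps)
        have "384 * T\<^sup>2 * v / \<epsilon>^4 / (\<eta>/3) \<le> real n" using n n1 by linarith
        then show "384 * T\<^sup>2 * v / \<epsilon>^4 / real n \<le> \<eta>/3" using kn \<eta> \<epsilon> zero_less_power[OF \<epsilon>, of 4] by (simp add: field_simps)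
        show "8 * tail_moment T / \<epsilon>\<^sup>2 \<le> \<eta>/3" using k \<epsilon> by (simp add: T_def field_simps)
      qed
      finally show "prob ?A \<le> \<eta>" by simp
    qed simp
  qed simp
qed

end

section \<open>White noise from Haar rotations\<close>

lemma nn_integral_rotation:
  fixes g :: "real \<times> real \<Rightarrow> ennreal"
  assumes [measurable]: "g \<in> borel_measurable (borel \<Otimes>\<^sub>M borel)"
  shows "(\<integral>\<^sup>+z. g ((fst z + snd z) / sqrt 2, (fst z - snd z) / sqrt 2) \<partial>(lborel \<Otimes>\<^sub>M lborel)) = (\<integral>\<^sup>+z. g z \<partial>(lborel \<Otimes>\<^sub>M lborel))"
proof -
  have eq: "(sqrt 2 * u - 2 * y) / sqrt 2 = u - sqrt 2 * y" for u y :: real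
  proof -
    have "2 * y / sqrt 2 = 2 / sqrt 2 * y" by simp
    also have "2 / sqrt 2 = sqrt (2::real)" by (rule real_div_sqrt) simp
    finally show ?thesis by (simp add: diff_divide_distrib)
  qed
  have "(\<integral>\<^sup>+z. g ((fst z + snd z) / sqrt 2, (fst z - snd z) / sqrt 2) \<partial>(lborel \<Otimes>\<^sub>M lborel)) =
     (\<integral>\<^sup>+y. \<integral>\<^sup>+x. g ((x + y) / sqrt 2, (x - y) / sqrt 2) \<partial>lborel \<partial>lborel)"
    by (subst lborel_pair.nn_integral_snd[symmetric]) auto
  also have "\<dots> = (\<integral>\<^sup>+y. ennreal (sqrt 2) * (\<integral>\<^sup>+u. g (u, u - sqrt 2 * y) \<partial>lborel) \<partial>lborel)"
  proof (rule nn_integral_cong)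
    fix y :: real
    show "(\<integral>\<^sup>+x. g ((x + y) / sqrt 2, (x - y) / sqrt 2) \<partial>lborel) = ennreal (sqrt 2) * (\<integral>\<^sup>+u. g (u, u - sqrt 2 * y) \<partial>lborel)"
      by (subst nn_integral_real_affine[of _ "sqrt 2" "-y"]) (auto simp: eq)
  qed
  also have "\<dots> = ennreal (sqrt 2) * (\<integral>\<^sup>+y. \<integral>\<^sup>+u. g (u, u - sqrt 2 * y) \<partial>lborel \<partial>lborel)"
    by (rule nn_integral_cmult) measurable
  also have "(\<integral>\<^sup>+y. \<integral>\<^sup>+u. g (u, u - sqrt 2 * y) \<partial>lborel \<partial>lborel) = (\<integral>\<^sup>+u. \<integral>\<^sup>+y. g (u, u - sqrt 2 * y) \<partial>lborel \<partial>lborel)"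
    by (rule lborel_pair.Fubini') measurable
  also have "ennreal (sqrt 2) * \<dots> = (\<integral>\<^sup>+u. ennreal (sqrt 2) * (\<integral>\<^sup>+y. g (u, u - sqrt 2 * y) \<partial>lborel) \<partial>lborel)"
    by (rule nn_integral_cmult[symmetric]) measurable
  also have "\<dots> = (\<integral>\<^sup>+u. \<integral>\<^sup>+y. g (u, y) \<partial>lborel \<partial>lborel)"
  proof (rule nn_integral_cong)
    fix u :: real
    show "ennreal (sqrt 2) * (\<integral>\<^sup>+y. g (u, u - sqrt 2 * y) \<partial>lborel) = (\<integral>\<^sup>+y. g (u, y) \<partial>lborel)"
      using nn_integral_real_affine[of "\<lambda>y. g (u, y)" "- sqrt 2" u] by simp
  qed
  also have "\<dots> = (\<integral>\<^sup>+z. g z \<partial>(lborel \<Otimes>\<^sub>M lborel))"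
    by (rule lborel.nn_integral_fst) simp
  finally show ?thesis .
qed

abbreviation std_normal :: "real measure" where
  "std_normal \<equiv> std_normal_distribution"

lemma prob_space_std_normal: "prob_space std_normal"
  by (rule prob_space_normal_density) simp

lemma std_normal_pair_rotation:
  "distr (std_normal \<Otimes>\<^sub>M std_normal) (borel \<Otimes>\<^sub>M borel) (\<lambda>z. ((fst z + snd z) / sqrt 2, (fst z - snd z) / sqrt 2))
     = std_normal \<Otimes>\<^sub>M std_normal" (is "distr ?P _ ?R = _")
proof (rule measure_eqI)
  interpret prob_space std_normal by (rule prob_space_std_normal)
  have [measurable_cong]: "sets ?P = sets (borel \<Otimes>\<^sub>M borel)" by (intro sets_pair_measure_cong) auto
  show "sets (distr ?P (borel \<Otimes>\<^sub>M borel) ?R) = sets ?P" using \<open>sets ?P = _\<close> by simp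
  have P: "?P = density (lborel \<Otimes>\<^sub>M lborel) (\<lambda>(x,y). ennreal (std_normal_density x) * ennreal (std_normal_density y))"
    by (rule pair_measure_density) (auto intro: prob_space_imp_sigma_finite prob_space_std_normal lborel.sigma_finite_measure_axioms)
  let ?d = "\<lambda>z. ennreal (std_normal_density (fst z)) * ennreal (std_normal_density (snd z))"
  have d: "?d (?R z) = ?d z" for z
  proof -
    have "((fst z + snd z) / sqrt 2)\<^sup>2 + ((fst z - snd z) / sqrt 2)\<^sup>2 = (fst z)\<^sup>2 + (snd z)\<^sup>2"
      by (simp add: power_divide power2_eq_square field_simps)
    then show ?thesis
      by (simp add: std_normal_density_def ennreal_mult'[symmetric] mult_exp_exp flip: add_divide_distrib minus_add_distrib)
  qed
  fix A assume "A \<in> sets (distr ?P (borel \<Otimes>\<^sub>M borel) ?R)"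
  then have A [measurable]: "A \<in> sets (borel \<Otimes>\<^sub>M borel)" by simp
  have "emeasure (distr ?P (borel \<Otimes>\<^sub>M borel) ?R) A = (\<integral>\<^sup>+z. indicator A (?R z) \<partial>?P)"
    by (subst nn_integral_indicator[symmetric], simp, subst nn_integral_distr) auto
  also have "\<dots> = (\<integral>\<^sup>+z. ?d z * indicator A (?R z) \<partial>(lborel \<Otimes>\<^sub>M lborel))"
    unfolding P by (subst nn_integral_density) (auto simp: case_prod_beta)
  also have "\<dots> = (\<integral>\<^sup>+z. (\<lambda>z. ?d z * indicator A z) (?R z) \<partial>(lborel \<Otimes>\<^sub>M lborel))"
    by (simp only: d)
  also have "\<dots> = (\<integral>\<^sup>+z. ?d z * indicator A z \<partial>(lborel \<Otimes>\<^sub>M lborel))"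
    by (rule nn_integral_rotation) measurable
  also have "\<dots> = emeasure ?P A"
    unfolding P by (subst emeasure_density) (auto simp: case_prod_beta)
  finally show "emeasure (distr ?P (borel \<Otimes>\<^sub>M borel) ?R) A = emeasure ?P A" .
qed

lemma (in prob_space) std_normal_rotation:
  assumes "indep_var borel X borel Y" "distr M borel X = std_normal" "distr M borel Y = std_normal"
  defines "U \<equiv> \<lambda>\<omega>. (X \<omega> + Y \<omega>) / sqrt 2" and "V \<equiv> \<lambda>\<omega>. (X \<omega> - Y \<omega>) / sqrt 2"
  shows "indep_var borel U borel V" "distr M borel U = std_normal" "distr M borel V = std_normal"
proof -
  interpret N: prob_space std_normal by (rule prob_space_std_normal)
  interpret NN: pair_prob_space std_normal std_normal ..
  have XY: "X \<in> borel_measurable M" "Y \<in> borel_measurable M"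
    "distr M (borel \<Otimes>\<^sub>M borel) (\<lambda>\<omega>. (X \<omega>, Y \<omega>)) = std_normal \<Otimes>\<^sub>M std_normal"
    using assms(1) unfolding indep_var_distribution_eq assms(2,3) by auto
  note [measurable] = XY(1,2)
  have [measurable]: "U \<in> borel_measurable M" "V \<in> borel_measurable M" unfolding U_def V_def by measurable
  let ?R = "\<lambda>z. ((fst z + snd z) / sqrt 2, (fst z - snd z) / sqrt 2) :: real \<times> real"
  have J: "distr M (borel \<Otimes>\<^sub>M borel) (\<lambda>\<omega>. (U \<omega>, V \<omega>)) = std_normal \<Otimes>\<^sub>M std_normal"
  proof -
    have "distr M (borel \<Otimes>\<^sub>M borel) (\<lambda>\<omega>. (U \<omega>, V \<omega>)) =
      distr (distr M (borel \<Otimes>\<^sub>M borel) (\<lambda>\<omega>. (X \<omega>, Y \<omega>))) (borel \<Otimes>\<^sub>M borel) ?R"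
      by (subst distr_distr) (auto simp: U_def V_def comp_def)
    then show ?thesis unfolding XY(3) std_normal_pair_rotation .
  qed
  have sets [measurable_cong]: "sets (std_normal \<Otimes>\<^sub>M std_normal) = sets (borel \<Otimes>\<^sub>M borel)"
    by (intro sets_pair_measure_cong) auto
  show U: "distr M borel U = std_normal"
  proof (rule measure_eqI)
    fix A assume "A \<in> sets (distr M borel U)"
    then have [measurable]: "A \<in> sets borel" by simp
    have "emeasure (distr M borel U) A = emeasure (distr M (borel \<Otimes>\<^sub>M borel) (\<lambda>\<omega>. (U \<omega>, V \<omega>))) (A \<times> UNIV)"
      by (subst (1 2) emeasure_distr) (auto intro!: arg_cong[where f = "emeasure M"])
    also have "\<dots> = emeasure std_normal A"
      unfolding J using N.emeasure_pair_measure_Times[of A std_normal UNIV] N.emeasure_space_1 by simp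
    finally show "emeasure (distr M borel U) A = emeasure std_normal A" .
  qed simp
  show V: "distr M borel V = std_normal"
  proof (rule measure_eqI)
    fix A assume "A \<in> sets (distr M borel V)"
    then have [measurable]: "A \<in> sets borel" by simp
    have "emeasure (distr M borel V) A = emeasure (distr M (borel \<Otimes>\<^sub>M borel) (\<lambda>\<omega>. (U \<omega>, V \<omega>))) (UNIV \<times> A)"
      by (subst (1 2) emeasure_distr) (auto intro!: arg_cong[where f = "emeasure M"])
    also have "\<dots> = emeasure std_normal A"
      unfolding J using N.emeasure_pair_measure_Times[of UNIV std_normal A] N.emeasure_space_1 by simp
    finally show "emeasure (distr M borel V) A = emeasure std_normal A" .
  qed simp
  show "indep_var borel U borel V"
    unfolding indep_var_distribution_eq U V J by simp
qed

definition iid_std_normal :: "'a measure \<Rightarrow> (nat \<Rightarrow> 'a \<Rightarrow> real) \<Rightarrow> nat \<Rightarrow> bool" where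
  "iid_std_normal M W n \<longleftrightarrow> prob_space.indep_vars M (\<lambda>_. borel) W {..<n} \<and> (\<forall>i<n. distr M borel (W i) = std_normal)"

lemma (in prob_space) iid_std_normal_rotate_pairs:
  assumes W: "iid_std_normal M W n" and n: "2 * K \<le> n"
    and W'1: "\<And>i \<omega>. i < K \<Longrightarrow> W' (2 * i) \<omega> = (W i \<omega> + W (K + i) \<omega>) / sqrt 2"
    and W'2: "\<And>i \<omega>. i < K \<Longrightarrow> W' (Suc (2 * i)) \<omega> = (W i \<omega> - W (K + i) \<omega>) / sqrt 2"
    and W'3: "\<And>i \<omega>. 2 * K \<le> i \<Longrightarrow> W' i \<omega> = W i \<omega>"
  shows "iid_std_normal M W' n"
proof (cases "n = 0")
  case True
  then show ?thesis by (simp add: iid_std_normal_def indep_vars_def indep_sets_def)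
next
  case n0: False
  have ind: "indep_vars (\<lambda>_. borel) W {..<n}" and law: "\<And>i. i < n \<Longrightarrow> distr M borel (W i) = std_normal"
    using W by (auto simp: iid_std_normal_def)
  have rv: "W i \<in> borel_measurable M" if "i < n" for i using ind that by (auto simp: indep_vars_def)
  have pair: "indep_var borel (W i) borel (W (K + i))" if "i < K" for i
  proof -
    have "indep_var borel ((\<lambda>x. x i) \<circ> (\<lambda>\<omega>. restrict (\<lambda>i. W i \<omega>) {i})) borel
        ((\<lambda>x. x (K + i)) \<circ> (\<lambda>\<omega>. restrict (\<lambda>i. W i \<omega>) {K + i}))"
      by (rule indep_var_compose[OF indep_var_restrict[OF ind]]) (use that n in auto)
    then show ?thesis by (simp add: comp_def)
  qed
  note rot = std_normal_rotation[OF pair law law]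
  have W'e: "W' (2 * i) = (\<lambda>\<omega>. (W i \<omega> + W (K + i) \<omega>) / sqrt 2)"
    "W' (Suc (2 * i)) = (\<lambda>\<omega>. (W i \<omega> - W (K + i) \<omega>) / sqrt 2)" if "i < K" for i
    using W'1 W'2 that by auto
  have law': "distr M borel (W' j) = std_normal" if "j < n" for j
  proof (cases "j < 2 * K")
    case True
    then have "j div 2 < K" "j div 2 < n" "K + j div 2 < n" using n by auto
    then show ?thesis
      using rot[of "j div 2"] W'e[of "j div 2"] by (cases "even j") (auto elim!: evenE oddE)
  next
    case False
    then have "W' j = W j" using W'3 by auto
    then show ?thesis using law that by simp
  qed
  have rv': "W' j \<in> borel_measurable M" if "j < n" for j
  proof (cases "j < 2 * K")
    case True
    then have "j div 2 < K" "W (j div 2) \<in> borel_measurable M" "W (K + j div 2) \<in> borel_measurable M"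
      using n rv by auto
    then show ?thesis
      using W'e[of "j div 2"] by (cases "even j") (auto elim!: evenE oddE)
  next
    case False
    then have "W' j = W j" using W'3 by auto
    then show ?thesis using rv that by simp
  qed
  let ?L = "{..<K} \<union> {2*K..<n}"
  let ?B = "\<lambda>l. if l < K then {l, K + l} else {l}"
  let ?V = "\<lambda>l \<omega>. (W l \<omega>, if l < K then W (K + l) \<omega> else 0)"
  have indV: "indep_vars (\<lambda>_. borel \<Otimes>\<^sub>M borel) ?V ?L"
  proof -
    have "disjoint_family_on ?B ?L" by (auto simp: disjoint_family_on_def split: if_splits)
    then have "indep_vars (\<lambda>l. PiM (?B l) (\<lambda>_. borel)) (\<lambda>l \<omega>. restrict (\<lambda>i. W i \<omega>) (?B l)) ?L"
      by (intro indep_vars_restrict[OF ind]) (use n in \<open>auto split: if_splits\<close>)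
    then have "indep_vars (\<lambda>_. borel \<Otimes>\<^sub>M borel)
      (\<lambda>l \<omega>. (\<lambda>f. (f l, if l < K then f (K + l) else 0)) (restrict (\<lambda>i. W i \<omega>) (?B l))) ?L"
    proof (rule indep_vars_compose2)
      show "(\<lambda>f. (f l, if l < K then f (K + l) else 0)) \<in> PiM (?B l) (\<lambda>_. borel :: real measure) \<rightarrow>\<^sub>M borel \<Otimes>\<^sub>M borel" for l
        by (cases "l < K") (auto intro!: measurable_Pair measurable_component_singleton)
    qed
    then show ?thesis by (rule indep_vars_cong[THEN iffD1, rotated -1]) auto
  qed
  have fact: "prob (\<Inter>j\<in>{..<n}. W' j -` A j \<inter> space M) = (\<Prod>j\<in>{..<n}. prob (W' j -` A j \<inter> space M))"
    if A: "\<And>j. A j \<in> sets borel" for A :: "nat \<Rightarrow> real set"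
  proof -
    define D where "D l = (if l < K then (\<lambda>z. ((fst z + snd z) / sqrt 2, (fst z - snd z) / sqrt 2)) -` (A (2*l) \<times> A (Suc (2*l))) else A l \<times> UNIV)" for l
    have D: "D l \<in> sets (borel \<Otimes>\<^sub>M borel)" for l
    proof (cases "l < K")
      case True
      have "(\<lambda>z. ((fst z + snd z) / sqrt 2, (fst z - snd z) / sqrt 2) :: real \<times> real) \<in> borel \<Otimes>\<^sub>M borel \<rightarrow>\<^sub>M borel \<Otimes>\<^sub>M borel"
        by measurable
      from measurable_sets[OF this, of "A (2*l) \<times> A (Suc (2*l))"] True A show ?thesis
        by (simp add: D_def space_pair_measure)
    qed (use A in \<open>auto simp: D_def\<close>)
    have Dl: "?V l -` D l \<inter> space M = (W' (2*l) -` A (2*l) \<inter> space M) \<inter> (W' (Suc (2*l)) -` A (Suc (2*l)) \<inter> space M)" if "l < K" for l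
      using that by (auto simp: D_def W'1 W'2)
    have Dg: "?V l -` D l \<inter> space M = W' l -` A l \<inter> space M" if "2 * K \<le> l" for l
      using that by (cases "l < K") (auto simp: D_def W'3)
    have "(\<Inter>j\<in>{..<n}. W' j -` A j \<inter> space M) = (\<Inter>l\<in>?L. ?V l -` D l \<inter> space M)"
    proof (intro equalityI subsetI)
      fix \<omega> assume "\<omega> \<in> (\<Inter>j\<in>{..<n}. W' j -` A j \<inter> space M)"
      then have *: "\<omega> \<in> W' j -` A j \<inter> space M" if "j < n" for j using that by blast
      show "\<omega> \<in> (\<Inter>l\<in>?L. ?V l -` D l \<inter> space M)"
      proof
        fix l assume l: "l \<in> ?L"
        show "\<omega> \<in> ?V l -` D l \<inter> space M"
        proof (cases "l < K")
          case True
          then show ?thesis unfolding Dl[OF True] using *[of "2*l"] *[of "Suc (2*l)"] n by simp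
        next
          case False
          then have "2 * K \<le> l" "l < n" using l by auto
          then show ?thesis unfolding Dg[OF \<open>2 * K \<le> l\<close>] using * by blast
        qed
      qed
    next
      fix \<omega> assume "\<omega> \<in> (\<Inter>l\<in>?L. ?V l -` D l \<inter> space M)"
      then have *: "\<omega> \<in> ?V l -` D l \<inter> space M" if "l \<in> ?L" for l using that by blast
      show "\<omega> \<in> (\<Inter>j\<in>{..<n}. W' j -` A j \<inter> space M)"
      proof
        fix j assume j: "j \<in> {..<n}"
        show "\<omega> \<in> W' j -` A j \<inter> space M"
        proof (cases "j < 2 * K")
          case True
          then have "j div 2 < K" by auto
          then show ?thesis using *[of "j div 2"] unfolding Dl[OF \<open>j div 2 < K\<close>]
            by (cases "even j") (auto elim!: evenE oddE)
        next
          case False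
          then have "2 * K \<le> j" "j \<in> ?L" using j by auto
          then show ?thesis using *[of j] unfolding Dg[OF \<open>2 * K \<le> j\<close>] by blast
        qed
      qed
    qed
    also have "prob \<dots> = (\<Prod>l\<in>?L. prob (?V l -` D l \<inter> space M))"
      by (rule indep_varsD_finite[OF indV]) (use D n0 n in auto)
    also have "\<dots> = (\<Prod>l<K. prob (?V l -` D l \<inter> space M)) * (\<Prod>l\<in>{2*K..<n}. prob (?V l -` D l \<inter> space M))"
      by (rule prod.union_disjoint) auto
    also have "(\<Prod>l\<in>{2*K..<n}. prob (?V l -` D l \<inter> space M)) = (\<Prod>l\<in>{2*K..<n}. prob (W' l -` A l \<inter> space M))"
      by (intro prod.cong refl arg_cong[where f = prob] Dg) auto
    also have "(\<Prod>l<K. prob (?V l -` D l \<inter> space M)) =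
      (\<Prod>l<K. prob (W' (2*l) -` A (2*l) \<inter> space M) * prob (W' (Suc (2*l)) -` A (Suc (2*l)) \<inter> space M))"
    proof (rule prod.cong[OF refl])
      fix l assume "l \<in> {..<K}"
      then have l: "l < K" by simp
      have "indep_var borel (W' (2*l)) borel (W' (Suc (2*l)))"
        unfolding W'e[OF l] by (rule rot(1)) (use l n in auto)
      then have "prob ((\<lambda>x. (W' (2*l) x, W' (Suc (2*l)) x)) -` (A (2*l) \<times> A (Suc (2*l))) \<inter> space M) =
        prob (W' (2*l) -` A (2*l) \<inter> space M) * prob (W' (Suc (2*l)) -` A (Suc (2*l)) \<inter> space M)"
        by (rule indep_varD) (rule A)+
      also have "(\<lambda>x. (W' (2*l) x, W' (Suc (2*l)) x)) -` (A (2*l) \<times> A (Suc (2*l))) \<inter> space M = ?V l -` D l \<inter> space M"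
        unfolding Dl[OF l] by blast
      finally show "prob (?V l -` D l \<inter> space M) =
        prob (W' (2*l) -` A (2*l) \<inter> space M) * prob (W' (Suc (2*l)) -` A (Suc (2*l)) \<inter> space M)" .
    qed
    also have "\<dots> = (\<Prod>j<2*K. prob (W' j -` A j \<inter> space M))"
      by (induction K) (simp_all add: mult.assoc)
    also have "\<dots> * (\<Prod>l\<in>{2*K..<n}. prob (W' l -` A l \<inter> space M)) = (\<Prod>j<n. prob (W' j -` A j \<inter> space M))"
      using prod.atLeastLessThan_concat[of 0 "2*K" n] n by (simp add: atLeast0LessThan)
    finally show ?thesis .
  qed
  have "indep_vars (\<lambda>_. borel) W' {..<n}"
  proof (subst indep_vars_finite[where E = "\<lambda>_. sets borel"])
    show "\<forall>A\<in>(\<Pi> i\<in>{..<n}. sets borel). prob (\<Inter>j\<in>{..<n}. W' j -` A j \<inter> space M) = (\<Prod>j\<in>{..<n}. prob (W' j -` A j \<inter> space M))"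
    proof
      fix A assume A: "A \<in> (\<Pi> i\<in>{..<n}. sets (borel :: real measure))"
      define A' where "A' i = (if i < n then A i else {})" for i
      have "A' j \<in> sets borel" for j using A by (auto simp: A'_def)
      from fact[of A', OF this]
      show "prob (\<Inter>j\<in>{..<n}. W' j -` A j \<inter> space M) = (\<Prod>j\<in>{..<n}. prob (W' j -` A j \<inter> space M))"
        by (simp add: A'_def)
    qed
  qed (use n0 rv' in \<open>auto simp: sets.sigma_sets_eq[of borel, simplified] intro: sets.Int_stable[of borel, simplified] Int_stableI\<close>)
  then show ?thesis using law' by (simp add: iid_std_normal_def)
qed

lemma regressors_le_1_variation_le_1:
  assumes f: "f \<in> regressors q \<delta>" and q: "1 \<le> q"
  shows "t \<in> {0..1} \<Longrightarrow> \<bar>f t\<bar> \<le> 1"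
    and "\<lbrakk>\<And>i. i < m \<Longrightarrow> x i < x (Suc i); x 0 = 0; x m = 1\<rbrakk> \<Longrightarrow>
      (\<Sum>i<m. \<bar>f (x (Suc i)) - f (x i)\<bar> powr q) \<le> 1"
proof -
  define V where "V = real_of_ereal (q_variation q f)"
  have le: "ereal (\<Sum>i<m. \<bar>f (x (Suc i)) - f (x i)\<bar> powr q) \<le> q_variation q f"
    if "m \<ge> 1" "\<And>i. i < m \<Longrightarrow> x i < x (Suc i)" "x 0 = 0" "x m = 1" for m and x :: "nat \<Rightarrow> real"
  proof -
    have "(\<Sum>i<m. \<bar>f (x (Suc i)) - f (x i)\<bar> powr q) = (\<Sum>i=1..m. \<bar>f (x i) - f (x (i - 1))\<bar> powr q)"
      by (simp add: sum.atLeast1_atMost_eq)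
    moreover have "\<forall>i\<in>{1..m}. x (i - 1) < x i" using that(2) by (metis Suc_pred' atLeastAtMost_iff less_eq_Suc_le Suc_le_lessD One_nat_def)
    ultimately show ?thesis unfolding q_variation_def
      by (intro Sup_upper) (use that in auto)
  qed
  have fin: "q_variation q f < \<infinity>" using f by (simp add: regressors_def bounded_q_variation_def)
  have nonneg: "0 \<le> q_variation q f"
    using le[of 1 real] by (auto intro: order_trans[rotated] simp: zero_ereal_def)
  have V: "q_variation q f = ereal V" using fin nonneg by (cases "q_variation q f") (auto simp: V_def)
  have V0: "0 \<le> V" using nonneg V by simp
  have le': "(\<Sum>i<m. \<bar>f (x (Suc i)) - f (x i)\<bar> powr q) \<le> V"
    if "m \<ge> 1" "\<And>i. i < m \<Longrightarrow> x i < x (Suc i)" "x 0 = 0" "x m = 1" for m and x :: "nat \<Rightarrow> real"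
    using le[OF that] unfolding V by simp
  have point: "\<bar>f t - f 0\<bar> powr q \<le> V" if t: "t \<in> {0..1}" for t
  proof -
    consider "t = 0" | "t = 1" | "0 < t" "t < 1" using t by (auto simp: order_le_less)
    then show ?thesis
    proof cases
      case 1 then show ?thesis using V0 by simp
    next
      case 2 then show ?thesis using le'[of 1 real] by simp
    next
      case 3
      have "(\<Sum>i<2. \<bar>f ((\<lambda>i::nat. if i = 0 then 0 else if i = 1 then t else 1) (Suc i)) -
          f ((\<lambda>i::nat. if i = 0 then 0 else if i = 1 then t else 1) i)\<bar> powr q) \<le> V"
        by (rule le') (use 3 in \<open>auto simp: less_2_cases_iff\<close>)
      then have "\<bar>f t - f 0\<bar> powr q + \<bar>f 1 - f t\<bar> powr q \<le> V" by (simp add: numeral_2_eq_2)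
      then show ?thesis using powr_ge_zero[of "\<bar>f 1 - f t\<bar>" q] by linarith
    qed
  qed
  have bnd: "\<bar>f t\<bar> \<le> \<bar>f 0\<bar> + V powr (1/q)" if "t \<in> {0..1}" for t
  proof -
    have "(\<bar>f t - f 0\<bar> powr q) powr (1/q) \<le> V powr (1/q)"
      using point[OF that] q by (intro powr_mono2) auto
    then have "\<bar>f t - f 0\<bar> \<le> V powr (1/q)" using q by (simp add: powr_powr)
    then show ?thesis by linarith
  qed
  then have bdd: "bdd_above ((\<lambda>t. \<bar>f t\<bar>) ` {0..1})" by (intro bdd_aboveI2)
  have norm: "(SUP t\<in>{0..1}. \<bar>f t\<bar>) + V powr (1/q) \<le> 1"
    using f by (simp add: regressors_def q_variation_norm_def V_def)
  show 1: "\<bar>f t\<bar> \<le> 1" if "t \<in> {0..1}" for t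
    using cSUP_upper[OF that bdd] norm powr_ge_zero[of V "1/q"] by linarith
  have "V powr (1/q) \<le> 1"
    using cSUP_upper[of 0 "{0..1::real}", OF _ bdd] norm by force
  then have "(V powr (1/q)) powr q \<le> 1 powr q" using q by (intro powr_mono2) auto
  then have V1: "V \<le> 1" using q V0 by (simp add: powr_powr)
  show "(\<Sum>i<m. \<bar>f (x (Suc i)) - f (x i)\<bar> powr q) \<le> 1"
    if "\<And>i. i < m \<Longrightarrow> x i < x (Suc i)" "x 0 = 0" "x m = 1"
  proof -
    have "m \<noteq> 0" using that(2,3) by (metis zero_neq_one)
    then have "(\<Sum>i<m. \<bar>f (x (Suc i)) - f (x i)\<bar> powr q) \<le> V" by (intro le' that) auto
    then show ?thesis using V1 by linarith
  qed
qed

lemma regressors_normed_variation: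
  assumes f: "f \<in> regressors q \<delta>" and q: "1 \<le> q" and n: "n \<ge> 1"
  shows "normed_variation q n (\<lambda>j. f (real j / real n))"
  unfolding normed_variation_def
proof (intro conjI allI impI)
  fix j assume "j \<le> n"
  then show "\<bar>f (real j / real n)\<bar> \<le> 1" using n by (intro regressors_le_1_variation_le_1(1)[OF f q]) auto
next
  fix m and t :: "nat \<Rightarrow> nat" assume "(\<forall>i<m. t i < t (Suc i)) \<and> t 0 = 0 \<and> t m = n"
  then show "(\<Sum>i<m. \<bar>f (real (t (Suc i)) / real n) - f (real (t i) / real n)\<bar> powr q) \<le> 1"
    using n by (intro regressors_le_1_variation_le_1(2)[OF f q, of m "\<lambda>i. real (t i) / real n"])
      (auto simp: divide_strict_right_mono)
qed

lemma regressors_integral: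
  assumes "f \<in> regressors q \<delta>"
  shows "integral {0..1} (\<lambda>x. (f x)\<^sup>2) > \<delta>"
  using assms by (simp add: regressors_def)

lemma regressors_square_integrable:
  assumes "f \<in> regressors q \<delta>" "0 < \<delta>"
  shows "(\<lambda>x. (f x)\<^sup>2) integrable_on {0..1}"
  using regressors_integral[OF assms(1)] assms(2) not_integrable_integral by force

lemma integral_subdivision:
  fixes h :: "real \<Rightarrow> real"
  assumes "h integrable_on {0..1}" "n \<ge> 1" "m \<le> n"
  shows "integral {0..real m / real n} h = (\<Sum>j<m. integral {real j / real n..real (Suc j) / real n} h)"
  using assms(3)
proof (induction m)
  case (Suc m)
  have "h integrable_on {0..real (Suc m) / real n}"
    by (rule integrable_on_subinterval[OF assms(1)]) (use Suc.prems assms(2) in auto)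
  then have "integral {0..real m / real n} h + integral {real m / real n..real (Suc m) / real n} h =
    integral {0..real (Suc m) / real n} h"
    by (intro Henstock_Kurzweil_Integration.integral_combine) (use assms(2) in \<open>auto simp: divide_right_mono\<close>)
  then show ?case using Suc by simp
qed simp

lemma exists_deviating_point:
  fixes h :: "real \<Rightarrow> real"
  assumes h: "h integrable_on {a..b}" and ab: "a < b"
  shows "\<exists>x\<in>{a<..<b}. \<bar>integral {a..b} h / (b - a) - p\<bar> \<le> 2 * \<bar>h x - p\<bar>"
proof (rule ccontr)
  assume no: "\<not> ?thesis"
  define c where "c = \<bar>integral {a..b} h / (b - a) - p\<bar>"
  have lt: "2 * \<bar>h x - p\<bar> < c" if "x \<in> {a<..<b}" for x
    using no that by (auto simp: c_def not_le)
  have "(a+b)/2 \<in> {a<..<b}" using ab by simp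
  from lt[OF this] have c: "c > 0" by (rule order_le_less_trans[rotated]) simp
  have le: "norm (h x - p) \<le> c / 2" if "x \<in> cbox a b - {a,b}" for x
    using lt[of x] that by auto
  have "((\<lambda>x. h x - p) has_integral (integral {a..b} h - p * (b - a))) (cbox a b)"
    using has_integral_diff[OF integrable_integral[OF h] has_integral_const_real[of p a b]] ab by (simp add: mult.commute)
  then have "norm (integral {a..b} h - p * (b - a)) \<le> c / 2 * measure lborel (cbox a b)"
    by (rule has_integral_bound_spike_finite[of "c/2" "{a,b}", rotated 2, OF _ le]) (use c in auto)
  then have "\<bar>integral {a..b} h - p * (b - a)\<bar> \<le> c / 2 * (b - a)" using ab by simp
  moreover have "integral {a..b} h - p * (b - a) = (integral {a..b} h / (b - a) - p) * (b - a)"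
    using ab by (simp add: field_simps)
  ultimately have "c * (b - a) \<le> c / 2 * (b - a)" using ab by (simp add: c_def abs_mult)
  then show False using c ab by simp
qed

lemma regressors_riemann_sum:
  assumes f: "f \<in> regressors q \<delta>" and q: "1 \<le> q" and \<delta>: "0 < \<delta>" and n: "n \<ge> 1"
  shows "\<bar>(\<Sum>j<n. (f (real (Suc j) / real n))\<^sup>2) / real n - integral {0..1} (\<lambda>x. (f x)\<^sup>2)\<bar> \<le> 12 * real n powr (- 1/q)"
proof -
  let ?h = "\<lambda>x. (f x)\<^sup>2" and ?y = "\<lambda>j. real j / real n"
  have h: "?h integrable_on {0..1}" by (rule regressors_square_integrable[OF f \<delta>])
  have len: "?y (Suc j) - ?y j = 1 / real n" for j by (simp add: diff_divide_distrib[symmetric])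
  have y: "?y j < ?y (Suc j)" for j using n by (simp add: divide_strict_right_mono)
  have "\<exists>x\<in>{?y j<..<?y (Suc j)}. \<bar>integral {?y j..?y (Suc j)} ?h / (1 / real n) - ?h (?y (Suc j))\<bar> \<le> 2 * \<bar>?h x - ?h (?y (Suc j))\<bar>"
    if "j < n" for j
    using exists_deviating_point[OF integrable_on_subinterval[OF h] y[of j], of "?h (?y (Suc j))"] that n
    unfolding len by auto
  then obtain x where x: "\<And>j. j < n \<Longrightarrow> x j \<in> {?y j<..<?y (Suc j)}"
    "\<And>j. j < n \<Longrightarrow> \<bar>integral {?y j..?y (Suc j)} ?h / (1 / real n) - ?h (?y (Suc j))\<bar> \<le> 2 * \<bar>?h (x j) - ?h (?y (Suc j))\<bar>"
    by metis
  define t where "t i = (if even i then ?y (i div 2) else x (i div 2))" for i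
  have "(\<Sum>i<2*n. \<bar>f (t (Suc i)) - f (t i)\<bar> powr q) \<le> 1"
  proof (rule regressors_le_1_variation_le_1(2)[OF f q])
    fix i assume "i < 2 * n"
    then show "t i < t (Suc i)" using x(1)[of "i div 2"] by (auto simp: t_def elim!: evenE oddE)
  qed (use n in \<open>auto simp: t_def\<close>)
  then have "(\<Sum>i<2*n. \<bar>f (t (Suc i)) - f (t i)\<bar>) \<le> real (2*n) * real n powr (-1/q) + (real n powr (-1/q)) powr (1 - q)"
    using n by (intro sum_le_linear_of_sum_powr_le q) auto
  also have "(real n powr (-1/q)) powr (1 - q) = real n * real n powr (-1/q)"
  proof -
    have "(real n powr (-1/q)) powr (1 - q) = real n powr ((-1/q) * (1 - q))" by (rule powr_powr)
    also have "(-1/q) * (1 - q) = 1 + (-1/q)" using q by (simp add: field_simps)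
    also have "real n powr (1 + (-1/q)) = real n powr 1 * real n powr (-1/q)" by (rule powr_add)
    finally show ?thesis using n by simp
  qed
  finally have var: "(\<Sum>i<2*n. \<bar>f (t (Suc i)) - f (t i)\<bar>) \<le> 3 * real n * real n powr (-1/q)" by simp
  have "(\<Sum>j<n. \<bar>f (x j) - f (?y (Suc j))\<bar>) \<le> (\<Sum>j<n. \<bar>f (t (Suc (2*j))) - f (t (2*j))\<bar> + \<bar>f (t (Suc (Suc (2*j)))) - f (t (Suc (2*j)))\<bar>)"
    by (rule sum_mono) (simp add: t_def abs_minus_commute)
  also have "\<dots> = (\<Sum>i<2*n. \<bar>f (t (Suc i)) - f (t i)\<bar>)" by (induction n) simp_all
  finally have sumx: "(\<Sum>j<n. \<bar>f (x j) - f (?y (Suc j))\<bar>) \<le> 3 * real n * real n powr (-1/q)" using var by linarith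
  have piece: "\<bar>?h (?y (Suc j)) / real n - integral {?y j..?y (Suc j)} ?h\<bar> \<le> 4 / real n * \<bar>f (x j) - f (?y (Suc j))\<bar>" if j: "j < n" for j
  proof -
    have in01: "x j \<in> {0..1}" "?y (Suc j) \<in> {0..1}"
    proof -
      show y1: "?y (Suc j) \<in> {0..1}" using j by auto
      have "0 \<le> ?y j" by simp
      moreover have "?y j < x j" "x j < ?y (Suc j)" using x(1)[OF j] by simp_all
      moreover have "?y (Suc j) \<le> 1" using y1 by simp
      ultimately have "0 \<le> x j" "x j \<le> 1" by linarith+
      then show "x j \<in> {0..1}" by simp
    qed
    have "\<bar>?h (x j) - ?h (?y (Suc j))\<bar> = \<bar>f (x j) + f (?y (Suc j))\<bar> * \<bar>f (x j) - f (?y (Suc j))\<bar>"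
      by (simp add: power2_eq_square algebra_simps flip: abs_mult)
    also have "\<dots> \<le> 2 * \<bar>f (x j) - f (?y (Suc j))\<bar>"
      using regressors_le_1_variation_le_1(1)[OF f q in01(1)] regressors_le_1_variation_le_1(1)[OF f q in01(2)]
      by (intro mult_right_mono) linarith+
    finally have "2 * \<bar>?h (x j) - ?h (?y (Suc j))\<bar> \<le> 4 * \<bar>f (x j) - f (?y (Suc j))\<bar>" by simp
    from order_trans[OF x(2)[OF j] this]
    have "\<bar>integral {?y j..?y (Suc j)} ?h / (1 / real n) - ?h (?y (Suc j))\<bar> \<le> 4 * \<bar>f (x j) - f (?y (Suc j))\<bar>" .
    then have "\<bar>integral {?y j..?y (Suc j)} ?h / (1 / real n) - ?h (?y (Suc j))\<bar> / real n \<le> 4 * \<bar>f (x j) - f (?y (Suc j))\<bar> / real n"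
      by (simp add: divide_right_mono)
    also have "\<bar>integral {?y j..?y (Suc j)} ?h / (1 / real n) - ?h (?y (Suc j))\<bar> / real n =
       \<bar>(integral {?y j..?y (Suc j)} ?h / (1 / real n) - ?h (?y (Suc j))) / real n\<bar>" by simp
    also have "(integral {?y j..?y (Suc j)} ?h / (1 / real n) - ?h (?y (Suc j))) / real n = integral {?y j..?y (Suc j)} ?h - ?h (?y (Suc j)) / real n"
      using n by (simp add: field_simps)
    finally show ?thesis by (simp add: abs_minus_commute)
  qed
  have "integral {0..1} ?h = (\<Sum>j<n. integral {?y j..?y (Suc j)} ?h)"
    using integral_subdivision[OF h n, of n] n by simp
  then have eq: "(\<Sum>j<n. ?h (?y (Suc j))) / real n - integral {0..1} ?h = (\<Sum>j<n. ?h (?y (Suc j)) / real n - integral {?y j..?y (Suc j)} ?h)"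
    by (simp add: sum_subtractf sum_divide_distrib)
  have "\<bar>(\<Sum>j<n. ?h (?y (Suc j))) / real n - integral {0..1} ?h\<bar> \<le> (\<Sum>j<n. 4 / real n * \<bar>f (x j) - f (?y (Suc j))\<bar>)"
    unfolding eq by (rule order_trans[OF sum_abs sum_mono]) (rule piece, simp)
  also have "\<dots> = 4 / real n * (\<Sum>j<n. \<bar>f (x j) - f (?y (Suc j))\<bar>)" by (simp add: sum_distrib_left)
  also have "\<dots> \<le> 4 / real n * (3 * real n * real n powr (-1/q))" by (intro mult_left_mono sumx) simp
  also have "\<dots> = 12 * real n powr (-1/q)" using n by simp
  finally show ?thesis .
qed

fun haar :: "nat \<Rightarrow> nat \<Rightarrow> (nat \<Rightarrow> real) \<Rightarrow> real" where
  "haar 0 j x = x j"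
| "haar (Suc k) j x = (if j < 2 * 2^k
     then (haar k (j div 2) x + (if even j then 1 else -1) * haar k (2^k + j div 2) x) / sqrt 2
     else haar k j x)"

declare haar.simps(2) [simp del]

definition white_noise :: "(nat \<Rightarrow> real) measure" where
  "white_noise = PiM UNIV (\<lambda>_. std_normal)"

lemma prob_space_white_noise: "prob_space white_noise"
  unfolding white_noise_def by (rule prob_space_PiM) (rule prob_space_std_normal)

lemma sets_white_noise [measurable_cong]: "sets white_noise = sets (PiM UNIV (\<lambda>_::nat. borel :: real measure))"
  unfolding white_noise_def by (intro sets_PiM_cong) auto

lemma space_white_noise [simp]: "space white_noise = UNIV"
  by (simp add: white_noise_def space_PiM)

lemma haar_measurable [measurable]: "haar k j \<in> borel_measurable white_noise"
proof (induction k arbitrary: j)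
  case 0
  have "(\<lambda>x. x j) \<in> borel_measurable (PiM UNIV (\<lambda>_::nat. borel :: real measure))" by measurable
  then show ?case by (simp add: measurable_cong_sets[OF sets_white_noise refl])
next
  case (Suc k)
  note [measurable] = Suc
  show ?case unfolding haar.simps(2)[abs_def] by measurable
qed

lemma iid_haar_0: "iid_std_normal white_noise (haar 0) n"
proof -
  interpret prob_space white_noise by (rule prob_space_white_noise)
  have law: "distr white_noise borel (\<lambda>x. x i) = std_normal" for i
  proof -
    have "distr white_noise std_normal (\<lambda>x. x i) = std_normal"
      unfolding white_noise_def by (rule distr_PiM_component) (auto intro: prob_space_std_normal)
    moreover have "distr white_noise std_normal (\<lambda>x. x i) = distr white_noise borel (\<lambda>x. x i)"
      by (rule distr_cong) auto
    ultimately show ?thesis by simp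
  qed
  have rv: "random_variable borel (\<lambda>x. x i)" for i using haar_measurable[of 0 i] by simp
  have "distr white_noise (PiM UNIV (\<lambda>_. borel)) (\<lambda>x. restrict x UNIV) = PiM UNIV (\<lambda>i. distr white_noise borel (\<lambda>x. x i))"
    unfolding law white_noise_def[symmetric] restrict_UNIV by (rule distr_id2) (simp add: sets_white_noise)
  then have "indep_vars (\<lambda>_. borel) (\<lambda>i x. x i) UNIV"
    by (subst indep_vars_iff_distr_eq_PiM) (auto intro: rv)
  then have "indep_vars (\<lambda>_. borel) (\<lambda>i x. x i) {..<n}" by (rule indep_vars_subset) simp
  moreover have "haar 0 = (\<lambda>i x. x i)" by (intro ext) simp
  ultimately show ?thesis by (simp add: iid_std_normal_def law)
qed

lemma iid_haar: "2^k \<le> n \<Longrightarrow> iid_std_normal white_noise (haar k) n"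
proof (induction k)
  case 0
  show ?case by (rule iid_haar_0)
next
  case (Suc k)
  interpret prob_space white_noise by (rule prob_space_white_noise)
  from Suc have W: "iid_std_normal white_noise (haar k) n" "2 * 2^k \<le> n" by auto
  show ?case
    by (rule iid_std_normal_rotate_pairs[OF W]) (auto simp: haar.simps(2))
qed

lemma haar_refine:
  assumes "i < 2^k"
  shows "haar (Suc k) (2*i) x / sqrt (2^Suc k) + haar (Suc k) (Suc (2*i)) x / sqrt (2^Suc k) = haar k i x / sqrt (2^k)"
  using assms by (simp add: haar.simps(2) real_sqrt_mult field_simps)

definition wiener_sum :: "nat \<Rightarrow> (nat \<Rightarrow> real) \<Rightarrow> (real \<Rightarrow> real) \<Rightarrow> real" where
  "wiener_sum k x f = (\<Sum>i<2^k. f (real (Suc i) / 2^k) * (haar k i x / sqrt (2^k)))"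

lemma sum_pairs:
  fixes a :: "nat \<Rightarrow> real"
  shows "(\<Sum>j<2*n. a j) = (\<Sum>i<n. a (2*i) + a (Suc (2*i)))"
  by (induction n) (simp_all add: add.assoc)

lemma wiener_sum_refine:
  "wiener_sum (Suc k) x f - wiener_sum k x f =
    (\<Sum>i<2^k. (f (real (Suc (2*i)) / 2^Suc k) - f (real (Suc (Suc (2*i))) / 2^Suc k)) * (haar (Suc k) (2*i) x / sqrt (2^Suc k)))"
proof -
  have "wiener_sum k x f = (\<Sum>i<2^k. f (real (Suc (Suc (2*i))) / 2^Suc k) *
      (haar (Suc k) (2*i) x / sqrt (2^Suc k) + haar (Suc k) (Suc (2*i)) x / sqrt (2^Suc k)))"
    unfolding wiener_sum_def
  proof (rule sum.cong[OF refl])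
    fix i :: nat assume "i \<in> {..<2^k}"
    then have "haar k i x / sqrt (2^k) = haar (Suc k) (2*i) x / sqrt (2^Suc k) + haar (Suc k) (Suc (2*i)) x / sqrt (2^Suc k)"
      using haar_refine[of i k x] by simp
    moreover have "real (Suc i) / 2^k = real (Suc (Suc (2*i))) / 2^Suc k" by (simp add: field_simps)
    ultimately show "f (real (Suc i) / 2^k) * (haar k i x / sqrt (2^k)) = f (real (Suc (Suc (2*i))) / 2^Suc k) *
      (haar (Suc k) (2*i) x / sqrt (2^Suc k) + haar (Suc k) (Suc (2*i)) x / sqrt (2^Suc k))" by metis
  qed
  moreover have "wiener_sum (Suc k) x f = (\<Sum>i<2^k. f (real (Suc (2*i)) / 2^Suc k) * (haar (Suc k) (2*i) x / sqrt (2^Suc k)) +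
      f (real (Suc (Suc (2*i))) / 2^Suc k) * (haar (Suc k) (Suc (2*i)) x / sqrt (2^Suc k)))"
    unfolding wiener_sum_def using sum_pairs[of "\<lambda>j. f (real (Suc j) / 2^Suc k) * (haar (Suc k) j x / sqrt (2^Suc k))" "2^k"]
    by simp
  ultimately show ?thesis by (simp add: sum_subtractf[symmetric] algebra_simps)
qed

lemma AE_summable_of_summable_integral:
  fixes b :: "nat \<Rightarrow> 'a \<Rightarrow> real"
  assumes "\<And>k. integrable M (b k)" "\<And>k x. 0 \<le> b k x" "summable (\<lambda>k. \<integral>x. b k x \<partial>M)"
  shows "AE x in M. summable (\<lambda>k. b k x)"
proof -
  have [measurable]: "b k \<in> borel_measurable M" for k using assms(1) by auto
  have "(\<integral>\<^sup>+x. (\<Sum>k. ennreal (b k x)) \<partial>M) = (\<Sum>k. \<integral>\<^sup>+x. ennreal (b k x) \<partial>M)"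
    by (rule nn_integral_suminf) measurable
  also have "\<dots> = (\<Sum>k. ennreal (\<integral>x. b k x \<partial>M))"
    using assms by (intro suminf_cong nn_integral_eq_integral) auto
  also have "\<dots> = ennreal (\<Sum>k. \<integral>x. b k x \<partial>M)"
    using assms by (intro suminf_ennreal2) auto
  finally have "(\<integral>\<^sup>+x. (\<Sum>k. ennreal (b k x)) \<partial>M) \<noteq> \<infinity>" by simp
  then have "AE x in M. (\<Sum>k. ennreal (b k x)) \<noteq> \<infinity>"
    by (intro nn_integral_PInf_AE) measurable
  then show ?thesis
    by (rule AE_mp) (auto intro!: AE_I2 summable_suminf_not_top simp: assms)
qed

text \<open>The maximum of the \<open>|h\<^sub>i|\<close> is bounded through \<open>|h| \<le> y + h^(2r+2) / y^(2r+1)\<close>; a large \<open>r\<close> makes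
  the expectations summable over \<open>k\<close>.\<close>

definition haar_bound :: "real \<Rightarrow> real \<Rightarrow> nat \<Rightarrow> nat \<Rightarrow> (nat \<Rightarrow> real) \<Rightarrow> real" where
  "haar_bound q s r k x = (let m = 2^Suc k; y = m powr (- s) in
     2 * m powr (1 - 1/q) * (y + (\<Sum>i<2^Suc k. (haar (Suc k) i x / sqrt m)^(2 * Suc r) / y^(2 * r + 1))))"

lemma haar_bound_nonneg: "0 \<le> haar_bound q s r k x"
  unfolding haar_bound_def Let_def
  by (intro mult_nonneg_nonneg add_nonneg_nonneg sum_nonneg divide_nonneg_nonneg[OF zero_le_even_power zero_le_power]) auto

lemma wiener_sum_increment_le:
  assumes f: "f \<in> regressors q \<delta>" and q: "1 \<le> q"
  shows "\<bar>wiener_sum (Suc k) x f - wiener_sum k x f\<bar> \<le> haar_bound q s r k x"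
proof -
  define m where "m = (2::real)^Suc k"
  define y where "y = m powr (- s)"
  define B where "B = y + (\<Sum>i<2^Suc k. (haar (Suc k) i x / sqrt m)^(2 * Suc r) / y^(2 * r + 1))"
  have m: "m > 0" and y: "y > 0" by (auto simp: m_def y_def)
  have nn: "0 \<le> (haar (Suc k) i x / sqrt m)^(2 * Suc r) / y^(2 * r + 1)" for i
    using y by (intro divide_nonneg_nonneg[OF zero_le_even_power zero_le_power]) auto
  have D: "\<bar>haar (Suc k) i x / sqrt m\<bar> \<le> B" if "i < 2^Suc k" for i
  proof (cases "\<bar>haar (Suc k) i x / sqrt m\<bar> \<le> y")
    case True
    moreover have "0 \<le> (\<Sum>i<2^Suc k. (haar (Suc k) i x / sqrt m)^(2 * Suc r) / y^(2 * r + 1))"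
      by (intro sum_nonneg nn)
    ultimately show ?thesis unfolding B_def by linarith
  next
    case False
    let ?d = "\<bar>haar (Suc k) i x / sqrt m\<bar>"
    have "?d * y^(2 * r + 1) \<le> ?d * ?d^(2 * r + 1)"
      using False y by (intro mult_left_mono power_mono) auto
    also have "\<dots> = ?d^(2 * Suc r)" by simp
    also have "\<dots> = (haar (Suc k) i x / sqrt m)^(2 * Suc r)" by (rule power_even_abs) simp
    finally have "?d * y^(2 * r + 1) \<le> (haar (Suc k) i x / sqrt m)^(2 * Suc r)" .
    then have "?d \<le> (haar (Suc k) i x / sqrt m)^(2 * Suc r) / y^(2 * r + 1)"
      using pos_le_divide_eq[OF zero_less_power[OF y]] by blast
    also have "\<dots> \<le> (\<Sum>i<2^Suc k. (haar (Suc k) i x / sqrt m)^(2 * Suc r) / y^(2 * r + 1))"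
      by (rule member_le_sum) (use that nn in auto)
    finally show ?thesis using y unfolding B_def by linarith
  qed
  have B0: "0 \<le> B" using D[of 0] by (rule order_trans[OF abs_ge_zero]) simp
  let ?g = "\<lambda>j. f (real j / real (2^Suc k))"
  have "normed_variation q (2^Suc k) ?g" by (rule regressors_normed_variation[OF f q]) simp
  then have var: "(\<Sum>i<2^Suc k. \<bar>?g (Suc i) - ?g i\<bar> powr q) \<le> 1"
    unfolding normed_variation_def by (auto dest!: spec[of _ "2^Suc k"] spec[of _ "\<lambda>i. i"])
  have sumg: "(\<Sum>i<2^Suc k. \<bar>?g (Suc i) - ?g i\<bar>) \<le> 2 * m powr (1 - 1/q)"
  proof -
    have "(\<Sum>i<2^Suc k. \<bar>?g (Suc i) - ?g i\<bar>) \<le> real (2^Suc k) * m powr (-1/q) + (m powr (-1/q)) powr (1 - q)"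
      by (rule sum_le_linear_of_sum_powr_le[OF q _ _ var]) (use m in auto)
    also have "real (2^Suc k) * m powr (-1/q) = m powr (1 - 1/q)"
    proof -
      have "m powr (1 + (- 1/q)) = m powr 1 * m powr (-1/q)" by (rule powr_add)
      then show ?thesis using m by (simp add: m_def)
    qed
    also have "(m powr (-1/q)) powr (1 - q) = m powr (1 - 1/q)"
    proof -
      have "(-1/q) * (1 - q) = 1 - 1/q" using q by (simp add: field_simps)
      then show ?thesis by (simp only: powr_powr)
    qed
    finally show ?thesis by simp
  qed
  have "\<bar>wiener_sum (Suc k) x f - wiener_sum k x f\<bar> \<le>
    (\<Sum>i<2^k. \<bar>(?g (Suc (2*i)) - ?g (Suc (Suc (2*i)))) * (haar (Suc k) (2*i) x / sqrt m)\<bar>)"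
    unfolding wiener_sum_refine m_def by (rule order_trans[OF sum_abs]) simp
  also have "\<dots> \<le> (\<Sum>i<2^k. (\<bar>?g (Suc (2*i)) - ?g (2*i)\<bar> + \<bar>?g (Suc (Suc (2*i))) - ?g (Suc (2*i))\<bar>) * B)"
  proof (rule sum_mono)
    fix i :: nat assume "i \<in> {..<2^k}"
    then have "2 * i < 2^Suc k" by simp
    from D[OF this] show "\<bar>(?g (Suc (2*i)) - ?g (Suc (Suc (2*i)))) * (haar (Suc k) (2*i) x / sqrt m)\<bar> \<le>
      (\<bar>?g (Suc (2*i)) - ?g (2*i)\<bar> + \<bar>?g (Suc (Suc (2*i))) - ?g (Suc (2*i))\<bar>) * B"
      unfolding abs_mult by (intro mult_mono) (auto simp: abs_minus_commute)
  qed
  also have "\<dots> = (\<Sum>i<2^k. \<bar>?g (Suc (2*i)) - ?g (2*i)\<bar> + \<bar>?g (Suc (Suc (2*i))) - ?g (Suc (2*i))\<bar>) * B"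
    by (simp only: sum_distrib_right)
  also have "\<dots> = (\<Sum>i<2^Suc k. \<bar>?g (Suc i) - ?g i\<bar>) * B"
    using sum_pairs[of "\<lambda>j. \<bar>?g (Suc j) - ?g j\<bar>" "2^k"] by simp
  also have "\<dots> \<le> 2 * m powr (1 - 1/q) * B" by (rule mult_right_mono[OF sumg B0])
  also have "\<dots> = haar_bound q s r k x" by (simp add: haar_bound_def Let_def B_def y_def m_def)
  finally show ?thesis .
qed

lemma haar_moment:
  assumes "i < 2^k"
  shows "integrable white_noise (\<lambda>x. (haar k i x)^(2*p))"
    and "(\<integral>x. (haar k i x)^(2*p) \<partial>white_noise) = fact (2*p) / (2^p * fact p)"
proof -
  have law: "distr white_noise borel (haar k i) = std_normal"
    using iid_haar[of k "2^k"] assms by (simp add: iid_std_normal_def)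
  have "integrable (distr white_noise borel (haar k i)) (\<lambda>x. x^(2*p))"
    unfolding law by (rule std_normal_distribution_even_moments)
  then show "integrable white_noise (\<lambda>x. (haar k i x)^(2*p))" by (simp add: integrable_distr_eq)
  have "(\<integral>x. x^(2*p) \<partial>distr white_noise borel (haar k i)) = fact (2*p) / (2^p * fact p)"
    unfolding law by (rule std_normal_distribution_even_moments)
  then show "(\<integral>x. (haar k i x)^(2*p) \<partial>white_noise) = fact (2*p) / (2^p * fact p)" by (simp add: integral_distr)
qed

lemma (in prob_space) expectation_affine_sum:
  fixes h :: "'i \<Rightarrow> 'a \<Rightarrow> real"
  assumes "\<And>i. i \<in> A \<Longrightarrow> integrable M (h i)"
  shows "expectation (\<lambda>x. a * (y + (\<Sum>i\<in>A. h i x / C / D))) = a * (y + (\<Sum>i\<in>A. expectation (h i) / C / D))"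
  using assms by (simp add: prob_space)

lemma AE_summable_haar_bound:
  assumes q: "1 \<le> q" "q < 2"
  shows "\<exists>s r. AE x in white_noise. summable (\<lambda>k. haar_bound q s r k x)"
proof -
  interpret prob_space white_noise by (rule prob_space_white_noise)
  define \<kappa> where "\<kappa> = 1 - 1/q"
  define s where "s = (\<kappa> + 1/2) / 2"
  have \<kappa>: "\<kappa> < s" "s < 1/2" using q by (auto simp: \<kappa>_def s_def field_simps)
  obtain r :: nat where "1 / (1 - 2 * s) \<le> real r" using real_arch_simple by blast
  then have r: "1 \<le> real (Suc r) * (1 - 2 * s)" using \<kappa> by (simp add: divide_le_eq algebra_simps)
  define c where "c = (fact (2 * Suc r) / (2^Suc r * fact (Suc r)) :: real)"
  have c: "0 \<le> c" by (simp add: c_def)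
  have int: "integrable white_noise (haar_bound q s r k)" for k
    unfolding haar_bound_def[abs_def] Let_def power_divide
    by (intro integrable_mult_right Bochner_Integration.integrable_add Bochner_Integration.integrable_sum integrable_divide integrable_const)
      (auto intro!: haar_moment simp del: mult_Suc_right)
  have E: "expectation (haar_bound q s r k) \<le> 2 * (1 + c) * (2 powr (\<kappa> - s))^Suc k" for k
  proof -
    define m where "m = (2::real)^Suc k"
    define y where "y = m powr (- s)"
    have m: "1 \<le> m" "m > 0" and y: "y > 0" unfolding m_def y_def by (simp_all del: power_Suc)
    have mm: "(sqrt m)^(2 * Suc r) = m^Suc r" using m by (simp only: power_mult real_sqrt_pow2 less_imp_le)
    have hm: "integrable white_noise (\<lambda>x. (haar (Suc k) i x)^(2 * Suc r))"
      "expectation (\<lambda>x. (haar (Suc k) i x)^(2 * Suc r)) = c" if "i \<in> {..<2^Suc k}" for i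
      using haar_moment[of i "Suc k" "Suc r"] that unfolding c_def by blast+
    have "expectation (haar_bound q s r k) =
      expectation (\<lambda>x. 2 * m powr \<kappa> * (y + (\<Sum>i<2^Suc k. (haar (Suc k) i x)^(2 * Suc r) / m^Suc r / y^(2 * r + 1))))"
      unfolding haar_bound_def[abs_def] Let_def power_divide m_def[symmetric] y_def[symmetric] \<kappa>_def[symmetric] mm ..
    also have "\<dots> = 2 * m powr \<kappa> * (y + (\<Sum>i<2^Suc k. expectation (\<lambda>x. (haar (Suc k) i x)^(2 * Suc r)) / m^Suc r / y^(2 * r + 1)))"
      by (rule expectation_affine_sum) (rule hm(1))
    also have "\<dots> = 2 * m powr \<kappa> * (y + (\<Sum>i<(2::nat)^Suc k. c / m^Suc r / y^(2 * r + 1)))"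
      by (intro arg_cong2[where f = "(*)"] arg_cong2[where f = "(+)"] arg_cong2[where f = "(/)"] sum.cong refl hm(2))
    also have "(\<Sum>i<(2::nat)^Suc k. c / m^Suc r / y^(2 * r + 1)) = m * c / m^Suc r / y^(2 * r + 1)"
      by (simp add: m_def)
    also have "\<dots> = c * (m powr (1 - real (Suc r) + s * (2 * real r + 1)))"
    proof -
      have "m^Suc r = m powr real (Suc r)" using m by (simp only: powr_realpow)
      moreover have "y^(2 * r + 1) = m powr (- (s * (2 * real r + 1)))"
        unfolding y_def using m by (subst powr_power) (auto simp: algebra_simps)
      moreover have "m = m powr 1" using m by simp
      ultimately have "m * c / m^Suc r / y^(2 * r + 1) = c * (m powr 1 / m powr real (Suc r) / m powr (- (s * (2 * real r + 1))))"
        by simp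
      also have "m powr 1 / m powr real (Suc r) / m powr (- (s * (2 * real r + 1))) = m powr (1 - real (Suc r) + s * (2 * real r + 1))"
        by (simp only: powr_diff[symmetric]) simp
      finally show ?thesis .
    qed
    also have "\<dots> \<le> c * m powr (- s)"
    proof (intro mult_left_mono powr_mono c m)
      show "1 - real (Suc r) + s * (2 * real r + 1) \<le> - s" using r by (simp add: algebra_simps)
    qed
    finally have "expectation (haar_bound q s r k) \<le> 2 * m powr \<kappa> * (y + c * m powr (- s))"
      by (simp add: mult_left_mono)
    also have "\<dots> = 2 * (1 + c) * (m powr \<kappa> * m powr (- s))" by (simp add: y_def algebra_simps)
    also have "m powr \<kappa> * m powr (- s) = m powr (\<kappa> - s)" by (simp flip: powr_add)
    also have "\<dots> = (2 powr (\<kappa> - s))^Suc k"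
      unfolding m_def by (subst powr_power) (simp_all add: powr_powr del: power_Suc of_nat_Suc flip: powr_realpow)
    finally show ?thesis .
  qed
  have "summable (\<lambda>k. 2 * (1 + c) * (2 powr (\<kappa> - s))^Suc k)"
  proof -
    have "(2::real) powr (\<kappa> - s) < 2 powr 0" using \<kappa> by (intro powr_less_mono) auto
    then have "summable (\<lambda>k. (2 powr (\<kappa> - s))^Suc k)" by (subst summable_Suc_iff) (simp add: summable_geometric)
    then show ?thesis by (rule summable_mult)
  qed
  then have "summable (\<lambda>k. expectation (haar_bound q s r k))"
    by (rule summable_comparison_test'[of _ 0]) (use E in \<open>simp add: haar_bound_nonneg\<close>)
  then have "AE x in white_noise. summable (\<lambda>k. haar_bound q s r k x)"
    by (intro AE_summable_of_summable_integral int haar_bound_nonneg)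
  then show ?thesis by blast
qed

section \<open>The limit process\<close>

lemma openin_mtopology_of_iff:
  "openin (mtopology_of E) U \<longleftrightarrow> U \<subseteq> mspace E \<and> (\<forall>x\<in>U. \<exists>r>0. \<forall>y\<in>mspace E. mdist E x y < r \<longrightarrow> y \<in> U)"
proof -
  interpret E: Metric_space "mspace E" "mdist E" by simp
  have "openin (mtopology_of E) U \<longleftrightarrow> U \<subseteq> mspace E \<and> (\<forall>x. x \<in> U \<longrightarrow> (\<exists>r>0. E.mball x r \<subseteq> U))"
    by (simp add: mtopology_of_def E.openin_mtopology)
  also have "\<dots> \<longleftrightarrow> U \<subseteq> mspace E \<and> (\<forall>x\<in>U. \<exists>r>0. \<forall>y\<in>mspace E. mdist E x y < r \<longrightarrow> y \<in> U)"
  proof -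
    have "E.mball x r \<subseteq> U \<longleftrightarrow> (\<forall>y\<in>mspace E. mdist E x y < r \<longrightarrow> y \<in> U)" if "x \<in> mspace E" for x r
      using that by (auto simp: E.mball_def)
    then show ?thesis by blast
  qed
  finally show ?thesis .
qed

lemma continuous_map_mtopology_of_real_iff:
  "continuous_map (mtopology_of E) euclideanreal h \<longleftrightarrow>
    (\<forall>x\<in>mspace E. \<forall>e>0. \<exists>r>0. \<forall>y\<in>mspace E. mdist E x y < r \<longrightarrow> \<bar>h x - h y\<bar> < e)"
proof -
  interpret E: Metric_space "mspace E" "mdist E" by simp
  have "continuous_map (mtopology_of E) euclideanreal h \<longleftrightarrow> continuous_map E.mtopology Met_TC.mtopology h"
    by (simp add: mtopology_of_def)
  also have "\<dots> \<longleftrightarrow> (\<forall>x\<in>mspace E. \<forall>e>0. \<exists>r>0. \<forall>y\<in>mspace E. mdist E x y < r \<longrightarrow> \<bar>h x - h y\<bar> < e)"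
    unfolding E.metric_continuous_map[OF Met_TC.Metric_space_axioms] by (auto simp: dist_real_def) blast+
  finally show ?thesis .
qed

lemma continuous_map_tendsto:
  assumes h: "continuous_map (mtopology_of E) euclideanreal h"
    and X: "\<And>n. X n \<in> mspace E" "Y \<in> mspace E" "(\<lambda>n. mdist E (X n) Y) \<longlonglongrightarrow> 0"
  shows "(\<lambda>n. h (X n)) \<longlonglongrightarrow> h Y"
proof (rule tendstoI)
  fix e :: real assume "e > 0"
  then obtain r where r: "r > 0" "\<And>y. y \<in> mspace E \<Longrightarrow> mdist E Y y < r \<Longrightarrow> \<bar>h Y - h y\<bar> < e"
    using h X(2) unfolding continuous_map_mtopology_of_real_iff by meson
  have "\<forall>\<^sub>F n in sequentially. mdist E (X n) Y < r" by (rule order_tendstoD(2)[OF X(3) r(1)])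
  then show "\<forall>\<^sub>F n in sequentially. dist (h (X n)) (h Y) < e"
  proof eventually_elim
    case (elim n)
    then have "mdist E Y (X n) < r" by (simp add: mdist_commute)
    from r(2)[OF X(1) this] show ?case by (simp add: dist_real_def abs_minus_commute)
  qed
qed

lemma borel_on_rangeI:
  assumes Z: "Z \<in> space M \<rightarrow> mspace E"
    and h: "\<And>h. continuous_map (mtopology_of E) euclideanreal h \<Longrightarrow> (\<lambda>\<omega>. h (Z \<omega>)) \<in> borel_measurable M"
  shows "borel_on_range E M Z"
  unfolding borel_on_range_def borel_of_topology_def
proof (rule measurable_measure_of)
  let ?X = "subtopology (mtopology_of E) (Z ` space M)"
  show "{U. openin ?X U} \<subseteq> Pow (topspace ?X)" using openin_subset by blast
  show "Z \<in> space M \<rightarrow> topspace ?X" using Z by auto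
  fix U assume "U \<in> {U. openin ?X U}"
  then obtain T where T: "openin (mtopology_of E) T" "U = T \<inter> Z ` space M" by (auto simp: openin_subtopology)
  have eq: "Z -` U \<inter> space M = {\<omega>\<in>space M. Z \<omega> \<in> T}" using T by auto
  show "Z -` U \<inter> space M \<in> sets M"
  proof (cases "mspace E - T = {}")
    case True
    then have "{\<omega>\<in>space M. Z \<omega> \<in> T} = space M" using Z by auto
    then show ?thesis unfolding eq by simp
  next
    case False
    define d where "d x = (INF y\<in>mspace E - T. mdist E x y)" for x
    have bdd: "bdd_below (mdist E x ` (mspace E - T))" for x by (intro bdd_belowI2[of _ 0]) simp
    have lip: "d x \<le> mdist E x x' + d x'" if "x \<in> mspace E" "x' \<in> mspace E" for x x'
    proof -
      have "d x - mdist E x x' \<le> mdist E x' y" if y: "y \<in> mspace E - T" for y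
      proof -
        have "d x \<le> mdist E x y" unfolding d_def by (rule cINF_lower[OF bdd y])
        also have "\<dots> \<le> mdist E x x' + mdist E x' y" using that \<open>x \<in> _\<close> \<open>x' \<in> _\<close> by (intro mdist_triangle) auto
        finally show ?thesis by simp
      qed
      then have "d x - mdist E x x' \<le> d x'" unfolding d_def[of x'] by (rule cINF_greatest[OF False])
      then show ?thesis by simp
    qed
    have "continuous_map (mtopology_of E) euclideanreal d"
      unfolding continuous_map_mtopology_of_real_iff
    proof (intro ballI allI impI)
      fix x and e :: real assume xe: "x \<in> mspace E" "e > 0"
      show "\<exists>r>0. \<forall>y\<in>mspace E. mdist E x y < r \<longrightarrow> \<bar>d x - d y\<bar> < e"
      proof (intro exI[of _ e] conjI ballI impI xe(2))
        fix y assume y: "y \<in> mspace E" "mdist E x y < e"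
        show "\<bar>d x - d y\<bar> < e" using lip[OF xe(1) y(1)] lip[OF y(1) xe(1)] y(2) by (simp add: mdist_commute)
      qed
    qed
    from h[OF this] have [measurable]: "(\<lambda>\<omega>. d (Z \<omega>)) \<in> borel_measurable M" .
    have iff: "x \<in> T \<longleftrightarrow> 0 < d x" if x: "x \<in> mspace E" for x
    proof
      assume "x \<in> T"
      then obtain r where r: "r > 0" "\<And>y. y \<in> mspace E \<Longrightarrow> mdist E x y < r \<Longrightarrow> y \<in> T"
        using T(1) unfolding openin_mtopology_of_iff by meson
      then have "r \<le> mdist E x y" if "y \<in> mspace E - T" for y using that by (meson DiffD1 DiffD2 not_le)
      then have "r \<le> d x" unfolding d_def by (rule cINF_greatest[OF False])
      then show "0 < d x" using r(1) by simp
    next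
      assume "0 < d x"
      show "x \<in> T"
      proof (rule ccontr)
        assume "x \<notin> T"
        then have "d x \<le> mdist E x x" unfolding d_def using x by (intro cINF_lower[OF bdd]) auto
        then show False
          using \<open>0 < d x\<close> Metric_space.zero[OF Metric_space_mspace_mdist x x] by simp
      qed
    qed
    have "{\<omega>\<in>space M. Z \<omega> \<in> T} = {\<omega>\<in>space M. 0 < d (Z \<omega>)}" using iff Z by auto
    then show ?thesis unfolding eq by simp
  qed
qed

lemma linf_dist_le:
  assumes "0 \<le> c" "\<And>f. f \<in> F \<Longrightarrow> \<bar>\<mu> f - \<nu> f\<bar> \<le> c"
  shows "linf_dist F \<mu> \<nu> \<le> c"
  unfolding linf_dist_def using assms by (auto intro!: cSUP_least)

lemma linf_dist_ge:
  assumes "\<mu> \<in> linf_space F" "\<nu> \<in> linf_space F" "f \<in> F"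
  shows "\<bar>\<mu> f - \<nu> f\<bar> \<le> linf_dist F \<mu> \<nu>"
proof -
  have "bounded (\<mu> ` F)" "bounded (\<nu> ` F)" using assms by (simp_all add: linf_space_def)
  then obtain a b where ab: "\<forall>f\<in>F. \<bar>\<mu> f\<bar> \<le> a" "\<forall>f\<in>F. \<bar>\<nu> f\<bar> \<le> b"
    unfolding bounded_iff by (metis image_eqI real_norm_def)
  have "bdd_above ((\<lambda>f. \<bar>\<mu> f - \<nu> f\<bar>) ` F)"
  proof (rule bdd_aboveI2)
    fix f assume "f \<in> F"
    then have "\<bar>\<mu> f\<bar> \<le> a" "\<bar>\<nu> f\<bar> \<le> b" using ab by auto
    then show "\<bar>\<mu> f - \<nu> f\<bar> \<le> a + b" by linarith
  qed
  then have "\<bar>\<mu> f - \<nu> f\<bar> \<le> (SUP f\<in>F. \<bar>\<mu> f - \<nu> f\<bar>)" by (rule cSUP_upper[OF assms(3)])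
  then show ?thesis using assms by (auto simp: linf_dist_def)
qed

lemma linf_spaceI:
  assumes "\<And>f. f \<in> F \<Longrightarrow> \<bar>\<mu> f\<bar> \<le> c"
  shows "(\<lambda>f\<in>F. \<mu> f) \<in> linf_space F"
  using assms by (auto simp: linf_space_def bounded_iff intro!: exI[of _ c])

definition weighted_average :: "real \<Rightarrow> real \<Rightarrow> real \<Rightarrow> nat \<Rightarrow> (nat \<Rightarrow> real) \<Rightarrow> (real \<Rightarrow> real) \<Rightarrow> real" where
  "weighted_average q \<delta> c K y = (\<lambda>f\<in>regressors q \<delta>.
     c * (\<Sum>i<K. f (real (Suc i) / real K) * y i) / integral {0..1} (\<lambda>x. (f x)\<^sup>2))"

context
  fixes q \<delta> :: real
  assumes q: "1 \<le> q" and \<delta>: "0 < \<delta>"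
begin

lemma divide_integral_le:
  assumes f: "f \<in> regressors q \<delta>" and u: "\<bar>u\<bar> \<le> c"
  shows "\<bar>u / integral {0..1} (\<lambda>x. (f x)\<^sup>2)\<bar> \<le> c / \<delta>"
proof -
  have "\<bar>u / integral {0..1} (\<lambda>x. (f x)\<^sup>2)\<bar> = \<bar>u\<bar> / integral {0..1} (\<lambda>x. (f x)\<^sup>2)"
    using regressors_integral[OF f] \<delta> by simp
  also have "\<dots> \<le> c / \<delta>"
    using regressors_integral[OF f] \<delta> u by (intro frac_le) auto
  finally show ?thesis .
qed

lemma weighted_sum_le:
  assumes f: "f \<in> regressors q \<delta>"
  shows "\<bar>\<Sum>i<K. f (real (Suc i) / real K) * y i\<bar> \<le> (\<Sum>i<K. \<bar>y i\<bar>)"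
proof (rule order_trans[OF sum_abs sum_mono])
  fix i assume "i \<in> {..<K}"
  then have "\<bar>f (real (Suc i) / real K)\<bar> \<le> 1" by (intro regressors_le_1_variation_le_1(1)[OF f q]) auto
  then show "\<bar>f (real (Suc i) / real K) * y i\<bar> \<le> \<bar>y i\<bar>"
    unfolding abs_mult by (intro mult_left_le_one_le) auto
qed

lemma weighted_average_in_linf: "weighted_average q \<delta> c K y \<in> linf_space (regressors q \<delta>)"
  unfolding weighted_average_def
proof (rule linf_spaceI)
  fix f assume f: "f \<in> regressors q \<delta>"
  have "\<bar>c * (\<Sum>i<K. f (real (Suc i) / real K) * y i)\<bar> \<le> \<bar>c\<bar> * (\<Sum>i<K. \<bar>y i\<bar>)"
    unfolding abs_mult by (intro mult_left_mono weighted_sum_le f) simp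
  from divide_integral_le[OF f this]
  show "\<bar>c * (\<Sum>i<K. f (real (Suc i) / real K) * y i) / integral {0..1} (\<lambda>x. (f x)\<^sup>2)\<bar> \<le> \<bar>c\<bar> * (\<Sum>i<K. \<bar>y i\<bar>) / \<delta>" .
qed

lemma weighted_average_dist:
  "linf_dist (regressors q \<delta>) (weighted_average q \<delta> c K y) (weighted_average q \<delta> c K y') \<le> \<bar>c\<bar> * (\<Sum>i<K. \<bar>y i - y' i\<bar>) / \<delta>"
proof (rule linf_dist_le)
  show "0 \<le> \<bar>c\<bar> * (\<Sum>i<K. \<bar>y i - y' i\<bar>) / \<delta>" using \<delta> by (simp add: sum_nonneg)
  fix f assume f: "f \<in> regressors q \<delta>"
  have eq: "weighted_average q \<delta> c K y f - weighted_average q \<delta> c K y' f =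
    c * (\<Sum>i<K. f (real (Suc i) / real K) * (y i - y' i)) / integral {0..1} (\<lambda>x. (f x)\<^sup>2)"
    using f by (simp add: weighted_average_def right_diff_distrib sum_subtractf diff_divide_distrib)
  have "\<bar>c * (\<Sum>i<K. f (real (Suc i) / real K) * (y i - y' i))\<bar> \<le> \<bar>c\<bar> * (\<Sum>i<K. \<bar>y i - y' i\<bar>)"
    unfolding abs_mult by (intro mult_left_mono weighted_sum_le f) simp
  from divide_integral_le[OF f this]
  show "\<bar>weighted_average q \<delta> c K y f - weighted_average q \<delta> c K y' f\<bar> \<le> \<bar>c\<bar> * (\<Sum>i<K. \<bar>y i - y' i\<bar>) / \<delta>"
    unfolding eq .
qed

lemma continuous_weighted_average:
  assumes h: "continuous_map (mtopology_of (linf (regressors q \<delta>))) euclideanreal h"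
  shows "continuous_on UNIV (\<lambda>y. h (weighted_average q \<delta> c K y))"
  unfolding continuous_on_sequentially
proof (intro allI impI ballI)
  fix Y :: "nat \<Rightarrow> nat \<Rightarrow> real" and y
  assume "(\<forall>n. Y n \<in> UNIV) \<and> Y \<longlonglongrightarrow> y"
  then have lim: "Y \<longlonglongrightarrow> y" by simp
  have coord: "(\<lambda>n. Y n i) \<longlonglongrightarrow> y i" for i
    using continuous_on_tendsto_compose[OF continuous_on_product_coordinates[of i] lim] by simp
  have "(\<lambda>n. \<bar>c\<bar> * (\<Sum>i<K. \<bar>Y n i - y i\<bar>) / \<delta>) \<longlonglongrightarrow> \<bar>c\<bar> * (\<Sum>i<K. \<bar>y i - y i\<bar>) / \<delta>"
    by (intro tendsto_intros coord) (use \<delta> in auto)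
  then have lim0: "(\<lambda>n. \<bar>c\<bar> * (\<Sum>i<K. \<bar>Y n i - y i\<bar>) / \<delta>) \<longlonglongrightarrow> 0" by simp
  have "(\<lambda>n. linf_dist (regressors q \<delta>) (weighted_average q \<delta> c K (Y n)) (weighted_average q \<delta> c K y)) \<longlonglongrightarrow> 0"
    by (rule tendsto_sandwich[OF _ _ tendsto_const lim0])
      (auto intro!: always_eventually weighted_average_dist Metric_space.nonneg[OF Metric_space_linf])
  then show "((\<lambda>y. h (weighted_average q \<delta> c K y)) \<circ> Y) \<longlonglongrightarrow> h (weighted_average q \<delta> c K y)"
    unfolding comp_def by (intro continuous_map_tendsto[OF h]) (simp_all add: weighted_average_in_linf)
qed

lemma measurable_weighted_average:
  assumes "continuous_map (mtopology_of (linf (regressors q \<delta>))) euclideanreal h"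
  shows "(\<lambda>y. h (weighted_average q \<delta> c K y)) \<in> borel_measurable (PiM UNIV (\<lambda>_. borel))"
  using borel_measurable_continuous_onI[OF continuous_weighted_average[OF assms]]
  by (simp add: measurable_cong_sets[OF sets_PiM_equal_borel refl])

end

definition haar_converging :: "real \<Rightarrow> real \<Rightarrow> nat \<Rightarrow> (nat \<Rightarrow> real) set" where
  "haar_converging q s r = {x. (\<Sum>k. ennreal (haar_bound q s r k x)) \<noteq> \<infinity>}"

definition wiener_integral :: "(nat \<Rightarrow> real) \<Rightarrow> (real \<Rightarrow> real) \<Rightarrow> real" where
  "wiener_integral x f = lim (\<lambda>k. wiener_sum k x f)"

definition limit_process :: "real \<Rightarrow> real \<Rightarrow> real \<Rightarrow> nat \<Rightarrow> real \<Rightarrow> (nat \<Rightarrow> real) \<Rightarrow> (real \<Rightarrow> real) \<Rightarrow> real" where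
  "limit_process q \<delta> s r c x = (\<lambda>f\<in>regressors q \<delta>.
     if x \<in> haar_converging q s r then c * wiener_integral x f / integral {0..1} (\<lambda>x. (f x)\<^sup>2) else 0)"

lemma haar_bound_measurable [measurable]: "haar_bound q s r k \<in> borel_measurable white_noise"
  unfolding haar_bound_def[abs_def] Let_def by measurable

lemma haar_converging_measurable [measurable]: "Measurable.pred white_noise (\<lambda>x. x \<in> haar_converging q s r)"
  unfolding haar_converging_def mem_Collect_eq by measurable

lemma haar_converging_summable: "x \<in> haar_converging q s r \<Longrightarrow> summable (\<lambda>k. haar_bound q s r k x)"
  unfolding haar_converging_def by (auto intro!: summable_suminf_not_top haar_bound_nonneg)

lemma AE_haar_converging:
  assumes "1 \<le> q" "q < 2"
  shows "\<exists>s r. AE x in white_noise. x \<in> haar_converging q s r"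
proof -
  obtain s r where "AE x in white_noise. summable (\<lambda>k. haar_bound q s r k x)"
    using AE_summable_haar_bound[OF assms] by blast
  then have "AE x in white_noise. x \<in> haar_converging q s r"
    by (rule AE_mp) (auto intro!: AE_I2 simp: haar_converging_def suminf_ennreal2 haar_bound_nonneg)
  then show ?thesis by blast
qed

lemma tendsto_of_summable_increments:
  fixes w b :: "nat \<Rightarrow> real"
  assumes le: "\<And>k. \<bar>w (Suc k) - w k\<bar> \<le> b k" and b: "summable b"
  shows "convergent w" and "\<bar>w k - lim w\<bar> \<le> (\<Sum>j. b (j + k))"
proof -
  have b0: "0 \<le> b k" for k using le[of k] by linarith
  have "summable (\<lambda>k. w (Suc k) - w k)" by (rule summable_comparison_test'[OF b, of 0]) (use le in simp)
  then have "convergent (\<lambda>n. \<Sum>k<n. w (Suc k) - w k)" by (simp add: summable_iff_convergent)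
  then have "convergent (\<lambda>n. w n - w 0)" by (simp add: sum_lessThan_telescope)
  then obtain L where "(\<lambda>n. w n - w 0) \<longlonglongrightarrow> L" by (auto simp: convergent_def)
  from tendsto_add[OF this tendsto_const[of "w 0"]] have "w \<longlonglongrightarrow> L + w 0" by simp
  then show conv: "convergent w" by (auto simp: convergent_def)
  have bk: "summable (\<lambda>j. b (j + k))" by (rule summable_ignore_initial_segment[OF b])
  have "\<bar>w k - w (n + k)\<bar> \<le> (\<Sum>j. b (j + k))" for n
  proof -
    have "\<bar>w k - w (n + k)\<bar> \<le> (\<Sum>j<n. b (j + k))"
    proof (induction n)
      case (Suc n)
      then show ?case using le[of "n + k"] by simp
    qed simp
    also have "\<dots> \<le> (\<Sum>j. b (j + k))" by (rule sum_le_suminf[OF bk]) (simp_all add: b0)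
    finally show ?thesis .
  qed
  moreover have "(\<lambda>n. \<bar>w k - w (n + k)\<bar>) \<longlonglongrightarrow> \<bar>w k - lim w\<bar>"
    by (intro tendsto_intros LIMSEQ_ignore_initial_segment) (use conv in \<open>simp add: convergent_LIMSEQ_iff\<close>)
  ultimately show "\<bar>w k - lim w\<bar> \<le> (\<Sum>j. b (j + k))" by (intro LIMSEQ_le_const2) auto
qed

context
  fixes q \<delta> :: real
  assumes q: "1 \<le> q" and \<delta>: "0 < \<delta>"
begin

lemma weighted_average_haar:
  assumes "f \<in> regressors q \<delta>"
  shows "weighted_average q \<delta> c (2^k) (\<lambda>i. haar k i x / sqrt (2^k)) f = c * wiener_sum k x f / integral {0..1} (\<lambda>x. (f x)\<^sup>2)"
  using assms by (simp add: weighted_average_def wiener_sum_def)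

lemma wiener_integral_approx:
  assumes f: "f \<in> regressors q \<delta>" and x: "x \<in> haar_converging q s r"
  shows "(\<lambda>k. wiener_sum k x f) \<longlonglongrightarrow> wiener_integral x f"
    and "\<bar>wiener_sum k x f - wiener_integral x f\<bar> \<le> (\<Sum>j. haar_bound q s r (j + k) x)"
  unfolding wiener_integral_def
  using tendsto_of_summable_increments[OF wiener_sum_increment_le[OF f q] haar_converging_summable[OF x]]
  by (simp_all add: convergent_LIMSEQ_iff)

lemma limit_process_approx:
  assumes x: "x \<in> haar_converging q s r"
  shows "linf_dist (regressors q \<delta>) (weighted_average q \<delta> c (2^k) (\<lambda>i. haar k i x / sqrt (2^k))) (limit_process q \<delta> s r c x)
    \<le> \<bar>c\<bar> * (\<Sum>j. haar_bound q s r (j + k) x) / \<delta>"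
proof (rule linf_dist_le)
  have "summable (\<lambda>j. haar_bound q s r (j + k) x)"
    by (rule summable_ignore_initial_segment[OF haar_converging_summable[OF x]])
  then have "0 \<le> (\<Sum>j. haar_bound q s r (j + k) x)" by (rule suminf_nonneg) (rule haar_bound_nonneg)
  then show "0 \<le> \<bar>c\<bar> * (\<Sum>j. haar_bound q s r (j + k) x) / \<delta>" using \<delta> by simp
  fix f assume f: "f \<in> regressors q \<delta>"
  have "\<bar>c * (wiener_sum k x f - wiener_integral x f)\<bar> \<le> \<bar>c\<bar> * (\<Sum>j. haar_bound q s r (j + k) x)"
    unfolding abs_mult by (intro mult_left_mono wiener_integral_approx(2)[OF f x]) simp
  from divide_integral_le[OF q \<delta> f this]
  show "\<bar>weighted_average q \<delta> c (2^k) (\<lambda>i. haar k i x / sqrt (2^k)) f - limit_process q \<delta> s r c x f\<bar>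
    \<le> \<bar>c\<bar> * (\<Sum>j. haar_bound q s r (j + k) x) / \<delta>"
    unfolding weighted_average_haar[OF f] using f x
    by (simp add: limit_process_def diff_divide_distrib right_diff_distrib)
qed

lemma limit_process_in_linf: "limit_process q \<delta> s r c x \<in> linf_space (regressors q \<delta>)"
proof (cases "x \<in> haar_converging q s r")
  case True
  let ?B = "\<Sum>j. haar_bound q s r (j + 0) x"
  have "\<bar>c * wiener_integral x f / integral {0..1} (\<lambda>x. (f x)\<^sup>2)\<bar> \<le> \<bar>c\<bar> * (?B + \<bar>haar 0 0 x\<bar>) / \<delta>" if f: "f \<in> regressors q \<delta>" for f
  proof (rule divide_integral_le[OF q \<delta> f])
    have "\<bar>wiener_sum 0 x f\<bar> \<le> \<bar>haar 0 0 x\<bar>"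
      using regressors_le_1_variation_le_1(1)[OF f q, of 1] by (simp add: wiener_sum_def abs_mult mult_left_le_one_le)
    then have "\<bar>wiener_integral x f\<bar> \<le> ?B + \<bar>haar 0 0 x\<bar>"
      using wiener_integral_approx(2)[OF f True, of 0] by linarith
    then show "\<bar>c * wiener_integral x f\<bar> \<le> \<bar>c\<bar> * (?B + \<bar>haar 0 0 x\<bar>)"
      unfolding abs_mult by (intro mult_left_mono) auto
  qed
  then show ?thesis unfolding limit_process_def using True by (simp only: if_True) (rule linf_spaceI)
next
  case False
  then show ?thesis unfolding limit_process_def by (intro linf_spaceI[of _ _ 0]) auto
qed

lemma limit_process_tendsto:
  assumes x: "x \<in> haar_converging q s r"
  shows "(\<lambda>k. linf_dist (regressors q \<delta>) (weighted_average q \<delta> c (2^k) (\<lambda>i. haar k i x / sqrt (2^k))) (limit_process q \<delta> s r c x)) \<longlonglongrightarrow> 0"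
proof (rule tendsto_sandwich[OF _ _ tendsto_const])
  have "(\<lambda>k. \<Sum>j. haar_bound q s r (j + k) x) \<longlonglongrightarrow> 0"
    by (rule suminf_exist_split2[OF haar_converging_summable[OF x]])
  then have "(\<lambda>k. \<bar>c\<bar> * (\<Sum>j. haar_bound q s r (j + k) x) / \<delta>) \<longlonglongrightarrow> \<bar>c\<bar> * 0 / \<delta>"
    by (intro tendsto_intros) (use \<delta> in auto)
  then show "(\<lambda>k. \<bar>c\<bar> * (\<Sum>j. haar_bound q s r (j + k) x) / \<delta>) \<longlonglongrightarrow> 0" by simp
qed (auto intro!: always_eventually limit_process_approx x Metric_space.nonneg[OF Metric_space_linf])

lemma measurable_haar_average:
  assumes h: "continuous_map (mtopology_of (linf (regressors q \<delta>))) euclideanreal h"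
  shows "(\<lambda>x. h (weighted_average q \<delta> c (2^k) (\<lambda>i. haar k i x / sqrt (2^k)))) \<in> borel_measurable white_noise"
proof -
  have "(\<lambda>x i. haar k i x / sqrt (2^k)) \<in> white_noise \<rightarrow>\<^sub>M PiM UNIV (\<lambda>_. borel)"
    by (rule measurable_PiM_single') (auto simp: space_PiM)
  from measurable_compose[OF this measurable_weighted_average[OF q \<delta> h]] show ?thesis by simp
qed

lemma measurable_limit_process:
  assumes h: "continuous_map (mtopology_of (linf (regressors q \<delta>))) euclideanreal h"
  shows "(\<lambda>x. h (limit_process q \<delta> s r c x)) \<in> borel_measurable white_noise"
proof -
  define H where "H k x = (if x \<in> haar_converging q s r then h (weighted_average q \<delta> c (2^k) (\<lambda>i. haar k i x / sqrt (2^k)))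
    else h (\<lambda>f\<in>regressors q \<delta>. 0))" for k x
  show ?thesis
  proof (rule borel_measurable_LIMSEQ_real)
    show "H k \<in> borel_measurable white_noise" for k
      unfolding H_def[abs_def] using measurable_haar_average[OF h] by measurable
    fix x
    show "(\<lambda>k. H k x) \<longlonglongrightarrow> h (limit_process q \<delta> s r c x)"
    proof (cases "x \<in> haar_converging q s r")
      case True
      have "(\<lambda>k. h (weighted_average q \<delta> c (2^k) (\<lambda>i. haar k i x / sqrt (2^k)))) \<longlonglongrightarrow> h (limit_process q \<delta> s r c x)"
        by (rule continuous_map_tendsto[OF h])
          (simp_all add: weighted_average_in_linf[OF q \<delta>] limit_process_in_linf limit_process_tendsto[OF True])
      then show ?thesis using True by (simp add: H_def)
    next
      case False
      then show ?thesis by (simp add: H_def limit_process_def)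
    qed
  qed
qed

lemma separably_valued_limit_process:
  "separably_valued (linf (regressors q \<delta>)) white_noise (limit_process q \<delta> s r c)"
proof -
  let ?F = "regressors q \<delta>"
  let ?E = "linf ?F"
  interpret L: Metric_space "linf_space ?F" "linf_dist ?F" by (rule Metric_space_linf)
  define z where "z ys i = (if i < length ys then of_rat (ys ! i) else 0 :: real)" for ys :: "rat list" and i
  define C where "C = (\<lambda>(K, ys). weighted_average q \<delta> c K (z ys)) ` (UNIV :: (nat \<times> rat list) set)"
  define S where "S = {\<mu> \<in> linf_space ?F. \<forall>e>0. \<exists>\<nu>\<in>C. linf_dist ?F \<mu> \<nu> < e}"
  have CS: "C \<subseteq> S"
  proof
    fix \<mu> assume "\<mu> \<in> C"
    moreover from this have "\<mu> \<in> linf_space ?F" by (auto simp: C_def weighted_average_in_linf[OF q \<delta>])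
    ultimately show "\<mu> \<in> S" by (auto simp: S_def intro!: bexI[of _ \<mu>])
  qed
  have cl: "S \<subseteq> mtopology_of ?E closure_of C"
  proof
    fix \<mu> assume \<mu>: "\<mu> \<in> S"
    show "\<mu> \<in> mtopology_of ?E closure_of C"
      unfolding in_closure_of
    proof (intro conjI allI impI)
      show "\<mu> \<in> topspace (mtopology_of ?E)" using \<mu> by (simp add: S_def)
      fix T assume T: "\<mu> \<in> T \<and> openin (mtopology_of ?E) T"
      then obtain e where e: "e > 0" "\<And>y. y \<in> linf_space ?F \<Longrightarrow> linf_dist ?F \<mu> y < e \<Longrightarrow> y \<in> T"
        unfolding openin_mtopology_of_iff by auto
      obtain \<nu> where "\<nu> \<in> C" "linf_dist ?F \<mu> \<nu> < e" using \<mu> e(1) by (auto simp: S_def)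
      moreover have "\<nu> \<in> linf_space ?F" using CS \<open>\<nu> \<in> C\<close> by (auto simp: S_def)
      ultimately show "\<exists>y. y \<in> C \<and> y \<in> T" using e(2) by blast
    qed
  qed
  have "separable_space (subtopology (mtopology_of ?E) S)"
    unfolding separable_space_def
  proof (intro exI[of _ C] conjI)
    show "countable C" unfolding C_def by (rule countable_image) simp
    show "C \<subseteq> topspace (subtopology (mtopology_of ?E) S)" using CS by (auto simp: S_def)
    show "subtopology (mtopology_of ?E) S closure_of C = topspace (subtopology (mtopology_of ?E) S)"
      using CS cl by (auto simp: closure_of_subtopology Int_absorb1 S_def)
  qed
  moreover have "limit_process q \<delta> s r c x \<in> S" for x
    unfolding S_def
  proof (intro CollectI conjI allI impI limit_process_in_linf)
    fix e :: real assume e: "e > 0"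
    show "\<exists>\<nu>\<in>C. linf_dist ?F (limit_process q \<delta> s r c x) \<nu> < e"
    proof (cases "x \<in> haar_converging q s r")
      case True
      let ?w = "\<lambda>k. weighted_average q \<delta> c (2^k) (\<lambda>i. haar k i x / sqrt (2^k))"
      have "\<forall>\<^sub>F k in sequentially. linf_dist ?F (?w k) (limit_process q \<delta> s r c x) < e/2"
        by (rule order_tendstoD(2)[OF limit_process_tendsto[OF True]]) (use e in simp)
      then obtain k where k: "linf_dist ?F (?w k) (limit_process q \<delta> s r c x) < e/2"
        by (auto simp: eventually_sequentially)
      define \<eta> where "\<eta> = e / 2 * \<delta> / ((\<bar>c\<bar> + 1) * 2^k)"
      have \<eta>: "\<eta> > 0" using e \<delta> by (simp add: \<eta>_def)
      have "\<exists>\<rho>::rat. \<bar>a - of_rat \<rho>\<bar> < \<eta>" for a :: real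
      proof -
        obtain \<rho> :: rat where "a - \<eta> < of_rat \<rho>" "of_rat \<rho> < a + \<eta>"
          using of_rat_dense[of "a - \<eta>" "a + \<eta>"] \<eta> by auto
        then have "\<bar>a - of_rat \<rho>\<bar> < \<eta>" by linarith
        then show ?thesis ..
      qed
      then have "\<forall>i. \<exists>\<rho>::rat. \<bar>haar k i x / sqrt (2^k) - of_rat \<rho>\<bar> < \<eta>" by blast
      then obtain \<rho> :: "nat \<Rightarrow> rat" where \<rho>: "\<And>i. \<bar>haar k i x / sqrt (2^k) - of_rat (\<rho> i)\<bar> < \<eta>" by metis
      let ?\<nu> = "weighted_average q \<delta> c (2^k) (z (map \<rho> [0..<2^k]))"
      have "?\<nu> \<in> C" unfolding C_def by (rule image_eqI[of _ _ "(2^k, map \<rho> [0..<2^k])"]) auto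
      moreover have "linf_dist ?F (?w k) ?\<nu> < e/2"
      proof -
        have "linf_dist ?F (?w k) ?\<nu> \<le> \<bar>c\<bar> * (\<Sum>i<2^k. \<bar>haar k i x / sqrt (2^k) - z (map \<rho> [0..<2^k]) i\<bar>) / \<delta>"
          by (rule weighted_average_dist[OF q \<delta>])
        also have "\<dots> \<le> \<bar>c\<bar> * (\<Sum>i<(2::nat)^k. \<eta>) / \<delta>"
          using \<rho> \<delta> by (intro divide_right_mono mult_left_mono sum_mono) (auto simp: z_def less_imp_le)
        also have "\<dots> = \<bar>c\<bar> / (\<bar>c\<bar> + 1) * (e/2)" using \<delta> by (simp add: \<eta>_def)
        also have "\<dots> < 1 * (e/2)" using e by (intro mult_strict_right_mono) (auto simp: divide_less_eq)
        finally show ?thesis by simp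
      qed
      moreover have "?\<nu> \<in> linf_space ?F" "?w k \<in> linf_space ?F"
        by (rule weighted_average_in_linf[OF q \<delta>])+
      ultimately show ?thesis
        using L.triangle[OF limit_process_in_linf[of s r c x] \<open>?w k \<in> _\<close> \<open>?\<nu> \<in> linf_space ?F\<close>] k
        by (intro bexI[of _ ?\<nu>]) (auto simp: L.commute)
    next
      case False
      have eq: "limit_process q \<delta> s r c x = weighted_average q \<delta> c 0 (z [])"
        using False by (simp add: limit_process_def weighted_average_def)
      have "weighted_average q \<delta> c 0 (z []) \<in> C" unfolding C_def by (rule image_eqI[of _ _ "(0, [])"]) auto
      then show ?thesis unfolding eq using e weighted_average_in_linf[OF q \<delta>]
        by (intro bexI[of _ "weighted_average q \<delta> c 0 (z [])"]) simp_all
    qed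
  qed
  ultimately show ?thesis unfolding separably_valued_def
    by (intro exI[of _ S]) (auto simp: S_def)
qed

end

section \<open>Gaussian marginals\<close>

lemma char_normal_law:
  assumes "s \<ge> 0"
  shows "char (normal_law 0 s) t = complex_of_real (exp (- (s * t)\<^sup>2 / 2))"
proof (cases "s = 0")
  case True
  then show ?thesis by (simp add: normal_law_def char_def integral_return)
next
  case False
  then have s: "s > 0" using assms by simp
  interpret prob_space std_normal by (rule prob_space_std_normal)
  have id: "distributed std_normal lborel (\<lambda>x. x) std_normal_density"
    unfolding distributed_def by (auto intro!: distr_id2)
  from normal_density_affine[OF id _ less_imp_neq[OF s, symmetric], of 0]
  have "distributed std_normal lborel (\<lambda>x. s * x) (normal_density 0 s)" using s by simp
  then have "distr std_normal lborel (\<lambda>x. s * x) = density lborel (normal_density 0 s)"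
    by (rule distributed_distr_eq_density)
  moreover have "distr std_normal lborel (\<lambda>x. s * x) = distr std_normal borel (\<lambda>x. s * x)"
    by (rule distr_cong) auto
  ultimately have law: "normal_law 0 s = distr std_normal borel (\<lambda>x. s * x)"
    using False by (simp add: normal_law_def)
  have "char (normal_law 0 s) t = char std_normal (s * t)"
    unfolding law by (simp add: char_def integral_distr mult_ac)
  then show ?thesis by (simp add: char_std_normal_distribution)
qed

lemma real_distribution_normal_law: "s \<ge> 0 \<Longrightarrow> real_distribution (normal_law 0 s)"
  unfolding normal_law_def real_distribution_def real_distribution_axioms_def
  by (auto intro: prob_space_return prob_space_normal_density)

lemma (in prob_space) char_iid_std_normal_combination:
  assumes W: "iid_std_normal M W n"
  shows "char (distr M borel (\<lambda>\<omega>. \<Sum>i<n. a i * W i \<omega>)) t = complex_of_real (exp (- (\<Sum>i<n. (a i)\<^sup>2) * t\<^sup>2 / 2))"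
proof -
  have ind: "indep_vars (\<lambda>_. borel) W {..<n}" and law: "\<And>i. i < n \<Longrightarrow> distr M borel (W i) = std_normal"
    using W by (auto simp: iid_std_normal_def)
  have rv: "W i \<in> borel_measurable M" if "i < n" for i using ind that by (auto simp: indep_vars_def)
  have ind': "indep_vars (\<lambda>_. borel) (\<lambda>i \<omega>. a i * W i \<omega>) {..<n}"
    by (rule indep_vars_compose2[OF ind, where Y = "\<lambda>i x. a i * x"]) measurable
  have one: "char (distr M borel (\<lambda>\<omega>. a i * W i \<omega>)) t = complex_of_real (exp (- (a i)\<^sup>2 * t\<^sup>2 / 2))" if "i < n" for i
  proof -
    have "char (distr M borel (\<lambda>\<omega>. a i * W i \<omega>)) t = char (distr M borel (W i)) (a i * t)"
      using rv[OF that] by (simp add: char_def integral_distr mult_ac)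
    then show ?thesis unfolding law[OF that] by (simp add: char_std_normal_distribution power_mult_distrib)
  qed
  have "char (distr M borel (\<lambda>\<omega>. \<Sum>i<n. a i * W i \<omega>)) t = (\<Prod>i<n. char (distr M borel (\<lambda>\<omega>. a i * W i \<omega>)) t)"
    by (rule char_distr_sum[OF ind'])
  also have "\<dots> = (\<Prod>i<n. complex_of_real (exp (- (a i)\<^sup>2 * t\<^sup>2 / 2)))"
    by (intro prod.cong refl one) simp
  also have "\<dots> = complex_of_real (exp (\<Sum>i<n. - (a i)\<^sup>2 * t\<^sup>2 / 2))"
    by (simp add: exp_sum)
  also have "(\<Sum>i<n. - (a i)\<^sup>2 * t\<^sup>2 / 2) = - (\<Sum>i<n. (a i)\<^sup>2) * t\<^sup>2 / 2"
    by (simp add: sum_distrib_right sum_divide_distrib sum_negf)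
  finally show ?thesis .
qed

text \<open>The variances of the approximating normal laws converge because the limiting characteristic
  function is nonzero near the origin.\<close>

lemma (in prob_space) normal_law_of_AE_limit:
  assumes W: "\<And>k. iid_std_normal M (W k) (n k)"
    and Y [measurable]: "Y \<in> borel_measurable M"
    and lim: "AE \<omega> in M. (\<lambda>k. \<Sum>i<n k. a k i * W k i \<omega>) \<longlonglongrightarrow> Y \<omega>"
  shows "\<exists>s\<ge>0. distr M borel Y = normal_law 0 s"
proof -
  define v where "v k = (\<Sum>i<n k. (a k i)\<^sup>2)" for k
  define Yk where "Yk k \<omega> = (\<Sum>i<n k. a k i * W k i \<omega>)" for k \<omega>
  have rv: "W k i \<in> borel_measurable M" if "i < n k" for k i
    using W[of k] that by (auto simp: iid_std_normal_def indep_vars_def)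
  have [measurable]: "Yk k \<in> borel_measurable M" for k
    unfolding Yk_def[abs_def] using rv by (intro borel_measurable_sum borel_measurable_times) auto
  interpret Y: real_distribution "distr M borel Y" by (rule real_distribution_distr) measurable
  have conv: "(\<lambda>k. complex_of_real (exp (- v k * t\<^sup>2 / 2))) \<longlonglongrightarrow> char (distr M borel Y) t" for t
  proof -
    have "(\<lambda>k. CLINT \<omega>|M. iexp (t * Yk k \<omega>)) \<longlonglongrightarrow> (CLINT \<omega>|M. iexp (t * Y \<omega>))"
    proof (rule integral_dominated_convergence[where w = "\<lambda>_. 1"])
      show "AE \<omega> in M. (\<lambda>k. iexp (t * Yk k \<omega>)) \<longlonglongrightarrow> iexp (t * Y \<omega>)"
        using lim
      proof eventually_elim
        case (elim \<omega>)
        then have "(\<lambda>k. Yk k \<omega>) \<longlonglongrightarrow> Y \<omega>" by (simp add: Yk_def)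
        then show ?case by (intro tendsto_intros)
      qed
    qed auto
    moreover have "(CLINT \<omega>|M. iexp (t * Yk k \<omega>)) = complex_of_real (exp (- v k * t\<^sup>2 / 2))" for k
      using char_iid_std_normal_combination[OF W[of k], of "a k" t]
      by (simp add: char_def integral_distr Yk_def[symmetric] v_def)
    moreover have "(CLINT \<omega>|M. iexp (t * Y \<omega>)) = char (distr M borel Y) t"
      by (simp add: char_def integral_distr)
    ultimately show ?thesis by simp
  qed
  have "(char (distr M borel Y) \<longlongrightarrow> 1) (at 0)"
    using Y.isCont_char[of 0] by (simp add: isCont_def Y.char_zero)
  then have "\<forall>\<^sub>F t in at 0. dist (char (distr M borel Y) t) 1 < 1" by (rule tendstoD) simp
  then obtain d where d: "d > 0" "\<And>t. t \<noteq> 0 \<Longrightarrow> dist t 0 < d \<Longrightarrow> dist (char (distr M borel Y) t) 1 < 1"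
    unfolding eventually_at by auto
  define t0 where "t0 = d / 2"
  have t0: "t0 > 0" using d by (simp add: t0_def)
  have "cmod (char (distr M borel Y) t0 - 1) < 1" using d(2)[of t0] d(1) by (simp add: t0_def dist_norm)
  then have p: "Re (char (distr M borel Y) t0) > 0"
    using abs_Re_le_cmod[of "char (distr M borel Y) t0 - 1"] by simp
  have "(\<lambda>k. exp (- v k * t0\<^sup>2 / 2)) \<longlonglongrightarrow> Re (char (distr M borel Y) t0)"
    using tendsto_Re[OF conv[of t0]] by simp
  then have "(\<lambda>k. ln (exp (- v k * t0\<^sup>2 / 2))) \<longlonglongrightarrow> ln (Re (char (distr M borel Y) t0))"
    using p by (intro tendsto_ln) auto
  then have "(\<lambda>k. (- 2 / t0\<^sup>2) * (- v k * t0\<^sup>2 / 2)) \<longlonglongrightarrow> (- 2 / t0\<^sup>2) * ln (Re (char (distr M borel Y) t0))"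
    by (intro tendsto_mult tendsto_const) simp
  then obtain V where V: "v \<longlonglongrightarrow> V" using t0 by simp
  have "0 \<le> V" by (rule LIMSEQ_le_const[OF V]) (auto simp: v_def sum_nonneg)
  have "char (distr M borel Y) t = char (normal_law 0 (sqrt V)) t" for t
  proof -
    have "(\<lambda>k. complex_of_real (exp (- v k * t\<^sup>2 / 2))) \<longlonglongrightarrow> complex_of_real (exp (- V * t\<^sup>2 / 2))"
      by (intro tendsto_intros V) auto
    from LIMSEQ_unique[OF conv this] show ?thesis
      using \<open>0 \<le> V\<close> by (simp add: char_normal_law power_mult_distrib)
  qed
  then have "char (distr M borel Y) = char (normal_law 0 (sqrt V))" by auto
  then have "distr M borel Y = normal_law 0 (sqrt V)"
    using \<open>0 \<le> V\<close> by (intro Levy_uniqueness real_distribution_normal_law Y.real_distribution_axioms) auto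
  then show ?thesis using \<open>0 \<le> V\<close> by (intro exI[of _ "sqrt V"]) simp
qed

lemma gaussian_process_limit_process:
  assumes q: "1 \<le> q" and \<delta>: "0 < \<delta>" and AE: "AE x in white_noise. x \<in> haar_converging q s r"
  shows "gaussian_process white_noise (regressors q \<delta>) (limit_process q \<delta> s r c)"
  unfolding gaussian_process_def
proof (intro conjI ballI allI impI prob_space_white_noise)
  interpret prob_space white_noise by (rule prob_space_white_noise)
  let ?I = "\<lambda>f. integral {0..1} (\<lambda>x. (f x)\<^sup>2)"
  have rv: "(\<lambda>x. limit_process q \<delta> s r c x f) \<in> borel_measurable white_noise" if f: "f \<in> regressors q \<delta>" for f
  proof (rule measurable_limit_process[OF q \<delta>, where h = "\<lambda>\<mu>. \<mu> f"])
    show "continuous_map (mtopology_of (linf (regressors q \<delta>))) euclideanreal (\<lambda>\<mu>. \<mu> f)"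
      unfolding continuous_map_mtopology_of_real_iff
    proof (intro ballI allI impI)
      fix x and e :: real assume "x \<in> mspace (linf (regressors q \<delta>))" "e > 0"
      then show "\<exists>r>0. \<forall>y\<in>mspace (linf (regressors q \<delta>)). mdist (linf (regressors q \<delta>)) x y < r \<longrightarrow> \<bar>x f - y f\<bar> < e"
        using linf_dist_ge[OF _ _ f] by (intro exI[of _ e]) (auto intro: le_less_trans)
    qed
  qed
  then show "(\<lambda>x. limit_process q \<delta> s r c x f) \<in> borel_measurable white_noise" if "f \<in> regressors q \<delta>" for f
    using that .
  fix S and b :: "(real \<Rightarrow> real) \<Rightarrow> real" assume S: "finite S \<and> S \<subseteq> regressors q \<delta>"
  let ?a = "\<lambda>k i. \<Sum>f\<in>S. b f * c * f (real (Suc i) / 2^k) / sqrt (2^k) / ?I f"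
  have "\<exists>s'\<ge>0. distr white_noise borel (\<lambda>x. \<Sum>f\<in>S. b f * limit_process q \<delta> s r c x f) = normal_law 0 s'"
  proof (rule normal_law_of_AE_limit)
    show "iid_std_normal white_noise (haar k) (2^k)" for k by (rule iid_haar) simp
    show "(\<lambda>x. \<Sum>f\<in>S. b f * limit_process q \<delta> s r c x f) \<in> borel_measurable white_noise"
      using rv S by (intro borel_measurable_sum borel_measurable_times) auto
    show "AE x in white_noise. (\<lambda>k. \<Sum>i<2^k. ?a k i * haar k i x) \<longlonglongrightarrow> (\<Sum>f\<in>S. b f * limit_process q \<delta> s r c x f)"
      using AE
    proof eventually_elim
      case (elim x)
      have "(\<Sum>i<2^k. ?a k i * haar k i x) = (\<Sum>f\<in>S. b f * (c * wiener_sum k x f / ?I f))" for k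
        unfolding wiener_sum_def sum_distrib_right sum_distrib_left sum_divide_distrib
        by (subst sum.swap) (simp add: mult_ac)
      moreover have "(\<lambda>k. \<Sum>f\<in>S. b f * (c * wiener_sum k x f / ?I f)) \<longlonglongrightarrow> (\<Sum>f\<in>S. b f * (c * wiener_integral x f / ?I f))"
        using S regressors_integral \<delta>
        by (intro tendsto_sum tendsto_mult tendsto_divide tendsto_const wiener_integral_approx(1)[OF q \<delta> _ elim]) force+
      moreover have "(\<Sum>f\<in>S. b f * (c * wiener_integral x f / ?I f)) = (\<Sum>f\<in>S. b f * limit_process q \<delta> s r c x f)"
        using S elim by (intro sum.cong refl) (auto simp: limit_process_def)
      ultimately show ?case by simp
    qed
  qed
  then show "\<exists>m s'. 0 \<le> s' \<and> distr white_noise borel (\<lambda>x. \<Sum>f\<in>S. b f * limit_process q \<delta> s r c x f) = normal_law m s'" by blast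
qed

section \<open>Outer expectations\<close>

context prob_space
begin

lemma ereal_expectation_real:
  fixes U :: "'a \<Rightarrow> real"
  assumes U: "integrable M U"
  shows "ereal_expectation_exists M (\<lambda>\<omega>. ereal (U \<omega>))" "ereal_expectation M (\<lambda>\<omega>. ereal (U \<omega>)) = ereal (expectation U)"
proof -
  obtain a b where ab: "(\<integral>\<^sup>+\<omega>. ennreal (U \<omega>) \<partial>M) = ennreal a" "0 \<le> a" "(\<integral>\<^sup>+\<omega>. ennreal (- U \<omega>) \<partial>M) = ennreal b" "0 \<le> b"
    and eq: "expectation U = a - b"
    using integrableE[OF U] by metis
  show "ereal_expectation_exists M (\<lambda>\<omega>. ereal (U \<omega>))"
    unfolding ereal_expectation_exists_def using ab by (simp add: ennreal.abs_eq[symmetric] flip: ennreal.abs_eq)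
  show "ereal_expectation M (\<lambda>\<omega>. ereal (U \<omega>)) = ereal (expectation U)"
    unfolding ereal_expectation_def using ab eq by simp
qed

lemma outer_expectation_le:
  assumes "integrable M U" "\<And>\<omega>. \<omega> \<in> space M \<Longrightarrow> T \<omega> \<le> U \<omega>"
  shows "outer_expectation M (\<lambda>\<omega>. ereal (T \<omega>)) \<le> ereal (expectation U)"
  unfolding outer_expectation_def
proof (rule Inf_lower, rule CollectI, intro exI conjI)
  show "ereal (expectation U) = ereal_expectation M (\<lambda>\<omega>. ereal (U \<omega>))"
    by (rule ereal_expectation_real(2)[OF assms(1), symmetric])
qed (use assms ereal_expectation_real(1)[OF assms(1)] in auto)

lemma outer_expectation_ge:
  assumes L: "integrable M L" and LT: "\<And>\<omega>. \<omega> \<in> space M \<Longrightarrow> L \<omega> \<le> T \<omega>"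
  shows "ereal (expectation L) \<le> outer_expectation M (\<lambda>\<omega>. ereal (T \<omega>))"
  unfolding outer_expectation_def
proof (rule Inf_greatest, safe)
  fix U assume U: "U \<in> borel_measurable M" "ereal_expectation_exists M U" "\<forall>\<omega>\<in>space M. ereal (T \<omega>) \<le> U \<omega>"
  have LU: "ereal (L \<omega>) \<le> U \<omega>" if "\<omega> \<in> space M" for \<omega>
    using LT[OF that] U(3) that by (meson ereal_less_eq(3) order_trans)
  have "ereal (expectation L) = ereal_expectation M (\<lambda>\<omega>. ereal (L \<omega>))"
    by (rule ereal_expectation_real(2)[OF L, symmetric])
  also have "\<dots> \<le> ereal_expectation M U"
    unfolding ereal_expectation_def
  proof (rule ereal_minus_mono)
    show "enn2ereal (\<integral>\<^sup>+\<omega>. e2ennreal (ereal (L \<omega>)) \<partial>M) \<le> enn2ereal (\<integral>\<^sup>+\<omega>. e2ennreal (U \<omega>) \<partial>M)"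
      unfolding less_eq_ennreal.rep_eq[symmetric] by (intro nn_integral_mono e2ennreal_mono LU)
    show "enn2ereal (\<integral>\<^sup>+\<omega>. e2ennreal (- U \<omega>) \<partial>M) \<le> enn2ereal (\<integral>\<^sup>+\<omega>. e2ennreal (- ereal (L \<omega>)) \<partial>M)"
      unfolding less_eq_ennreal.rep_eq[symmetric]
      by (intro nn_integral_mono e2ennreal_mono) (metis LU ereal_minus_le_minus)
  qed
  finally show "ereal (expectation L) \<le> ereal_expectation M U" .
qed

end

definition lipschitz_lower :: "'e metric \<Rightarrow> ('e \<Rightarrow> real) \<Rightarrow> nat \<Rightarrow> 'e \<Rightarrow> real" where
  "lipschitz_lower E h m x = (INF y\<in>mspace E. h y + real m * mdist E x y)"

context
  fixes E :: "'e metric" and h :: "'e \<Rightarrow> real" and B :: real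
  assumes B: "\<And>y. y \<in> mspace E \<Longrightarrow> \<bar>h y\<bar> \<le> B"
begin

lemma lipschitz_lower_bdd: "bdd_below ((\<lambda>y. h y + real m * mdist E x y) ` mspace E)"
proof (rule bdd_belowI2)
  fix y assume "y \<in> mspace E"
  then have "- B \<le> h y" using B[of y] by linarith
  moreover have "0 \<le> real m * mdist E x y" by simp
  ultimately show "- B \<le> h y + real m * mdist E x y" by linarith
qed

lemma lipschitz_lower_le:
  assumes x: "x \<in> mspace E"
  shows "lipschitz_lower E h m x \<le> h x"
proof -
  have "mdist E x x = 0" using Metric_space.zero[OF Metric_space_mspace_mdist x x] by simp
  then show ?thesis
    unfolding lipschitz_lower_def using cINF_lower[OF lipschitz_lower_bdd[of m x] x] by simp
qed

lemma lipschitz_lower_abs: "x \<in> mspace E \<Longrightarrow> \<bar>lipschitz_lower E h m x\<bar> \<le> B"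
proof -
  assume x: "x \<in> mspace E"
  have "- B \<le> lipschitz_lower E h m x"
    unfolding lipschitz_lower_def
  proof (rule cINF_greatest)
    fix y assume "y \<in> mspace E"
    then have "- B \<le> h y" using B[of y] by linarith
    moreover have "0 \<le> real m * mdist E x y" by simp
    ultimately show "- B \<le> h y + real m * mdist E x y" by linarith
  qed (use x in auto)
  then show ?thesis using lipschitz_lower_le[OF x, of m] B[OF x] by linarith
qed

lemma lipschitz_lower_lipschitz:
  assumes "x \<in> mspace E" "x' \<in> mspace E"
  shows "\<bar>lipschitz_lower E h m x - lipschitz_lower E h m x'\<bar> \<le> real m * mdist E x x'"
proof -
  have le: "lipschitz_lower E h m x - real m * mdist E x x' \<le> lipschitz_lower E h m x'"
    if x: "x \<in> mspace E" "x' \<in> mspace E" for x x'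
    unfolding lipschitz_lower_def[of _ _ _ x']
  proof (rule cINF_greatest)
    fix y assume y: "y \<in> mspace E"
    have "lipschitz_lower E h m x \<le> h y + real m * mdist E x y"
      unfolding lipschitz_lower_def by (rule cINF_lower[OF lipschitz_lower_bdd y])
    also have "real m * mdist E x y \<le> real m * (mdist E x x' + mdist E x' y)"
      by (intro mult_left_mono mdist_triangle x y) simp
    finally show "lipschitz_lower E h m x - real m * mdist E x x' \<le> h y + real m * mdist E x' y"
      by (simp add: algebra_simps)
  qed (use x in auto)
  from le[OF assms] le[OF assms(2,1)] show ?thesis
    using mdist_commute[of E x x'] by (simp add: abs_le_iff)
qed

lemma lipschitz_lower_continuous: "continuous_map (mtopology_of E) euclideanreal (lipschitz_lower E h m)"
  unfolding continuous_map_mtopology_of_real_iff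
proof (intro ballI allI impI)
  fix x and e :: real assume x: "x \<in> mspace E" and e: "e > 0"
  show "\<exists>r>0. \<forall>y\<in>mspace E. mdist E x y < r \<longrightarrow> \<bar>lipschitz_lower E h m x - lipschitz_lower E h m y\<bar> < e"
  proof (intro exI[of _ "e / (real m + 1)"] conjI ballI impI)
    fix y assume y: "y \<in> mspace E" "mdist E x y < e / (real m + 1)"
    have "\<bar>lipschitz_lower E h m x - lipschitz_lower E h m y\<bar> \<le> real m * mdist E x y"
      by (rule lipschitz_lower_lipschitz[OF x y(1)])
    also have "\<dots> \<le> (real m + 1) * mdist E x y" by (intro mult_right_mono) auto
    also have "\<dots> < e" using y(2) by (simp add: pos_less_divide_eq mult.commute)
    finally show "\<bar>lipschitz_lower E h m x - lipschitz_lower E h m y\<bar> < e" .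
  qed (use e in auto)
qed

lemma lipschitz_lower_tendsto:
  assumes h: "continuous_map (mtopology_of E) euclideanreal h" and x: "x \<in> mspace E"
  shows "(\<lambda>m. lipschitz_lower E h m x) \<longlonglongrightarrow> h x"
proof (rule tendstoI)
  fix e :: real assume e: "e > 0"
  obtain r where r: "r > 0" "\<And>y. y \<in> mspace E \<Longrightarrow> mdist E x y < r \<Longrightarrow> \<bar>h x - h y\<bar> < e/2"
    using h x e unfolding continuous_map_mtopology_of_real_iff by (meson half_gt_zero)
  obtain m0 :: nat where m0: "2 * B / r \<le> real m0" using real_arch_simple by blast
  have "dist (lipschitz_lower E h m x) (h x) < e" if m: "m \<ge> m0" for m
  proof -
    have "h x - e/2 \<le> lipschitz_lower E h m x"
      unfolding lipschitz_lower_def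
    proof (rule cINF_greatest)
      fix y assume y: "y \<in> mspace E"
      show "h x - e/2 \<le> h y + real m * mdist E x y"
      proof (cases "mdist E x y < r")
        case True
        have "0 \<le> real m * mdist E x y" by simp
        then show ?thesis using r(2)[OF y True] by linarith
      next
        case False
        have "2 * B \<le> real m0 * r" using m0 r(1) by (simp add: pos_divide_le_eq)
        also have "\<dots> \<le> real m * r" using m r(1) by (intro mult_right_mono) auto
        also have "\<dots> \<le> real m * mdist E x y" using False by (intro mult_left_mono) auto
        finally show ?thesis using B[OF x] B[OF y] e by linarith
      qed
    qed (use x in auto)
    then show ?thesis using lipschitz_lower_le[OF x, of m] e by (simp add: dist_real_def)
  qed
  then show "\<forall>\<^sub>F m in sequentially. dist (lipschitz_lower E h m x) (h x) < e"
    by (auto simp: eventually_sequentially)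
qed

end

locale approximated_convergence =
  M: prob_space M + N: prob_space N for M :: "'a measure" and N :: "'b measure" +
  fixes E :: "'e metric" and Z :: "nat \<Rightarrow> 'a \<Rightarrow> 'e" and Z0 :: "'b \<Rightarrow> 'e"
    and V :: "nat \<Rightarrow> nat \<Rightarrow> 'a \<Rightarrow> 'e" and V0 :: "nat \<Rightarrow> 'b \<Rightarrow> 'e"
  assumes Z_in: "\<forall>\<^sub>F n in sequentially. Z n \<in> space M \<rightarrow> mspace E"
    and Z0_in: "\<And>x. x \<in> space N \<Longrightarrow> Z0 x \<in> mspace E"
    and V_in: "\<And>n k \<omega>. \<omega> \<in> space M \<Longrightarrow> V n k \<omega> \<in> mspace E"
    and V0_in: "\<And>k x. x \<in> space N \<Longrightarrow> V0 k x \<in> mspace E"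
    and V_meas: "\<And>h n k. continuous_map (mtopology_of E) euclideanreal h \<Longrightarrow> (\<lambda>\<omega>. h (V n k \<omega>)) \<in> borel_measurable M"
    and V0_meas: "\<And>h k. continuous_map (mtopology_of E) euclideanreal h \<Longrightarrow> (\<lambda>x. h (V0 k x)) \<in> borel_measurable N"
    and Z0_meas: "\<And>h. continuous_map (mtopology_of E) euclideanreal h \<Longrightarrow> (\<lambda>x. h (Z0 x)) \<in> borel_measurable N"
    and close: "\<And>e. e > 0 \<Longrightarrow> \<exists>k0. \<forall>k\<ge>k0. \<exists>n0. \<forall>n\<ge>n0. \<exists>A\<in>sets M. measure M A \<le> e \<and>
      (\<forall>\<omega>\<in>space M - A. mdist E (Z n \<omega>) (V n k \<omega>) \<le> e)"
    and V_conv: "\<And>h k. continuous_map (mtopology_of E) euclideanreal h \<Longrightarrow> bounded (h ` mspace E) \<Longrightarrow>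
      (\<lambda>n. \<integral>\<omega>. h (V n k \<omega>) \<partial>M) \<longlonglongrightarrow> (\<integral>x. h (V0 k x) \<partial>N)"
    and V0_conv: "AE x in N. (\<lambda>k. mdist E (V0 k x) (Z0 x)) \<longlonglongrightarrow> 0"
begin

lemma outer_expectation_lipschitz:
  assumes g: "continuous_map (mtopology_of E) euclideanreal g" and B: "\<And>y. y \<in> mspace E \<Longrightarrow> \<bar>g y\<bar> \<le> B"
    and L: "\<And>x y. x \<in> mspace E \<Longrightarrow> y \<in> mspace E \<Longrightarrow> \<bar>g x - g y\<bar> \<le> L * mdist E x y"
    and gh: "\<And>y. y \<in> mspace E \<Longrightarrow> g y \<le> h y" and e: "e > 0"
  shows "\<exists>n0. \<forall>n\<ge>n0. ereal ((\<integral>x. g (Z0 x) \<partial>N) - e) \<le> outer_expectation M (\<lambda>\<omega>. ereal (h (Z n \<omega>)))"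
    and "(\<And>y. y \<in> mspace E \<Longrightarrow> h' y \<le> g y) \<Longrightarrow>
      \<exists>n0. \<forall>n\<ge>n0. outer_expectation M (\<lambda>\<omega>. ereal (h' (Z n \<omega>))) \<le> ereal ((\<integral>x. g (Z0 x) \<partial>N) + e)"
proof -
  have bdd: "bounded (g ` mspace E)" using B by (auto simp: bounded_iff)
  obtain x0 where "x0 \<in> space N" using N.not_empty by blast
  then have B0: "0 \<le> B" using B[OF Z0_in] by (meson abs_ge_zero order_trans)
  have "(\<lambda>k. \<integral>x. g (V0 k x) \<partial>N) \<longlonglongrightarrow> (\<integral>x. g (Z0 x) \<partial>N)"
  proof (rule integral_dominated_convergence[where w = "\<lambda>_. B"])
    show "AE x in N. (\<lambda>k. g (V0 k x)) \<longlonglongrightarrow> g (Z0 x)"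
      using V0_conv AE_space
    proof eventually_elim
      case (elim x)
      show ?case by (rule continuous_map_tendsto[OF g]) (use elim V0_in Z0_in in auto)
    qed
  qed (use g B V0_in Z0_in in \<open>auto intro!: V0_meas Z0_meas AE_I2\<close>)
  then have "\<forall>\<^sub>F k in sequentially. dist (\<integral>x. g (V0 k x) \<partial>N) (\<integral>x. g (Z0 x) \<partial>N) < e/3"
    by (rule tendstoD) (use e in simp)
  then obtain k1 where k1: "\<And>k. k \<ge> k1 \<Longrightarrow> dist (\<integral>x. g (V0 k x) \<partial>N) (\<integral>x. g (Z0 x) \<partial>N) < e/3"
    by (auto simp: eventually_sequentially)
  define \<epsilon> where "\<epsilon> = e / 3 / (\<bar>L\<bar> + 2 * B + 1)"
  have \<epsilon>: "\<epsilon> > 0" using e B0 by (simp add: \<epsilon>_def)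
  have \<epsilon>e: "(\<bar>L\<bar> + 2 * B) * \<epsilon> \<le> e/3"
  proof -
    have "(\<bar>L\<bar> + 2 * B) * \<epsilon> \<le> (\<bar>L\<bar> + 2 * B + 1) * \<epsilon>" using \<epsilon> by (intro mult_right_mono) auto
    also have "\<dots> = e/3"
    proof -
      have "\<bar>L\<bar> + 2 * B + 1 \<noteq> 0" using B0 by linarith
      then show ?thesis unfolding \<epsilon>_def times_divide_eq_right[of _ "e/3"] by (rule nonzero_mult_div_cancel_left)
    qed
    finally show ?thesis .
  qed
  obtain k0 where k0: "\<And>k. k \<ge> k0 \<Longrightarrow> \<exists>n0. \<forall>n\<ge>n0. \<exists>A\<in>sets M. measure M A \<le> \<epsilon> \<and>
      (\<forall>\<omega>\<in>space M - A. mdist E (Z n \<omega>) (V n k \<omega>) \<le> \<epsilon>)"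
    using close[OF \<epsilon>] by blast
  define k where "k = max k0 k1"
  obtain n1 where n1: "\<And>n. n \<ge> n1 \<Longrightarrow> \<exists>A\<in>sets M. measure M A \<le> \<epsilon> \<and>
      (\<forall>\<omega>\<in>space M - A. mdist E (Z n \<omega>) (V n k \<omega>) \<le> \<epsilon>)"
    using k0[of k] by (auto simp: k_def)
  have "\<forall>\<^sub>F n in sequentially. dist (\<integral>\<omega>. g (V n k \<omega>) \<partial>M) (\<integral>x. g (V0 k x) \<partial>N) < e/3"
    using tendstoD[OF V_conv[OF g bdd, of k], of "e/3"] e by simp
  then obtain n2 where n2: "\<And>n. n \<ge> n2 \<Longrightarrow> dist (\<integral>\<omega>. g (V n k \<omega>) \<partial>M) (\<integral>x. g (V0 k x) \<partial>N) < e/3"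
    by (auto simp: eventually_sequentially)
  obtain n3 where n3: "\<And>n. n \<ge> n3 \<Longrightarrow> Z n \<in> space M \<rightarrow> mspace E"
    using Z_in by (auto simp: eventually_sequentially)
  have sandwich: "\<exists>lo up. integrable M lo \<and> integrable M up \<and> (\<forall>\<omega>\<in>space M. lo \<omega> \<le> g (Z n \<omega>) \<and> g (Z n \<omega>) \<le> up \<omega>) \<and>
      (\<integral>x. g (Z0 x) \<partial>N) - e \<le> M.expectation lo \<and> M.expectation up \<le> (\<integral>x. g (Z0 x) \<partial>N) + e"
    if n: "n \<ge> max n1 (max n2 n3)" for n
  proof -
    obtain A where A [measurable]: "A \<in> sets M" and A': "measure M A \<le> \<epsilon>"
      "\<And>\<omega>. \<omega> \<in> space M - A \<Longrightarrow> mdist E (Z n \<omega>) (V n k \<omega>) \<le> \<epsilon>"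
      using n1[of n] n by auto
    have gV: "integrable M (\<lambda>\<omega>. g (V n k \<omega>))"
      by (rule M.integrable_const_bound[of _ B]) (use B V_in V_meas[OF g] in auto)
    have iA: "integrable M (indicator A :: 'a \<Rightarrow> real)" by (simp add: less_top[symmetric])
    define d where "d \<omega> = \<bar>L\<bar> * \<epsilon> + 2 * B * indicator A \<omega>" for \<omega> :: 'a
    have d: "integrable M d" unfolding d_def using iA by auto
    have "M.expectation d = \<bar>L\<bar> * \<epsilon> + 2 * B * measure M A"
      unfolding d_def using iA by (simp add: M.prob_space)
    also have "\<dots> \<le> \<bar>L\<bar> * \<epsilon> + 2 * B * \<epsilon>" using A' B0 by (intro add_left_mono mult_left_mono) auto
    also have "\<dots> \<le> e/3" using \<epsilon>e by (simp add: algebra_simps)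
    finally have Ed: "M.expectation d \<le> e/3" .
    have diff: "\<bar>g (Z n \<omega>) - g (V n k \<omega>)\<bar> \<le> d \<omega>" if \<omega>: "\<omega> \<in> space M" for \<omega>
    proof -
      have in_E: "Z n \<omega> \<in> mspace E" "V n k \<omega> \<in> mspace E" using n3[of n] n \<omega> V_in by auto
      show ?thesis
      proof (cases "\<omega> \<in> A")
        case True
        have "0 \<le> \<bar>L\<bar> * \<epsilon>" using \<epsilon> by simp
        then show ?thesis using True B[OF in_E(1)] B[OF in_E(2)] by (simp add: d_def)
      next
        case False
        have "\<bar>g (Z n \<omega>) - g (V n k \<omega>)\<bar> \<le> L * mdist E (Z n \<omega>) (V n k \<omega>)" by (rule L[OF in_E])
        also have "\<dots> \<le> \<bar>L\<bar> * mdist E (Z n \<omega>) (V n k \<omega>)" by (intro mult_right_mono) auto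
        also have "\<dots> \<le> \<bar>L\<bar> * \<epsilon>" using A'(2)[of \<omega>] False \<omega> by (intro mult_left_mono) auto
        finally show ?thesis using False by (simp add: d_def)
      qed
    qed
    have near: "\<bar>M.expectation (\<lambda>\<omega>. g (V n k \<omega>)) - (\<integral>x. g (Z0 x) \<partial>N)\<bar> \<le> 2 * e / 3"
    proof -
      have "k \<ge> k1" "n \<ge> n2" using n by (auto simp: k_def)
      from n2[OF this(2)] k1[OF this(1)] show ?thesis unfolding dist_real_def by linarith
    qed
    have "M.expectation (\<lambda>\<omega>. g (V n k \<omega>) - d \<omega>) = M.expectation (\<lambda>\<omega>. g (V n k \<omega>)) - M.expectation d"
      "M.expectation (\<lambda>\<omega>. g (V n k \<omega>) + d \<omega>) = M.expectation (\<lambda>\<omega>. g (V n k \<omega>)) + M.expectation d"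
      using gV d by simp_all
    then have "(\<integral>x. g (Z0 x) \<partial>N) - e \<le> M.expectation (\<lambda>\<omega>. g (V n k \<omega>) - d \<omega>)"
      "M.expectation (\<lambda>\<omega>. g (V n k \<omega>) + d \<omega>) \<le> (\<integral>x. g (Z0 x) \<partial>N) + e"
      using near Ed by linarith+
    moreover have "\<forall>\<omega>\<in>space M. g (V n k \<omega>) - d \<omega> \<le> g (Z n \<omega>) \<and> g (Z n \<omega>) \<le> g (V n k \<omega>) + d \<omega>"
    proof (intro ballI conjI)
      fix \<omega> assume "\<omega> \<in> space M"
      from diff[OF this] show "g (V n k \<omega>) - d \<omega> \<le> g (Z n \<omega>)" "g (Z n \<omega>) \<le> g (V n k \<omega>) + d \<omega>"
        by linarith+
    qed
    ultimately show ?thesis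
      using gV d by (intro exI[of _ "\<lambda>\<omega>. g (V n k \<omega>) - d \<omega>"] exI[of _ "\<lambda>\<omega>. g (V n k \<omega>) + d \<omega>"]) auto
  qed
  show "\<exists>n0. \<forall>n\<ge>n0. ereal ((\<integral>x. g (Z0 x) \<partial>N) - e) \<le> outer_expectation M (\<lambda>\<omega>. ereal (h (Z n \<omega>)))"
  proof (intro exI[of _ "max n1 (max n2 n3)"] allI impI)
    fix n assume n: "n \<ge> max n1 (max n2 n3)"
    obtain lo where lo: "integrable M lo" "\<forall>\<omega>\<in>space M. lo \<omega> \<le> g (Z n \<omega>)" "(\<integral>x. g (Z0 x) \<partial>N) - e \<le> M.expectation lo"
      using sandwich[OF n] by blast
    have "ereal ((\<integral>x. g (Z0 x) \<partial>N) - e) \<le> ereal (M.expectation lo)" using lo(3) by simp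
    also have "\<dots> \<le> outer_expectation M (\<lambda>\<omega>. ereal (h (Z n \<omega>)))"
    proof (rule M.outer_expectation_ge[OF lo(1)])
      fix \<omega> assume \<omega>: "\<omega> \<in> space M"
      then have "Z n \<omega> \<in> mspace E" using n3[of n] n by auto
      then show "lo \<omega> \<le> h (Z n \<omega>)" using lo(2) gh \<omega> by (meson order_trans)
    qed
    finally show "ereal ((\<integral>x. g (Z0 x) \<partial>N) - e) \<le> outer_expectation M (\<lambda>\<omega>. ereal (h (Z n \<omega>)))" .
  qed
  show "\<exists>n0. \<forall>n\<ge>n0. outer_expectation M (\<lambda>\<omega>. ereal (h' (Z n \<omega>))) \<le> ereal ((\<integral>x. g (Z0 x) \<partial>N) + e)"
    if h': "\<And>y. y \<in> mspace E \<Longrightarrow> h' y \<le> g y"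
  proof (intro exI[of _ "max n1 (max n2 n3)"] allI impI)
    fix n assume n: "n \<ge> max n1 (max n2 n3)"
    obtain up where up: "integrable M up" "\<forall>\<omega>\<in>space M. g (Z n \<omega>) \<le> up \<omega>" "M.expectation up \<le> (\<integral>x. g (Z0 x) \<partial>N) + e"
      using sandwich[OF n] by blast
    have "outer_expectation M (\<lambda>\<omega>. ereal (h' (Z n \<omega>))) \<le> ereal (M.expectation up)"
    proof (rule M.outer_expectation_le[OF up(1)])
      fix \<omega> assume \<omega>: "\<omega> \<in> space M"
      then have "Z n \<omega> \<in> mspace E" using n3[of n] n by auto
      then show "h' (Z n \<omega>) \<le> up \<omega>" using up(2) h' \<omega> by (meson order_trans)
    qed
    also have "\<dots> \<le> ereal ((\<integral>x. g (Z0 x) \<partial>N) + e)" using up(3) by simp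
    finally show "outer_expectation M (\<lambda>\<omega>. ereal (h' (Z n \<omega>))) \<le> ereal ((\<integral>x. g (Z0 x) \<partial>N) + e)" .
  qed
qed

lemma integral_lipschitz_lower_tendsto:
  assumes h: "continuous_map (mtopology_of E) euclideanreal h" and B: "\<And>y. y \<in> mspace E \<Longrightarrow> \<bar>h y\<bar> \<le> B"
  shows "(\<lambda>m. \<integral>x. lipschitz_lower E h m (Z0 x) \<partial>N) \<longlonglongrightarrow> (\<integral>x. h (Z0 x) \<partial>N)"
proof (rule integral_dominated_convergence[where w = "\<lambda>_. B"])
  show "(\<lambda>x. h (Z0 x)) \<in> borel_measurable N" by (rule Z0_meas[OF h])
  show "(\<lambda>x. lipschitz_lower E h m (Z0 x)) \<in> borel_measurable N" for m
    by (rule Z0_meas[OF lipschitz_lower_continuous[OF B]])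
  show "AE x in N. (\<lambda>m. lipschitz_lower E h m (Z0 x)) \<longlonglongrightarrow> h (Z0 x)"
    by (intro AE_I2 lipschitz_lower_tendsto[OF B h] Z0_in)
  show "AE x in N. norm (lipschitz_lower E h m (Z0 x)) \<le> B" for m
    using lipschitz_lower_abs[OF B Z0_in] by (intro AE_I2) simp
qed simp

theorem outer_expectation_tendsto:
  assumes h: "continuous_map (mtopology_of E) euclideanreal h" and bdd: "bounded (h ` mspace E)"
  shows "(\<lambda>n. outer_expectation M (\<lambda>\<omega>. ereal (h (Z n \<omega>)))) \<longlonglongrightarrow> ereal (\<integral>x. h (Z0 x) \<partial>N)"
proof -
  obtain B where B: "\<And>y. y \<in> mspace E \<Longrightarrow> \<bar>h y\<bar> \<le> B"
    using bdd unfolding bounded_iff by (metis image_eqI real_norm_def)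
  have h': "continuous_map (mtopology_of E) euclideanreal (\<lambda>y. - h y)"
    using h unfolding continuous_map_mtopology_of_real_iff by (simp add: abs_minus_commute)
  have B': "\<And>y. y \<in> mspace E \<Longrightarrow> \<bar>- h y\<bar> \<le> B" using B by simp
  let ?I = "\<integral>x. h (Z0 x) \<partial>N"
  have ev: "\<exists>n0. \<forall>n\<ge>n0. ereal (?I - e) \<le> outer_expectation M (\<lambda>\<omega>. ereal (h (Z n \<omega>))) \<and>
      outer_expectation M (\<lambda>\<omega>. ereal (h (Z n \<omega>))) \<le> ereal (?I + e)" if e: "e > 0" for e
  proof -
    have "\<forall>\<^sub>F m in sequentially. dist (\<integral>x. lipschitz_lower E h m (Z0 x) \<partial>N) ?I < e/2"
      by (rule tendstoD[OF integral_lipschitz_lower_tendsto[OF h B]]) (use e in auto)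
    then obtain m where m: "dist (\<integral>x. lipschitz_lower E h m (Z0 x) \<partial>N) ?I < e/2" by (auto simp: eventually_sequentially)
    have "\<exists>n0. \<forall>n\<ge>n0. ereal ((\<integral>x. lipschitz_lower E h m (Z0 x) \<partial>N) - e/2) \<le> outer_expectation M (\<lambda>\<omega>. ereal (h (Z n \<omega>)))"
      by (rule outer_expectation_lipschitz(1)[OF lipschitz_lower_continuous[OF B] lipschitz_lower_abs[OF B]
          lipschitz_lower_lipschitz[OF B] lipschitz_lower_le[OF B]]) (use e in auto)
    then obtain n1 where n1: "\<And>n. n \<ge> n1 \<Longrightarrow> ereal ((\<integral>x. lipschitz_lower E h m (Z0 x) \<partial>N) - e/2) \<le> outer_expectation M (\<lambda>\<omega>. ereal (h (Z n \<omega>)))"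
      by blast
    have "\<forall>\<^sub>F m in sequentially. dist (\<integral>x. lipschitz_lower E (\<lambda>y. - h y) m (Z0 x) \<partial>N) (\<integral>x. - h (Z0 x) \<partial>N) < e/2"
      by (rule tendstoD[OF integral_lipschitz_lower_tendsto[OF h' B']]) (use e in auto)
    then obtain m' where m': "dist (\<integral>x. lipschitz_lower E (\<lambda>y. - h y) m' (Z0 x) \<partial>N) (\<integral>x. - h (Z0 x) \<partial>N) < e/2"
      by (auto simp: eventually_sequentially)
    define g where "g y = - lipschitz_lower E (\<lambda>y. - h y) m' y" for y
    have "\<exists>n0. \<forall>n\<ge>n0. outer_expectation M (\<lambda>\<omega>. ereal (h (Z n \<omega>))) \<le> ereal ((\<integral>x. g (Z0 x) \<partial>N) + e/2)"
    proof (rule outer_expectation_lipschitz(2))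
      show "continuous_map (mtopology_of E) euclideanreal g"
        using lipschitz_lower_continuous[of E "\<lambda>y. - h y" B m', OF B'] unfolding g_def continuous_map_mtopology_of_real_iff
        by (simp add: abs_minus_commute)
      show "\<bar>g y\<bar> \<le> B" if "y \<in> mspace E" for y using lipschitz_lower_abs[of E "\<lambda>y. - h y" B, OF B' that] by (simp add: g_def)
      show "\<bar>g x - g y\<bar> \<le> real m' * mdist E x y" if "x \<in> mspace E" "y \<in> mspace E" for x y
        using lipschitz_lower_lipschitz[of E "\<lambda>y. - h y" B, OF B' that] by (simp add: g_def abs_minus_commute)
      show "g y \<le> g y" for y by simp
      show "h y \<le> g y" if "y \<in> mspace E" for y
        using lipschitz_lower_le[of E "\<lambda>y. - h y" B, OF B' that, of m'] by (simp add: g_def)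
    qed (use e in auto)
    then obtain n2 where n2: "\<And>n. n \<ge> n2 \<Longrightarrow> outer_expectation M (\<lambda>\<omega>. ereal (h (Z n \<omega>))) \<le> ereal ((\<integral>x. g (Z0 x) \<partial>N) + e/2)"
      by blast
    have 1: "?I - e \<le> (\<integral>x. lipschitz_lower E h m (Z0 x) \<partial>N) - e/2" using m unfolding dist_real_def by linarith
    have 2: "(\<integral>x. g (Z0 x) \<partial>N) + e/2 \<le> ?I + e"
    proof -
      have "(\<integral>x. g (Z0 x) \<partial>N) = - (\<integral>x. lipschitz_lower E (\<lambda>y. - h y) m' (Z0 x) \<partial>N)"
        "(\<integral>x. - h (Z0 x) \<partial>N) = - ?I" by (simp_all add: g_def)
      then show ?thesis using m' unfolding dist_real_def by linarith
    qed
    show ?thesis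
    proof (intro exI[of _ "max n1 n2"] allI impI conjI)
      fix n assume n: "n \<ge> max n1 n2"
      have "ereal (?I - e) \<le> ereal ((\<integral>x. lipschitz_lower E h m (Z0 x) \<partial>N) - e/2)" using 1 by simp
      also have "\<dots> \<le> outer_expectation M (\<lambda>\<omega>. ereal (h (Z n \<omega>)))" using n1 n by simp
      finally show "ereal (?I - e) \<le> outer_expectation M (\<lambda>\<omega>. ereal (h (Z n \<omega>)))" .
      have "outer_expectation M (\<lambda>\<omega>. ereal (h (Z n \<omega>))) \<le> ereal ((\<integral>x. g (Z0 x) \<partial>N) + e/2)" using n2 n by simp
      also have "\<dots> \<le> ereal (?I + e)" using 2 by simp
      finally show "outer_expectation M (\<lambda>\<omega>. ereal (h (Z n \<omega>))) \<le> ereal (?I + e)" .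
    qed
  qed
  show ?thesis
  proof (rule order_tendstoI)
    fix a assume "a < ereal ?I"
    then obtain b where "a < ereal b" "ereal b < ereal ?I" using ereal_dense2 by blast
    then have b: "a < ereal b" "b < ?I" by simp_all
    obtain n0 where "\<And>n. n \<ge> n0 \<Longrightarrow> ereal (?I - (?I - b)) \<le> outer_expectation M (\<lambda>\<omega>. ereal (h (Z n \<omega>)))"
      using ev[of "?I - b"] b(2) by auto
    then show "\<forall>\<^sub>F n in sequentially. a < outer_expectation M (\<lambda>\<omega>. ereal (h (Z n \<omega>)))"
      unfolding eventually_sequentially using less_le_trans[OF b(1)] by (intro exI[of _ n0]) auto
  next
    fix a assume "ereal ?I < a"
    then obtain b where "ereal ?I < ereal b" "ereal b < a" using ereal_dense2 by blast
    then have b: "ereal b < a" "?I < b" by simp_all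
    obtain n0 where "\<And>n. n \<ge> n0 \<Longrightarrow> outer_expectation M (\<lambda>\<omega>. ereal (h (Z n \<omega>))) \<le> ereal (?I + (b - ?I))"
      using ev[of "b - ?I"] b(2) by auto
    then show "\<forall>\<^sub>F n in sequentially. outer_expectation M (\<lambda>\<omega>. ereal (h (Z n \<omega>))) < a"
      unfolding eventually_sequentially using le_less_trans[OF _ b(1)] by (intro exI[of _ n0]) auto
  qed
qed

end

section \<open>The central limit theorem for block sums\<close>

lemma indep_vars_expectation_cong:
  fixes X :: "nat \<Rightarrow> 'a \<Rightarrow> real" and X' :: "nat \<Rightarrow> 'b \<Rightarrow> real" and H :: "(nat \<Rightarrow> real) \<Rightarrow> real"
  assumes M: "prob_space M" "prob_space M'" and K: "K \<ge> 1"
    and X: "prob_space.indep_vars M (\<lambda>_. borel) X {..<K}" "prob_space.indep_vars M' (\<lambda>_. borel) X' {..<K}"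
    and law: "\<And>i. i < K \<Longrightarrow> distr M borel (X i) = distr M' borel (X' i)"
    and H: "H \<in> borel_measurable (PiM UNIV (\<lambda>_. borel))"
    and cut: "\<And>y y'. (\<And>i. i < K \<Longrightarrow> y i = y' i) \<Longrightarrow> H y = H y'"
  shows "(\<integral>\<omega>. H (\<lambda>i. X i \<omega>) \<partial>M) = (\<integral>\<omega>. H (\<lambda>i. X' i \<omega>) \<partial>M')"
proof -
  interpret M: prob_space M by fact
  interpret M': prob_space M' by fact
  have rv: "X i \<in> borel_measurable M" "X' i \<in> borel_measurable M'" if "i \<in> {..<K}" for i
    using X that by (auto simp: M.indep_vars_def M'.indep_vars_def)
  define G where "G y = H (\<lambda>i. if i < K then y i else 0)" for y
  have "(\<lambda>y i. if i < K then y i else (0::real)) \<in> PiM {..<K} (\<lambda>_. borel) \<rightarrow>\<^sub>M PiM UNIV (\<lambda>_. borel)"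
  proof (rule measurable_PiM_single')
    show "(\<lambda>y. if i < K then y i else (0::real)) \<in> borel_measurable (PiM {..<K} (\<lambda>_. borel))" for i
      by (cases "i < K") auto
  qed (auto simp: space_PiM)
  from measurable_compose[OF this H] have G: "G \<in> borel_measurable (PiM {..<K} (\<lambda>_. borel))"
    by (simp add: G_def[abs_def])
  have ne: "{..<K} \<noteq> {}" using K by (auto simp: lessThan_empty_iff)
  have 1: "(\<integral>\<omega>. H (\<lambda>i. X i \<omega>) \<partial>M) = (\<integral>y. G y \<partial>PiM {..<K} (\<lambda>i. distr M borel (X i)))"
  proof -
    have "(\<integral>\<omega>. H (\<lambda>i. X i \<omega>) \<partial>M) = (\<integral>\<omega>. G (restrict (\<lambda>i. X i \<omega>) {..<K}) \<partial>M)"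
      unfolding G_def by (intro Bochner_Integration.integral_cong refl cut) auto
    also have "\<dots> = (\<integral>y. G y \<partial>distr M (PiM {..<K} (\<lambda>_. borel)) (\<lambda>\<omega>. restrict (\<lambda>i. X i \<omega>) {..<K}))"
      by (rule integral_distr[symmetric], rule measurable_restrict, erule rv(1), rule G)
    also have "distr M (PiM {..<K} (\<lambda>_. borel)) (\<lambda>\<omega>. restrict (\<lambda>i. X i \<omega>) {..<K}) = PiM {..<K} (\<lambda>i. distr M borel (X i))"
      by (rule M.indep_vars_iff_distr_eq_PiM'[OF ne, THEN iffD1, OF _ X(1)]) (rule rv(1))
    finally show ?thesis .
  qed
  have 2: "(\<integral>\<omega>. H (\<lambda>i. X' i \<omega>) \<partial>M') = (\<integral>y. G y \<partial>PiM {..<K} (\<lambda>i. distr M' borel (X' i)))"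
  proof -
    have "(\<integral>\<omega>. H (\<lambda>i. X' i \<omega>) \<partial>M') = (\<integral>\<omega>. G (restrict (\<lambda>i. X' i \<omega>) {..<K}) \<partial>M')"
      unfolding G_def by (intro Bochner_Integration.integral_cong refl cut) auto
    also have "\<dots> = (\<integral>y. G y \<partial>distr M' (PiM {..<K} (\<lambda>_. borel)) (\<lambda>\<omega>. restrict (\<lambda>i. X' i \<omega>) {..<K}))"
      by (rule integral_distr[symmetric], rule measurable_restrict, erule rv(2), rule G)
    also have "distr M' (PiM {..<K} (\<lambda>_. borel)) (\<lambda>\<omega>. restrict (\<lambda>i. X' i \<omega>) {..<K}) = PiM {..<K} (\<lambda>i. distr M' borel (X' i))"
      by (rule M'.indep_vars_iff_distr_eq_PiM'[OF ne, THEN iffD1, OF _ X(2)]) (rule rv(2))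
    finally show ?thesis .
  qed
  have "PiM {..<K} (\<lambda>i. distr M borel (X i)) = PiM {..<K} (\<lambda>i. distr M' borel (X' i))"
    by (rule PiM_cong) (auto simp: law)
  then show ?thesis using 1 2 by simp
qed

lemma indep_vars_PiM_functions:
  assumes \<Omega>: "prob_space \<Omega>" and K: "K \<ge> (1::nat)" and g: "\<And>i. g i \<in> borel_measurable \<Omega>"
  shows "prob_space.indep_vars (PiM {..<K} (\<lambda>_. \<Omega>)) (\<lambda>_. borel) (\<lambda>i \<omega>. g i (\<omega> i) :: real) {..<K}"
    and "i < K \<Longrightarrow> distr (PiM {..<K} (\<lambda>_. \<Omega>)) borel (\<lambda>\<omega>. g i (\<omega> i)) = distr \<Omega> borel (g i)"
proof -
  let ?P = "PiM {..<K} (\<lambda>_. \<Omega>)"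
  interpret P: prob_space ?P by (rule prob_space_PiM) (rule \<Omega>)
  have comp: "distr ?P \<Omega> (\<lambda>\<omega>. \<omega> i) = \<Omega>" if "i < K" for i
    by (rule distr_PiM_component) (use that \<Omega> in auto)
  have "P.indep_vars (\<lambda>_. \<Omega>) (\<lambda>i \<omega>. \<omega> i) {..<K}"
  proof (subst P.indep_vars_iff_distr_eq_PiM')
    have "distr ?P ?P (\<lambda>x. restrict x {..<K}) = distr ?P ?P (\<lambda>x. x)"
      by (rule distr_cong) (auto simp: space_PiM PiE_restrict)
    also have "\<dots> = ?P" by (rule distr_id)
    also have "\<dots> = PiM {..<K} (\<lambda>i. distr ?P \<Omega> (\<lambda>\<omega>. \<omega> i))"
      by (rule PiM_cong) (auto simp: comp)
    finally show "distr ?P ?P (\<lambda>x. restrict x {..<K}) = PiM {..<K} (\<lambda>i. distr ?P \<Omega> (\<lambda>\<omega>. \<omega> i))" .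
  qed (use K in \<open>auto simp: lessThan_empty_iff\<close>)
  then show "P.indep_vars (\<lambda>_. borel) (\<lambda>i \<omega>. g i (\<omega> i)) {..<K}"
    by (rule P.indep_vars_compose2) (rule g)
  assume i: "i < K"
  have "distr ?P borel (\<lambda>\<omega>. g i (\<omega> i)) = distr (distr ?P \<Omega> (\<lambda>\<omega>. \<omega> i)) borel (g i)"
    using i g by (subst distr_distr) (auto simp: comp_def)
  then show "distr ?P borel (\<lambda>\<omega>. g i (\<omega> i)) = distr \<Omega> borel (g i)" unfolding comp[OF i] .
qed

lemma of_nat_div_tendsto:
  assumes "K \<ge> 1"
  shows "(\<lambda>n. real (n * m div K) / real n) \<longlonglongrightarrow> real m / real K"
proof (rule tendsto_sandwich)
  have K: "real K > 0" using assms by simp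
  show "\<forall>\<^sub>F n in sequentially. real m / real K - 1 / real n \<le> real (n * m div K) / real n"
    using eventually_gt_at_top[of 0]
  proof eventually_elim
    case (elim n)
    have "real (n * m) / real K - 1 \<le> real (n * m div K)" 
      using real_of_int_floor_gt_diff_one[of "real (n * m) / real K"]
      by (simp only: floor_divide_of_nat_eq of_int_of_nat_eq less_imp_le)
    then have "(real (n * m) / real K - 1) / real n \<le> real (n * m div K) / real n" by (rule divide_right_mono) simp
    then show ?case using elim by (simp add: diff_divide_distrib)
  qed
  show "\<forall>\<^sub>F n in sequentially. real (n * m div K) / real n \<le> real m / real K"
    using eventually_gt_at_top[of 0]
  proof eventually_elim
    case (elim n)
    have "real (n * m div K) / real n \<le> (real (n * m) / real K) / real n"
      by (intro divide_right_mono of_nat_div_le_of_nat) simp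
    then show ?case using elim by simp
  qed
  have "(\<lambda>n. real m / real K - 1 / real n) \<longlonglongrightarrow> real m / real K - 0"
    by (intro tendsto_diff tendsto_const lim_1_over_n)
  then show "(\<lambda>n. real m / real K - 1 / real n) \<longlonglongrightarrow> real m / real K" by simp
qed simp

lemma tendsto_fun_real:
  fixes Y :: "nat \<Rightarrow> nat \<Rightarrow> real"
  assumes "\<And>i. (\<lambda>n. Y n i) \<longlonglongrightarrow> y i"
  shows "Y \<longlonglongrightarrow> y"
proof -
  have "limitin (product_topology (\<lambda>_. euclidean) UNIV) Y y sequentially"
    using assms by (simp add: limitin_componentwise)
  then show ?thesis by (simp only: euclidean_product_topology limitin_canonical_iff)
qed

context noise
begin

definition block_sum :: "nat \<Rightarrow> nat \<Rightarrow> nat \<Rightarrow> 'a \<Rightarrow> real" where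
  "block_sum n K i \<omega> = (partial_sum (n * Suc i div K) \<omega> - partial_sum (n * i div K) \<omega>) / sqrt n"

lemma block_sum_measurable [measurable]: "block_sum n K i \<in> borel_measurable M"
  unfolding block_sum_def[abs_def] by measurable

lemma block_sum_eq: "block_sum n K i \<omega> = (\<Sum>j\<in>{n * i div K..<n * Suc i div K}. \<zeta> j \<omega>) / sqrt n"
proof -
  have "n * i div K \<le> n * Suc i div K" by (intro div_le_mono mult_le_mono) auto
  then show ?thesis
    using sum_diff_nat_ivl[of 0 "n * i div K" "n * Suc i div K" "\<lambda>i. \<zeta> i \<omega>"]
    by (simp add: block_sum_def partial_sum_def atLeast0LessThan)
qed

lemma indep_block_sums: "indep_vars (\<lambda>_. borel) (block_sum n K) I"
proof -
  have mono: "n * i div K \<le> n * i' div K" if "i \<le> i'" for i i' using that by (intro div_le_mono mult_le_mono) auto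
  have "disjoint_family_on (\<lambda>i. {n * i div K..<n * Suc i div K}) I"
  proof -
    have "{n * i div K..<n * Suc i div K} \<inter> {n * i' div K..<n * Suc i' div K} = {}" if "i < i'" for i i'
      using mono[of "Suc i" i'] that by auto
    then show ?thesis unfolding disjoint_family_on_def by (metis inf_commute nat_neq_iff)
  qed
  then have "indep_vars (\<lambda>_. borel) (\<lambda>i \<omega>. \<Sum>j\<in>{n * i div K..<n * Suc i div K}. \<zeta> j \<omega>) I"
    by (intro indep_vars_block_sums[OF ind]) auto
  then have "indep_vars (\<lambda>_. borel) (\<lambda>i \<omega>. (\<Sum>j\<in>{n * i div K..<n * Suc i div K}. \<zeta> j \<omega>) / sqrt n) I"
    by (rule indep_vars_compose2[where Y = "\<lambda>_ x. x / sqrt n"]) measurable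
  then show ?thesis by (simp add: block_sum_eq[abs_def])
qed

lemma sum_law_card:
  assumes "finite A"
  shows "distr M borel (\<lambda>\<omega>. \<Sum>j\<in>A. \<zeta> j \<omega>) = distr M borel (partial_sum (card A))"
proof (rule Levy_uniqueness)
  show "real_distribution (distr M borel (\<lambda>\<omega>. \<Sum>j\<in>A. \<zeta> j \<omega>))"
    "real_distribution (distr M borel (partial_sum (card A)))"
    by (rule real_distribution_distr, measurable)+
  have "char (distr M borel (\<lambda>\<omega>. \<Sum>j\<in>B. \<zeta> j \<omega>)) t = char (distr M borel (\<zeta> 0)) t ^ card B" for B t
  proof -
    have "char (distr M borel (\<lambda>\<omega>. \<Sum>j\<in>B. \<zeta> j \<omega>)) t = (\<Prod>j\<in>B. char (distr M borel (\<zeta> j)) t)"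
      by (rule char_distr_sum[OF indep_vars_subset[OF ind]]) simp
    also have "\<dots> = (\<Prod>j\<in>B. char (distr M borel (\<zeta> 0)) t)"
      by (rule prod.cong[OF refl], subst same, rule refl)
    finally show ?thesis by simp
  qed
  from this[of A] this[of "{..<card A}"]
  show "char (distr M borel (\<lambda>\<omega>. \<Sum>j\<in>A. \<zeta> j \<omega>)) = char (distr M borel (partial_sum (card A)))"
    unfolding partial_sum_def by auto
qed

theorem block_sums_converge:
  fixes H :: "(nat \<Rightarrow> real) \<Rightarrow> real"
  assumes v: "v > 0" and H: "continuous_on UNIV H" "\<And>y. \<bar>H y\<bar> \<le> C"
    and cut: "\<And>y y'. (\<And>i. i < 2^k \<Longrightarrow> y i = y' i) \<Longrightarrow> H y = H y'"
  shows "(\<lambda>n. expectation (\<lambda>\<omega>. H (\<lambda>i. block_sum n (2^k) i \<omega>))) \<longlonglongrightarrow>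
    (\<integral>x. H (\<lambda>i. sqrt v * (haar k i x / sqrt (2^k))) \<partial>white_noise)"
proof -
  define K where "K = (2::nat)^k"
  have K: "K \<ge> 1" "real K > 0" by (auto simp: K_def)
  have Hm: "H \<in> borel_measurable (PiM UNIV (\<lambda>_. borel))"
    using borel_measurable_continuous_onI[OF H(1)] by (simp add: measurable_cong_sets[OF sets_PiM_equal_borel refl])
  define \<mu> where "\<mu> L = distr M borel (\<lambda>\<omega>. partial_sum L \<omega> / sqrt (real L * (sqrt v)\<^sup>2))" for L
  have "weak_conv_m (\<lambda>n. distr M borel (\<lambda>x. (\<Sum>i<n. \<zeta> i x) / sqrt (real n * (sqrt v)\<^sup>2))) std_normal"
    by (rule central_limit_theorem_zero_mean[OF ind mean _ sq]) (use v mean var same in auto)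
  then have "weak_conv_m \<mu> std_normal" unfolding \<mu>_def[abs_def] partial_sum_def .
  moreover have "real_distribution (\<mu> L)" for L unfolding \<mu>_def by (rule real_distribution_distr) measurable
  ultimately obtain \<Omega> :: "real measure" and Ys Y where \<Omega>: "prob_space \<Omega>"
    and Ys: "\<And>n. Ys n \<in> \<Omega> \<rightarrow>\<^sub>M borel" "\<And>n. distr \<Omega> borel (Ys n) = \<mu> n"
    and Y: "Y \<in> \<Omega> \<rightarrow>\<^sub>M lborel" "distr \<Omega> borel Y = std_normal"
    and lim: "\<And>x. x \<in> space \<Omega> \<Longrightarrow> (\<lambda>n. Ys n x) \<longlonglongrightarrow> Y x"
    using Skorohod[OF _ real_dist_normal_dist, of \<mu>] by blast
  have Ym: "Y \<in> \<Omega> \<rightarrow>\<^sub>M borel" using Y(1) by (simp add: measurable_cong_sets[OF refl sets_lborel])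
  define L where "L n i = n * Suc i div K - n * i div K" for n i
  define c where "c n i = sqrt (real (L n i) * v / real n)" for n i
  let ?P = "PiM {..<K} (\<lambda>_. \<Omega>)"
  interpret P: prob_space ?P by (rule prob_space_PiM) (rule \<Omega>)
  have L_lim: "(\<lambda>n. real (L n i) / real n) \<longlonglongrightarrow> 1 / real K" for i
  proof -
    have Leq: "real (L n i) / real n = real (n * Suc i div K) / real n - real (n * i div K) / real n" for n
    proof -
      have "n * i div K \<le> n * Suc i div K" by (intro div_le_mono mult_le_mono) auto
      then show ?thesis by (simp add: L_def of_nat_diff diff_divide_distrib)
    qed
    have "(\<lambda>n. real (n * Suc i div K) / real n - real (n * i div K) / real n) \<longlonglongrightarrow> real (Suc i) / real K - real i / real K"
      by (intro tendsto_diff of_nat_div_tendsto K)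
    also have "real (Suc i) / real K - real i / real K = 1 / real K" by (simp add: diff_divide_distrib[symmetric])
    finally show ?thesis unfolding Leq .
  qed
  have L_top: "filterlim (\<lambda>n. L n i) at_top sequentially" for i
  proof -
    have "filterlim (\<lambda>n. real (L n i) / real n * real n) at_top sequentially"
      by (rule filterlim_tendsto_pos_mult_at_top[OF L_lim _ filterlim_real_sequentially]) (use K in simp)
    moreover have "\<forall>\<^sub>F n in sequentially. real (L n i) / real n * real n = real (L n i)"
      using eventually_gt_at_top[of 0] by eventually_elim simp
    ultimately have "filterlim (\<lambda>n. real (L n i)) at_top sequentially"
      by (simp add: filterlim_cong[OF refl refl])
    then show ?thesis by (simp add: filterlim_sequentially_iff_filterlim_real)
  qed
  have c_lim: "(\<lambda>n. c n i) \<longlonglongrightarrow> sqrt v / sqrt (real K)" for i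
  proof -
    have "(\<lambda>n. sqrt (real (L n i) / real n * v)) \<longlonglongrightarrow> sqrt (1 / real K * v)"
      by (intro tendsto_intros L_lim)
    then show ?thesis by (simp add: c_def real_sqrt_divide)
  qed
  have E1: "expectation (\<lambda>\<omega>. H (\<lambda>i. block_sum n K i \<omega>)) = (\<integral>\<omega>. H (\<lambda>i. c n i * Ys (L n i) (\<omega> i)) \<partial>?P)" if n: "n > 0" for n
  proof (rule indep_vars_expectation_cong[OF prob_space_axioms P.prob_space_axioms K(1) indep_block_sums])
    show "P.indep_vars (\<lambda>_. borel) (\<lambda>i \<omega>. c n i * Ys (L n i) (\<omega> i)) {..<K}"
      by (rule indep_vars_PiM_functions(1)[OF \<Omega> K(1)]) (use Ys(1) in measurable)
    fix i assume i: "i < K"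
    have m: "n * i div K \<le> n * Suc i div K" by (intro div_le_mono mult_le_mono) auto
    have "distr ?P borel (\<lambda>\<omega>. c n i * Ys (L n i) (\<omega> i)) = distr \<Omega> borel (\<lambda>u. c n i * Ys (L n i) u)"
      by (rule indep_vars_PiM_functions(2)[OF \<Omega> K(1) _ i, where g = "\<lambda>i u. c n i * Ys (L n i) u"]) (use Ys(1) in measurable)
    also have "\<dots> = distr (distr \<Omega> borel (Ys (L n i))) borel (\<lambda>u. c n i * u)"
      using Ys(1) by (subst distr_distr) (auto simp: comp_def)
    also have "\<dots> = distr M borel (\<lambda>\<omega>. c n i * (partial_sum (L n i) \<omega> / sqrt (real (L n i) * (sqrt v)\<^sup>2)))"
      unfolding Ys(2) \<mu>_def by (subst distr_distr) (auto simp: comp_def)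
    also have "\<dots> = distr M borel (\<lambda>\<omega>. partial_sum (L n i) \<omega> / sqrt n)"
    proof (rule distr_cong[OF refl refl])
      fix \<omega>
      show "c n i * (partial_sum (L n i) \<omega> / sqrt (real (L n i) * (sqrt v)\<^sup>2)) = partial_sum (L n i) \<omega> / sqrt n"
        using v by (cases "L n i = 0") (simp_all add: c_def partial_sum_def real_sqrt_divide)
    qed
    also have "\<dots> = distr (distr M borel (partial_sum (L n i))) borel (\<lambda>u. u / sqrt n)"
      by (subst distr_distr) (auto simp: comp_def)
    also have "distr M borel (partial_sum (L n i)) = distr M borel (\<lambda>\<omega>. \<Sum>j\<in>{n * i div K..<n * Suc i div K}. \<zeta> j \<omega>)"
      using sum_law_card[of "{n * i div K..<n * Suc i div K}"] by (simp add: L_def)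
    also have "distr \<dots> borel (\<lambda>u. u / sqrt n) = distr M borel (block_sum n K i)"
      by (subst distr_distr) (auto simp: comp_def block_sum_eq[abs_def])
    finally show "distr M borel (block_sum n K i) = distr ?P borel (\<lambda>\<omega>. c n i * Ys (L n i) (\<omega> i))" ..
  qed (rule Hm, rule cut, simp add: K_def)
  have lawY: "distr \<Omega> borel (\<lambda>u. sqrt v / sqrt (real K) * Y u) = distr white_noise borel (\<lambda>x. sqrt v * (haar k i x / sqrt (2^k)))" if "i < K" for i
  proof -
    have "distr \<Omega> borel (\<lambda>u. sqrt v / sqrt (real K) * Y u) = distr (distr \<Omega> borel Y) borel (\<lambda>u. sqrt v / sqrt (real K) * u)"
      using Ym by (subst distr_distr) (auto simp: comp_def)
    also have "distr \<Omega> borel Y = distr white_noise borel (haar k i)"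
      using iid_haar[of k "2^k"] that Y(2) by (simp add: iid_std_normal_def K_def)
    also have "distr (distr white_noise borel (haar k i)) borel (\<lambda>u. sqrt v / sqrt (real K) * u) =
      distr white_noise borel (\<lambda>x. sqrt v * (haar k i x / sqrt (2^k)))"
      by (subst distr_distr) (auto simp: comp_def K_def)
    finally show ?thesis .
  qed
  interpret W: prob_space white_noise by (rule prob_space_white_noise)
  have E2: "(\<integral>\<omega>. H (\<lambda>i. sqrt v / sqrt (real K) * Y (\<omega> i)) \<partial>?P) = (\<integral>x. H (\<lambda>i. sqrt v * (haar k i x / sqrt (2^k))) \<partial>white_noise)"
  proof (rule indep_vars_expectation_cong[OF P.prob_space_axioms prob_space_white_noise K(1),
        where X = "\<lambda>i \<omega>. sqrt v / sqrt (real K) * Y (\<omega> i)" and X' = "\<lambda>i x. sqrt v * (haar k i x / sqrt (2^k))"])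
    show "P.indep_vars (\<lambda>_. borel) (\<lambda>i \<omega>. sqrt v / sqrt (real K) * Y (\<omega> i)) {..<K}"
      by (rule indep_vars_PiM_functions(1)[OF \<Omega> K(1)]) (use Ym in measurable)
    have "W.indep_vars (\<lambda>_. borel) (haar k) {..<K}" using iid_haar[of k K] by (simp add: iid_std_normal_def K_def)
    then show "W.indep_vars (\<lambda>_. borel) (\<lambda>i x. sqrt v * (haar k i x / sqrt (2^k))) {..<K}"
      by (rule W.indep_vars_compose2[where Y = "\<lambda>i x. sqrt v * (x / sqrt (2^k))"]) measurable
    fix i assume i: "i < K"
    have "distr ?P borel (\<lambda>\<omega>. sqrt v / sqrt (real K) * Y (\<omega> i)) = distr \<Omega> borel (\<lambda>u. sqrt v / sqrt (real K) * Y u)"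
      by (rule indep_vars_PiM_functions(2)[OF \<Omega> K(1) _ i, where g = "\<lambda>i u. sqrt v / sqrt (real K) * Y u"]) (use Ym in measurable)
    then show "distr ?P borel (\<lambda>\<omega>. sqrt v / sqrt (real K) * Y (\<omega> i)) = distr white_noise borel (\<lambda>x. sqrt v * (haar k i x / sqrt (2^k)))"
      using lawY[OF i] by simp
  qed (rule Hm, rule cut, simp add: K_def)
  have coordm: "(\<lambda>\<omega> i. if i < K then g i (\<omega> i) else 0) \<in> ?P \<rightarrow>\<^sub>M PiM UNIV (\<lambda>_. borel)"
    if "\<And>i. g i \<in> borel_measurable \<Omega>" for g :: "nat \<Rightarrow> real \<Rightarrow> real"
  proof (rule measurable_PiM_single')
    show "(\<lambda>\<omega>. if i < K then g i (\<omega> i) else 0) \<in> borel_measurable ?P" for i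
    proof (cases "i < K")
      case True
      then have "(\<lambda>\<omega>. \<omega> i) \<in> ?P \<rightarrow>\<^sub>M \<Omega>" by (intro measurable_component_singleton) simp
      from measurable_compose[OF this that[of i]] True show ?thesis by simp
    qed simp
  qed (auto simp: space_PiM)
  have cutH: "H y = H (\<lambda>i. if i < K then y i else 0)" for y by (rule cut) (simp add: K_def)
  have "(\<lambda>n. \<integral>\<omega>. H (\<lambda>i. if i < K then c n i * Ys (L n i) (\<omega> i) else 0) \<partial>?P) \<longlonglongrightarrow>
     (\<integral>\<omega>. H (\<lambda>i. if i < K then sqrt v / sqrt (real K) * Y (\<omega> i) else 0) \<partial>?P)"
  proof (rule integral_dominated_convergence[where w = "\<lambda>_. C"])
    have "(\<lambda>\<omega> i. if i < K then sqrt v / sqrt (real K) * Y (\<omega> i) else 0) \<in> ?P \<rightarrow>\<^sub>M PiM UNIV (\<lambda>_. borel)"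
      by (rule coordm[of "\<lambda>i u. sqrt v / sqrt (real K) * Y u"]) (use Ym in measurable)
    from measurable_compose[OF this Hm]
    show "(\<lambda>\<omega>. H (\<lambda>i. if i < K then sqrt v / sqrt (real K) * Y (\<omega> i) else 0)) \<in> borel_measurable ?P" .
    have "(\<lambda>\<omega> i. if i < K then c n i * Ys (L n i) (\<omega> i) else 0) \<in> ?P \<rightarrow>\<^sub>M PiM UNIV (\<lambda>_. borel)" for n
      by (rule coordm[of "\<lambda>i u. c n i * Ys (L n i) u"]) (use Ys(1) in measurable)
    from measurable_compose[OF this Hm]
    show "(\<lambda>\<omega>. H (\<lambda>i. if i < K then c n i * Ys (L n i) (\<omega> i) else 0)) \<in> borel_measurable ?P" for n .
    show "AE \<omega> in ?P. (\<lambda>n. H (\<lambda>i. if i < K then c n i * Ys (L n i) (\<omega> i) else 0)) \<longlonglongrightarrow>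
        H (\<lambda>i. if i < K then sqrt v / sqrt (real K) * Y (\<omega> i) else 0)"
    proof (rule AE_I2)
      fix \<omega> assume \<omega>: "\<omega> \<in> space ?P"
      have "(\<lambda>n i. if i < K then c n i * Ys (L n i) (\<omega> i) else 0) \<longlonglongrightarrow> (\<lambda>i. if i < K then sqrt v / sqrt (real K) * Y (\<omega> i) else 0)"
      proof (rule tendsto_fun_real)
        fix i
        show "(\<lambda>n. if i < K then c n i * Ys (L n i) (\<omega> i) else 0) \<longlonglongrightarrow> (if i < K then sqrt v / sqrt (real K) * Y (\<omega> i) else 0)"
        proof (cases "i < K")
          case True
          then have "\<omega> i \<in> space \<Omega>" using \<omega> by (auto simp: space_PiM)
          from tendsto_mult[OF c_lim[of i] filterlim_compose[OF lim[OF this] L_top[of i]]] True show ?thesis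
            by simp
        qed simp
      qed
      with continuous_on_tendsto_compose[OF H(1) this]
      show "(\<lambda>n. H (\<lambda>i. if i < K then c n i * Ys (L n i) (\<omega> i) else 0)) \<longlonglongrightarrow>
        H (\<lambda>i. if i < K then sqrt v / sqrt (real K) * Y (\<omega> i) else 0)" by simp
    qed
  qed (use H(2) in auto)
  then have conv: "(\<lambda>n. \<integral>\<omega>. H (\<lambda>i. c n i * Ys (L n i) (\<omega> i)) \<partial>?P) \<longlonglongrightarrow> (\<integral>\<omega>. H (\<lambda>i. sqrt v / sqrt (real K) * Y (\<omega> i)) \<partial>?P)"
    by (simp only: cutH[symmetric])
  have "\<forall>\<^sub>F n in sequentially. (\<integral>\<omega>. H (\<lambda>i. c n i * Ys (L n i) (\<omega> i)) \<partial>?P) = expectation (\<lambda>\<omega>. H (\<lambda>i. block_sum n K i \<omega>))"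
    using eventually_gt_at_top[of 0] by eventually_elim (simp add: E1)
  from tendsto_cong[OF this, THEN iffD1, OF conv] show ?thesis unfolding E2 unfolding K_def .
qed

end

section \<open>Approximation by block sums\<close>

definition weighted_increments :: "nat \<Rightarrow> (nat \<Rightarrow> real) \<Rightarrow> (real \<Rightarrow> real) \<Rightarrow> real" where
  "weighted_increments n s f = (\<Sum>j<n. f (real (Suc j) / real n) * (s (Suc j) - s j))"

lemma powr_small:
  fixes C \<theta> :: real
  assumes "C > 0" "\<theta> > 0" "b > 0"
  shows "\<exists>\<epsilon>>0. \<epsilon> \<le> 1 \<and> C * \<epsilon> powr \<theta> \<le> b"
proof -
  define x where "x = (b / C) powr (1 / \<theta>)"
  have x: "x > 0" using assms by (simp add: x_def)
  have "(min 1 x) powr \<theta> \<le> x powr \<theta>" using assms x by (intro powr_mono2) auto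
  also have "\<dots> = b / C" using assms by (simp add: x_def powr_powr)
  finally have "C * (min 1 x) powr \<theta> \<le> b" using assms by (simp add: pos_le_divide_eq mult.commute)
  then show ?thesis using x by (intro exI[of _ "min 1 x"]) auto
qed

definition comparable ::
    "'a measure \<Rightarrow> real \<Rightarrow> nat \<Rightarrow> ('a \<Rightarrow> nat \<Rightarrow> real) \<Rightarrow> ('a \<Rightarrow> nat \<Rightarrow> real) \<Rightarrow> real \<Rightarrow> real \<Rightarrow> bool" where
  "comparable M q n s s' \<epsilon> e \<longleftrightarrow> (\<exists>A\<in>sets M. measure M A \<le> e \<and>
     (\<forall>\<omega>\<in>space M - A. (\<forall>j\<le>n. \<bar>s \<omega> j - s' \<omega> j\<bar> \<le> \<epsilon>) \<longrightarrow>
       (\<forall>\<delta>. \<forall>f\<in>regressors q \<delta>. \<bar>weighted_increments n (s \<omega>) f - weighted_increments n (s' \<omega>) f\<bar> \<le> e)))"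

lemma comparison_event:
  assumes M: "prob_space M" and q: "1 \<le> q" "q < 2" and v: "0 \<le> v" and e: "e > 0"
  shows "\<exists>\<epsilon>>0. \<forall>n\<ge>1. \<forall>s s'. energy_bounded M s n v \<and> energy_bounded M s' n v \<and> (\<forall>\<omega>. s \<omega> 0 = 0 \<and> s' \<omega> 0 = 0) \<longrightarrow>
    comparable M q n s s' \<epsilon> e"
proof -
  interpret prob_space M by fact
  define C where "C = 7 + 6 * v + 2 * chain_const q v"
  have C: "C > 0" using v chain_const_pos[OF q v] by (simp add: C_def)
  obtain \<epsilon> where \<epsilon>: "\<epsilon> > 0" "\<epsilon> \<le> 1" "C * \<epsilon> powr (2/q - 1) \<le> e * e"
    using powr_small[OF C, of "2/q - 1" "e * e"] q e by (auto simp: field_simps)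
  show ?thesis
  proof (intro exI[of _ \<epsilon>] conjI allI impI \<epsilon>(1))
    fix n :: nat and s s' assume n: "1 \<le> n"
      and "energy_bounded M s n v \<and> energy_bounded M s' n v \<and> (\<forall>\<omega>. s \<omega> 0 = 0 \<and> s' \<omega> 0 = 0)"
    then have s: "energy_bounded M s n v" "energy_bounded M s' n v" and s0: "\<And>\<omega>. s \<omega> 0 = 0" "\<And>\<omega>. s' \<omega> 0 = 0" by auto
    let ?X = "\<lambda>\<omega>. comparison_bound q \<epsilon> n (s \<omega>) (s' \<omega>)"
    note X = comparison_bound_expectation[OF s q \<epsilon>(1,2) M]
    have [measurable]: "?X \<in> borel_measurable M" using X(1) by auto
    have X0: "0 \<le> ?X \<omega>" for \<omega>
      using \<epsilon> chain_bound_nonneg[OF \<epsilon>(1)] energy_nonneg unfolding comparison_bound_def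
      by (intro add_nonneg_nonneg mult_nonneg_nonneg) auto
    define A where "A = {\<omega>\<in>space M. e \<le> ?X \<omega>}"
    have A: "A \<in> sets M" unfolding A_def by measurable
    have "measure M A \<le> C * \<epsilon> powr (2/q - 1) / e"
      by (rule markov_on_event[OF X(1) X0 _ e A]) (use X(2) in \<open>auto simp: C_def A_def\<close>)
    also have "\<dots> \<le> e" using \<epsilon>(3) e by (simp add: divide_le_eq)
    finally have PA: "measure M A \<le> e" .
    show "comparable M q n s s' \<epsilon> e"
      unfolding comparable_def
    proof (intro bexI[OF _ A] conjI PA ballI allI impI)
      fix \<omega> \<delta> f assume \<omega>: "\<omega> \<in> space M - A" and cl: "\<forall>j\<le>n. \<bar>s \<omega> j - s' \<omega> j\<bar> \<le> \<epsilon>" and f: "f \<in> regressors q \<delta>"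
      have "\<bar>weighted_increments n (s \<omega>) f - weighted_increments n (s' \<omega>) f\<bar> \<le> ?X \<omega>"
        unfolding weighted_increments_def
        by (rule weighted_increments_comparison[OF regressors_normed_variation[OF f q(1) n] q(1) n \<epsilon>(1,2), where s = "s \<omega>" and s' = "s' \<omega>"]) (use cl s0 in auto)
      also have "\<dots> \<le> e" using \<omega> by (auto simp: A_def)
      finally show "\<bar>weighted_increments n (s \<omega>) f - weighted_increments n (s' \<omega>) f\<bar> \<le> e" .
    qed
  qed
qed

lemma sum_div_collapse:
  fixes g S :: "nat \<Rightarrow> real"
  assumes "K \<ge> 1"
  shows "(\<Sum>l<n*K. g (Suc l) * (S (Suc l div K) - S (l div K))) = (\<Sum>j<n. g (K * Suc j) * (S (Suc j) - S j))"
proof (induction n)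
  case (Suc n)
  have "(\<Sum>l<Suc n * K. g (Suc l) * (S (Suc l div K) - S (l div K))) =
    (\<Sum>l<n*K. g (Suc l) * (S (Suc l div K) - S (l div K))) +
    (\<Sum>l\<in>{n*K..<n*K+K}. g (Suc l) * (S (Suc l div K) - S (l div K)))"
    using sum.atLeastLessThan_concat[of 0 "n*K" "n*K+K" "\<lambda>l. g (Suc l) * (S (Suc l div K) - S (l div K))"]
    by (simp add: atLeast0LessThan add.commute)
  also have "(\<Sum>l\<in>{n*K..<n*K+K}. g (Suc l) * (S (Suc l div K) - S (l div K))) =
     (\<Sum>l\<in>{n*K+K-1}. g (Suc l) * (S (Suc l div K) - S (l div K)))"
  proof (rule sum.mono_neutral_right)
    show "\<forall>i\<in>{n*K..<n*K+K} - {n*K+K-1}. g (Suc i) * (S (Suc i div K) - S (i div K)) = 0"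
    proof
      fix i assume "i \<in> {n*K..<n*K+K} - {n*K+K-1}"
      then have "n * K \<le> i" "Suc i < n * K + K" by auto
      then have "i div K = n" "Suc i div K = n"
        by (auto intro!: div_nat_eqI simp: mult.commute)
      then show "g (Suc i) * (S (Suc i div K) - S (i div K)) = 0" by simp
    qed
  qed (use assms in auto)
  also have "\<dots> = g (K * Suc n) * (S (Suc n) - S n)"
  proof -
    have "Suc (n*K+K-1) = K * Suc n" using assms by simp
    moreover have "(n*K+K-1) div K = n" using assms by (auto intro!: div_nat_eqI simp: mult.commute)
    moreover have "K * Suc n div K = Suc n" using assms by simp
    ultimately show ?thesis by simp
  qed
  finally show ?case using Suc by simp
qed simp

context noise
begin

definition scaled_sum :: "nat \<Rightarrow> 'a \<Rightarrow> nat \<Rightarrow> real" where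
  "scaled_sum n \<omega> l = partial_sum l \<omega> / sqrt n"

lemma energy_bounded_scaled_sum_div:
  assumes n: "n \<ge> 1" and \<tau>: "mono \<tau>" "\<tau> 0 = 0" "\<tau> m = n"
  shows "energy_bounded M (\<lambda>\<omega> l. scaled_sum n \<omega> (\<tau> l)) m v"
proof -
  have eq1: "(\<lambda>\<omega> l. scaled_sum n \<omega> (\<tau> l)) = (\<lambda>\<omega> l. (1 / sqrt n) * (\<Sum>i\<in>{\<tau> 0..<\<tau> l}. \<zeta> i \<omega>))"
    by (simp add: fun_eq_iff scaled_sum_def partial_sum_def \<tau>(2) atLeast0LessThan)
  have eq2: "(1 / sqrt n)\<^sup>2 * v * real (\<tau> m - \<tau> 0) = v" using n \<tau> by (simp add: power_divide)
  show ?thesis using energy_bounded_grid[OF \<tau>(1), of "1 / sqrt n" m] unfolding eq1 eq2 .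
qed

lemma energy_bounded_scaled_sum: "n \<ge> 1 \<Longrightarrow> energy_bounded M (scaled_sum n) n v"
  using energy_bounded_scaled_sum_div[of n "\<lambda>l. l" n] by (simp add: mono_def)

lemma scaled_sum_0 [simp]: "scaled_sum n \<omega> 0 = 0"
  by (simp add: scaled_sum_def partial_sum_def)

lemma weighted_increments_scaled_sum:
  "weighted_increments n (scaled_sum n \<omega>) f = (\<Sum>j<n. f (real (Suc j) / real n) * \<zeta> j \<omega>) / sqrt n"
  unfolding weighted_increments_def scaled_sum_def partial_sum_def sum_divide_distrib[of "\<lambda>j. f (real (Suc j) / real n) * \<zeta> j \<omega>"]
  by (intro sum.cong refl) (simp add: add_divide_distrib)

lemma weighted_increments_fine_grid:
  assumes "K \<ge> 1"
  shows "weighted_increments (n*K) (\<lambda>l. scaled_sum n \<omega> (l div K)) f = weighted_increments n (scaled_sum n \<omega>) f"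
proof -
  have "weighted_increments (n*K) (\<lambda>l. scaled_sum n \<omega> (l div K)) f =
    (\<Sum>j<n. f (real (K * Suc j) / real (n*K)) * (scaled_sum n \<omega> (Suc j) - scaled_sum n \<omega> j))"
    unfolding weighted_increments_def
    by (rule sum_div_collapse[OF assms, of "\<lambda>l. f (real l / real (n*K))" "scaled_sum n \<omega>"])
  also have "\<dots> = weighted_increments n (scaled_sum n \<omega>) f"
    unfolding weighted_increments_def
  proof (rule sum.cong[OF refl])
    fix j
    have "real (K * Suc j) / real (n * K) = real (Suc j) / real n" using assms by (simp del: of_nat_Suc mult_Suc_right)
    then show "f (real (K * Suc j) / real (n*K)) * (scaled_sum n \<omega> (Suc j) - scaled_sum n \<omega> j) =
      f (real (Suc j) / real n) * (scaled_sum n \<omega> (Suc j) - scaled_sum n \<omega> j)" by (simp only:)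
  qed
  finally show ?thesis .
qed

lemma weighted_increments_block_grid:
  assumes "n \<ge> 1"
  shows "weighted_increments (n*K) (\<lambda>l. scaled_sum n \<omega> (n * (l div n) div K)) f = (\<Sum>i<K. f (real (Suc i) / real K) * block_sum n K i \<omega>)"
proof -
  have "weighted_increments (n*K) (\<lambda>l. scaled_sum n \<omega> (n * (l div n) div K)) f =
    (\<Sum>l<K*n. f (real (Suc l) / real (n*K)) * (scaled_sum n \<omega> (n * (Suc l div n) div K) - scaled_sum n \<omega> (n * (l div n) div K)))"
    unfolding weighted_increments_def by (simp add: mult.commute[of n K])
  also have "\<dots> = (\<Sum>i<K. f (real (n * Suc i) / real (n*K)) * (scaled_sum n \<omega> (n * Suc i div K) - scaled_sum n \<omega> (n * i div K)))"
    by (rule sum_div_collapse[OF assms, of "\<lambda>l. f (real l / real (n*K))" "\<lambda>i. scaled_sum n \<omega> (n * i div K)"])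
  also have "\<dots> = (\<Sum>i<K. f (real (Suc i) / real K) * block_sum n K i \<omega>)"
  proof (rule sum.cong[OF refl])
    fix i
    have "real (n * Suc i) / real (n * K) = real (Suc i) / real K" using assms by (simp del: of_nat_Suc mult_Suc_right)
    then show "f (real (n * Suc i) / real (n*K)) * (scaled_sum n \<omega> (n * Suc i div K) - scaled_sum n \<omega> (n * i div K)) =
      f (real (Suc i) / real K) * block_sum n K i \<omega>"
      by (simp only: scaled_sum_def block_sum_def diff_divide_distrib)
  qed
  finally show ?thesis .
qed

lemma block_approximation:
  assumes q: "1 \<le> q" "q < 2" and e: "e > 0"
  shows "\<exists>K0\<ge>1. \<forall>K\<ge>K0. \<exists>n0\<ge>1. \<forall>n\<ge>n0. \<exists>A\<in>events. prob A \<le> e \<and> (\<forall>\<omega>\<in>space M - A. \<forall>f\<in>regressors q \<delta>.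
    \<bar>weighted_increments n (scaled_sum n \<omega>) f - (\<Sum>i<K. f (real (Suc i) / real K) * block_sum n K i \<omega>)\<bar> \<le> e)"
proof -
  have e2: "e/2 > 0" using e by simp
  obtain \<epsilon> where \<epsilon>: "\<epsilon> > 0" "\<forall>n\<ge>1. \<forall>s s'. energy_bounded M s n v \<and> energy_bounded M s' n v \<and> (\<forall>\<omega>. s \<omega> 0 = 0 \<and> s' \<omega> 0 = 0) \<longrightarrow>
    comparable M q n s s' \<epsilon> (e/2)"
    using comparison_event[OF prob_space_axioms q v_nonneg e2] by blast
  obtain K0 where K0: "K0 \<ge> 1" "\<And>K. K \<ge> K0 \<Longrightarrow> \<exists>n0\<ge>1. \<forall>n\<ge>n0. prob {\<omega>\<in>space M. \<exists>l\<le>n*K.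
    \<epsilon> \<le> \<bar>partial_sum (l div K) \<omega> / sqrt n - partial_sum (n * (l div n) div K) \<omega> / sqrt n\<bar>} \<le> e/2"
    using block_oscillation[OF \<epsilon>(1) e2] by blast
  show ?thesis
  proof (rule exI[of _ K0], intro conjI allI impI K0(1))
    fix K assume K: "K \<ge> K0"
    then have K1: "K \<ge> 1" using K0(1) by simp
    obtain n0 where n0: "n0 \<ge> 1" "\<And>n. n \<ge> n0 \<Longrightarrow> prob {\<omega>\<in>space M. \<exists>l\<le>n*K.
      \<epsilon> \<le> \<bar>partial_sum (l div K) \<omega> / sqrt n - partial_sum (n * (l div n) div K) \<omega> / sqrt n\<bar>} \<le> e/2"
      using K0(2)[OF K] by blast
    have "\<exists>A\<in>events. prob A \<le> e \<and> (\<forall>\<omega>\<in>space M - A. \<forall>f\<in>regressors q \<delta>.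
      \<bar>weighted_increments n (scaled_sum n \<omega>) f - (\<Sum>i<K. f (real (Suc i) / real K) * block_sum n K i \<omega>)\<bar> \<le> e)" if n: "n \<ge> n0" for n
    proof -
      have n1: "n \<ge> 1" using n n0 by simp
      let ?s = "\<lambda>\<omega> l. scaled_sum n \<omega> (l div K)" and ?s' = "\<lambda>\<omega> l. scaled_sum n \<omega> (n * (l div n) div K)"
      have "energy_bounded M ?s (n*K) v"
        by (rule energy_bounded_scaled_sum_div[OF n1]) (use K1 in \<open>auto simp: mono_def div_le_mono\<close>)
      moreover have "energy_bounded M ?s' (n*K) v"
        by (rule energy_bounded_scaled_sum_div[OF n1]) (use K1 n1 in \<open>auto simp: mono_def div_le_mono\<close>)
      moreover have "n * K \<ge> 1" using n1 K1 by (simp add: Suc_le_eq)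
      moreover have "\<forall>\<omega>. ?s \<omega> 0 = 0 \<and> ?s' \<omega> 0 = 0" by simp
      ultimately have "comparable M q (n*K) ?s ?s' \<epsilon> (e/2)" using \<epsilon>(2) by blast
      then obtain A where A: "A \<in> sets M" "measure M A \<le> e/2"
        "\<forall>\<omega>\<in>space M - A. (\<forall>j\<le>n*K. \<bar>?s \<omega> j - ?s' \<omega> j\<bar> \<le> \<epsilon>) \<longrightarrow>
          (\<forall>\<delta>. \<forall>f\<in>regressors q \<delta>. \<bar>weighted_increments (n*K) (?s \<omega>) f - weighted_increments (n*K) (?s' \<omega>) f\<bar> \<le> e/2)"
        unfolding comparable_def by blast
      define A' where "A' = {\<omega>\<in>space M. \<exists>l\<le>n*K. \<epsilon> \<le> \<bar>partial_sum (l div K) \<omega> / sqrt n - partial_sum (n * (l div n) div K) \<omega> / sqrt n\<bar>}"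
      have A': "A' \<in> sets M" "measure M A' \<le> e/2" using n0(2)[OF n] unfolding A'_def by measurable
      show ?thesis
      proof (intro bexI[of _ "A \<union> A'"] conjI ballI)
        show "prob (A \<union> A') \<le> e" using measure_Un_le[of A M A'] A A' by simp
        fix \<omega> f assume \<omega>: "\<omega> \<in> space M - (A \<union> A')" and f: "f \<in> regressors q \<delta>"
        have "\<forall>j\<le>n*K. \<bar>?s \<omega> j - ?s' \<omega> j\<bar> \<le> \<epsilon>"
        proof (intro allI impI)
          fix l assume "l \<le> n * K"
          then have "\<not> \<epsilon> \<le> \<bar>partial_sum (l div K) \<omega> / sqrt n - partial_sum (n * (l div n) div K) \<omega> / sqrt n\<bar>"
            using \<omega> unfolding A'_def by blast
          then show "\<bar>?s \<omega> l - ?s' \<omega> l\<bar> \<le> \<epsilon>" by (simp add: scaled_sum_def)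
        qed
        then have "\<bar>weighted_increments (n*K) (?s \<omega>) f - weighted_increments (n*K) (?s' \<omega>) f\<bar> \<le> e/2"
          using A(3) \<omega> f by blast
        then show "\<bar>weighted_increments n (scaled_sum n \<omega>) f - (\<Sum>i<K. f (real (Suc i) / real K) * block_sum n K i \<omega>)\<bar> \<le> e"
          unfolding weighted_increments_fine_grid[OF K1] weighted_increments_block_grid[OF n1] using e by linarith
      qed (use A A' in auto)
    qed
    then show "\<exists>n0\<ge>1. \<forall>n\<ge>n0. \<exists>A\<in>events. prob A \<le> e \<and> (\<forall>\<omega>\<in>space M - A. \<forall>f\<in>regressors q \<delta>.
      \<bar>weighted_increments n (scaled_sum n \<omega>) f - (\<Sum>i<K. f (real (Suc i) / real K) * block_sum n K i \<omega>)\<bar> \<le> e)"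
      using n0(1) by blast
  qed
qed

lemma maximum_small:
  assumes \<epsilon>: "\<epsilon> > 0" and e: "e > 0"
  shows "\<exists>n0\<ge>1. \<forall>n\<ge>n0. prob {\<omega>\<in>space M. \<exists>l\<le>n. \<epsilon> * sqrt (real n) < \<bar>\<zeta> l \<omega>\<bar>} \<le> e"
proof -
  have "\<forall>\<^sub>F k in sequentially. tail_moment (real k) < e * \<epsilon>\<^sup>2 / 2"
    by (rule order_tendstoD(2)[OF tail_moment_tendsto]) (use \<epsilon> e in simp)
  then obtain k where k: "tail_moment (real k) < e * \<epsilon>\<^sup>2 / 2" by (auto simp: eventually_sequentially)
  obtain n0 :: nat where n0: "(real k / \<epsilon>)\<^sup>2 \<le> real n0" using real_arch_simple by blast
  show ?thesis
  proof (rule exI[of _ "max 1 n0"], intro conjI allI impI)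
    fix n assume n: "n \<ge> max 1 n0"
    define T where "T = \<epsilon> * sqrt (real n)"
    have T: "T > 0" "T\<^sup>2 = \<epsilon>\<^sup>2 * real n" using n \<epsilon> by (auto simp: T_def power_mult_distrib)
    have kT: "real k \<le> T"
    proof -
      have "(real k / \<epsilon>)\<^sup>2 \<le> real n" using n n0 by linarith
      then have "real k / \<epsilon> \<le> sqrt n" by (rule real_le_rsqrt)
      then show ?thesis using \<epsilon> by (simp add: T_def pos_divide_le_eq mult.commute)
    qed
    have one: "prob {\<omega>\<in>space M. T < \<bar>\<zeta> l \<omega>\<bar>} \<le> tail_moment (real k) / T\<^sup>2" for l
    proof (rule markov_on_event)
      let ?X = "\<lambda>\<omega>. if \<bar>\<zeta> l \<omega>\<bar> \<le> real k then 0 else (\<zeta> l \<omega>)\<^sup>2"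
      show "integrable M ?X" by (rule Bochner_Integration.integrable_bound[OF sq[of l]]) auto
      show "expectation ?X \<le> tail_moment (real k)"
        using expectation_same[of "\<lambda>x. if \<bar>x\<bar> \<le> real k then 0 else x\<^sup>2" l] by (simp add: tail_moment_def)
      fix \<omega> assume "\<omega> \<in> {\<omega>\<in>space M. T < \<bar>\<zeta> l \<omega>\<bar>}"
      then have "T < \<bar>\<zeta> l \<omega>\<bar>" by simp
      then show "T\<^sup>2 \<le> ?X \<omega>" using kT T(1) by (auto simp: abs_le_square_iff[symmetric])
    qed (use zero_less_power[OF T(1), of 2] in auto)
    have "{\<omega>\<in>space M. \<exists>l\<le>n. \<epsilon> * sqrt (real n) < \<bar>\<zeta> l \<omega>\<bar>} = (\<Union>l\<in>{..n}. {\<omega>\<in>space M. T < \<bar>\<zeta> l \<omega>\<bar>})"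
      by (auto simp: T_def)
    then have "prob {\<omega>\<in>space M. \<exists>l\<le>n. \<epsilon> * sqrt (real n) < \<bar>\<zeta> l \<omega>\<bar>} \<le> (\<Sum>l\<in>{..n}. prob {\<omega>\<in>space M. T < \<bar>\<zeta> l \<omega>\<bar>})"
      by (simp only:) (rule measure_UNION_le, auto)
    also have "\<dots> \<le> (\<Sum>l\<in>{..n}. tail_moment (real k) / T\<^sup>2)" by (intro sum_mono one)
    also have "\<dots> = (real n + 1) * tail_moment (real k) / (\<epsilon>\<^sup>2 * real n)" using T by simp
    also have "\<dots> \<le> (2 * real n) * (e * \<epsilon>\<^sup>2 / 2) / (\<epsilon>\<^sup>2 * real n)"
      using n k by (intro divide_right_mono mult_mono) (auto simp: tail_moment_def)
    also have "\<dots> = e" using n \<epsilon> by simp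
    finally show "prob {\<omega>\<in>space M. \<exists>l\<le>n. \<epsilon> * sqrt (real n) < \<bar>\<zeta> l \<omega>\<bar>} \<le> e" .
  qed simp
qed

definition sup_bound :: "real \<Rightarrow> nat \<Rightarrow> 'a \<Rightarrow> real" where
  "sup_bound q n \<omega> = energy 1 (scaled_sum n \<omega>) n + 1 + chain_bound q 1 n (scaled_sum n \<omega>)"

lemma sup_bound:
  assumes q: "1 \<le> q" "q < 2" and n: "n \<ge> 1"
  shows "integrable M (sup_bound q n)" "expectation (sup_bound q n) \<le> v + 1 + chain_const q v"
    "0 \<le> sup_bound q n \<omega>"
    "f \<in> regressors q \<delta> \<Longrightarrow> \<bar>weighted_increments n (scaled_sum n \<omega>) f\<bar> \<le> sup_bound q n \<omega>"
proof -
  show "integrable M (sup_bound q n)" "expectation (sup_bound q n) \<le> v + 1 + chain_const q v"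
    unfolding sup_bound_def[abs_def]
    by (rule weighted_bound_expectation[OF energy_bounded_scaled_sum[OF n] q prob_space_axioms])+
  show "0 \<le> sup_bound q n \<omega>"
    unfolding sup_bound_def by (intro add_nonneg_nonneg energy_nonneg chain_bound_nonneg) auto
  show "\<bar>weighted_increments n (scaled_sum n \<omega>) f\<bar> \<le> sup_bound q n \<omega>" if f: "f \<in> regressors q \<delta>"
    unfolding weighted_increments_def sup_bound_def
    by (rule weighted_increments_bound[OF regressors_normed_variation[OF f q(1) n] q(1) n]) simp
qed

end

section \<open>Short-memory linear processes\<close>

definition negligible_in_prob :: "'a measure \<Rightarrow> 'i set \<Rightarrow> (nat \<Rightarrow> 'a \<Rightarrow> 'i \<Rightarrow> real) \<Rightarrow> bool" where
  "negligible_in_prob M F D \<longleftrightarrow> (\<forall>e>0. \<exists>n0. \<forall>n\<ge>n0. \<exists>A\<in>sets M. measure M A \<le> e \<and> (\<forall>\<omega>\<in>space M - A. \<forall>f\<in>F. \<bar>D n \<omega> f\<bar> \<le> e))"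

lemma negligible_in_probD:
  assumes "negligible_in_prob M F D" "e > 0"
  obtains n0 where "\<forall>n\<ge>n0. \<exists>A\<in>sets M. measure M A \<le> e \<and> (\<forall>\<omega>\<in>space M - A. \<forall>f\<in>F. \<bar>D n \<omega> f\<bar> \<le> e)"
  using assms unfolding negligible_in_prob_def by blast

lemma negligible_in_prob_add:
  assumes D: "negligible_in_prob M F D" and D': "negligible_in_prob M F D'"
  shows "negligible_in_prob M F (\<lambda>n \<omega> f. D n \<omega> f + D' n \<omega> f)"
  unfolding negligible_in_prob_def
proof (intro allI impI)
  fix e :: real assume "e > 0"
  then have e: "e/2 > 0" by simp
  obtain n1 where n1: "\<forall>n\<ge>n1. \<exists>A\<in>sets M. measure M A \<le> e/2 \<and> (\<forall>\<omega>\<in>space M - A. \<forall>f\<in>F. \<bar>D n \<omega> f\<bar> \<le> e/2)"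
    by (rule negligible_in_probD[OF D e])
  obtain n2 where n2: "\<forall>n\<ge>n2. \<exists>A\<in>sets M. measure M A \<le> e/2 \<and> (\<forall>\<omega>\<in>space M - A. \<forall>f\<in>F. \<bar>D' n \<omega> f\<bar> \<le> e/2)"
    by (rule negligible_in_probD[OF D' e])
  show "\<exists>n0. \<forall>n\<ge>n0. \<exists>A\<in>sets M. measure M A \<le> e \<and> (\<forall>\<omega>\<in>space M - A. \<forall>f\<in>F. \<bar>D n \<omega> f + D' n \<omega> f\<bar> \<le> e)"
  proof (intro exI[of _ "max n1 n2"] allI impI)
    fix n assume n: "n \<ge> max n1 n2"
    obtain A where A: "A \<in> sets M" "measure M A \<le> e/2" "\<forall>\<omega>\<in>space M - A. \<forall>f\<in>F. \<bar>D n \<omega> f\<bar> \<le> e/2" using n1 n by auto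
    obtain A' where A': "A' \<in> sets M" "measure M A' \<le> e/2" "\<forall>\<omega>\<in>space M - A'. \<forall>f\<in>F. \<bar>D' n \<omega> f\<bar> \<le> e/2" using n2 n by auto
    show "\<exists>A\<in>sets M. measure M A \<le> e \<and> (\<forall>\<omega>\<in>space M - A. \<forall>f\<in>F. \<bar>D n \<omega> f + D' n \<omega> f\<bar> \<le> e)"
    proof (rule bexI[of _ "A \<union> A'"], intro conjI ballI)
      show "measure M (A \<union> A') \<le> e" using measure_Un_le[OF A(1) A'(1)] A(2) A'(2) by linarith
      fix \<omega> f assume "\<omega> \<in> space M - (A \<union> A')" "f \<in> F"
      then have "\<bar>D n \<omega> f\<bar> \<le> e/2" "\<bar>D' n \<omega> f\<bar> \<le> e/2" using A(3) A'(3) by auto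
      then show "\<bar>D n \<omega> f + D' n \<omega> f\<bar> \<le> e" by linarith
    qed (use A A' in auto)
  qed
qed

lemma negligible_in_prob_scaled_le:
  assumes D: "negligible_in_prob M F D" and c: "c > 0"
    and le: "\<And>n \<omega> f. \<omega> \<in> space M \<Longrightarrow> f \<in> F \<Longrightarrow> \<bar>D' n \<omega> f\<bar> \<le> c * \<bar>D n \<omega> f\<bar>"
  shows "negligible_in_prob M F D'"
  unfolding negligible_in_prob_def
proof (intro allI impI)
  fix e :: real assume e: "e > 0"
  define e' where "e' = min e (e / c)"
  have e': "e' > 0" "e' \<le> e" "c * e' \<le> e"
  proof -
    show "e' > 0" "e' \<le> e" using e c by (auto simp: e'_def)
    have "c * e' \<le> c * (e / c)" using c by (intro mult_left_mono) (auto simp: e'_def)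
    then show "c * e' \<le> e" using c by simp
  qed
  obtain n1 where n1: "\<forall>n\<ge>n1. \<exists>A\<in>sets M. measure M A \<le> e' \<and> (\<forall>\<omega>\<in>space M - A. \<forall>f\<in>F. \<bar>D n \<omega> f\<bar> \<le> e')"
    by (rule negligible_in_probD[OF D e'(1)])
  show "\<exists>n0. \<forall>n\<ge>n0. \<exists>A\<in>sets M. measure M A \<le> e \<and> (\<forall>\<omega>\<in>space M - A. \<forall>f\<in>F. \<bar>D' n \<omega> f\<bar> \<le> e)"
  proof (intro exI[of _ n1] allI impI)
    fix n assume n: "n \<ge> n1"
    obtain A where A: "A \<in> sets M" "measure M A \<le> e'" "\<forall>\<omega>\<in>space M - A. \<forall>f\<in>F. \<bar>D n \<omega> f\<bar> \<le> e'" using n1 n by auto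
    show "\<exists>A\<in>sets M. measure M A \<le> e \<and> (\<forall>\<omega>\<in>space M - A. \<forall>f\<in>F. \<bar>D' n \<omega> f\<bar> \<le> e)"
    proof (rule bexI[OF _ A(1)], intro conjI ballI)
      show "measure M A \<le> e" using A(2) e'(2) by linarith
      fix \<omega> f assume \<omega>: "\<omega> \<in> space M - A" "f \<in> F"
      have "\<bar>D' n \<omega> f\<bar> \<le> c * \<bar>D n \<omega> f\<bar>" using \<omega> by (intro le) auto
      also have "\<dots> \<le> c * e'" using A(3) \<omega> c by (intro mult_left_mono) auto
      also have "\<dots> \<le> e" by (rule e'(3))
      finally show "\<bar>D' n \<omega> f\<bar> \<le> e" .
    qed
  qed
qed

lemma negligible_in_prob_0: "negligible_in_prob M F (\<lambda>n \<omega> f. 0)"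
  unfolding negligible_in_prob_def
proof (intro allI impI exI[of _ 0])
  fix e :: real assume "e > 0"
  then show "\<exists>A\<in>sets M. measure M A \<le> e \<and> (\<forall>\<omega>\<in>space M - A. \<forall>f\<in>F. \<bar>0::real\<bar> \<le> e)"
    by (intro bexI[of _ "{}"]) auto
qed

lemma negligible_in_prob_sum:
  fixes N :: nat
  assumes "\<And>m. negligible_in_prob M F (D m)"
  shows "negligible_in_prob M F (\<lambda>n \<omega> f. \<Sum>m<N. a m * D m n \<omega> f)"
proof (induction N)
  case 0
  show ?case using negligible_in_prob_0 by simp
next
  case (Suc N)
  have "negligible_in_prob M F (\<lambda>n \<omega> f. a N * D N n \<omega> f)"
    by (rule negligible_in_prob_scaled_le[OF assms[of N], of "\<bar>a N\<bar> + 1"]) (auto simp: abs_mult intro!: mult_right_mono)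
  from negligible_in_prob_add[OF Suc this] show ?case by simp
qed

locale short_memory = prob_space M for M :: "'a measure" +
  fixes \<eta> :: "int \<Rightarrow> 'a \<Rightarrow> real" and \<psi> :: "nat \<Rightarrow> real" and v q \<delta> :: real
  assumes ind: "indep_vars (\<lambda>_. borel) \<eta> UNIV"
    and same: "\<And>j. distr M borel (\<eta> j) = distr M borel (\<eta> 1)"
    and sq: "integrable M (\<lambda>\<omega>. (\<eta> 1 \<omega>)\<^sup>2)"
    and mean: "expectation (\<eta> 1) = 0"
    and var: "expectation (\<lambda>\<omega>. (\<eta> 1 \<omega>)\<^sup>2) = v"
    and \<psi>: "summable (\<lambda>j. \<bar>\<psi> j\<bar>)"
    and q: "1 \<le> q" "q < 2" and \<delta>: "0 < \<delta>"
begin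

lemma noise_shift: "noise M (\<lambda>i. \<eta> (int i + 1 - int m)) v"
proof
  have rv: "\<eta> j \<in> borel_measurable M" for j using ind by (auto simp: indep_vars_def)
  have "indep_vars (\<lambda>_. borel) (\<lambda>i \<omega>. \<Sum>j\<in>{int i + 1 - int m}. \<eta> j \<omega>) (UNIV :: nat set)"
    by (rule indep_vars_block_sums[OF ind]) (auto simp: disjoint_family_on_def)
  then show "indep_vars (\<lambda>_. borel) (\<lambda>i. \<eta> (int i + 1 - int m)) (UNIV :: nat set)" by simp
  show "distr M borel (\<eta> (int i + 1 - int m)) = distr M borel (\<eta> (int 0 + 1 - int m))" for i
    using same[of "int i + 1 - int m"] same[of "int 0 + 1 - int m"] by simp
  have E: "expectation (\<lambda>\<omega>. h (\<eta> j \<omega>)) = expectation (\<lambda>\<omega>. h (\<eta> 1 \<omega>))"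
    "integrable M (\<lambda>\<omega>. h (\<eta> j \<omega>)) \<longleftrightarrow> integrable M (\<lambda>\<omega>. h (\<eta> 1 \<omega>))"
    if "h \<in> borel_measurable borel" for h :: "real \<Rightarrow> real" and j
    using integral_distr[OF rv that, of j] integral_distr[OF rv that, of 1] same[of j]
      integrable_distr_eq[OF rv that, of j] integrable_distr_eq[OF rv that, of 1] by simp_all
  show "integrable M (\<lambda>\<omega>. (\<eta> (int 0 + 1 - int m) \<omega>)\<^sup>2)" using E(2)[of "\<lambda>x. x\<^sup>2"] sq by simp
  show "expectation (\<eta> (int 0 + 1 - int m)) = 0" using E(1)[of "\<lambda>x. x"] mean by simp
  show "expectation (\<lambda>\<omega>. (\<eta> (int 0 + 1 - int m) \<omega>)\<^sup>2) = v" using E(1)[of "\<lambda>x. x\<^sup>2"] var by simp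
qed

sublocale shift: noise M "\<lambda>i. \<eta> (int i + 1 - int m)" v for m :: nat
  by (rule noise_shift)

abbreviation shift_sum :: "nat \<Rightarrow> nat \<Rightarrow> 'a \<Rightarrow> (real \<Rightarrow> real) \<Rightarrow> real" where
  "shift_sum m n \<omega> f \<equiv> weighted_increments n (shift.scaled_sum m n \<omega>) f"

definition weighted_process :: "nat \<Rightarrow> 'a \<Rightarrow> (real \<Rightarrow> real) \<Rightarrow> real" where
  "weighted_process n \<omega> f = (\<Sum>j<n. f (real (Suc j) / real n) * linear_process \<psi> \<eta> (int (Suc j)) \<omega>) / sqrt n"

lemma partial_sum_shift_diff:
  "shift.partial_sum (Suc m) l \<omega> - shift.partial_sum m l \<omega> = \<eta> (- int m) \<omega> - \<eta> (int l - int m) \<omega>"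
  unfolding shift.partial_sum_def by (induction l) (simp_all add: algebra_simps)

lemma shift_one_negligible:
  "negligible_in_prob M (regressors q \<delta>) (\<lambda>n \<omega> f. shift_sum (Suc m) n \<omega> f - shift_sum m n \<omega> f)"
  unfolding negligible_in_prob_def
proof (intro allI impI)
  fix e :: real assume "e > 0"
  then have e: "e/2 > 0" by simp
  obtain \<epsilon> where \<epsilon>: "\<epsilon> > 0" "\<forall>n\<ge>1. \<forall>s s'. energy_bounded M s n v \<and> energy_bounded M s' n v \<and> (\<forall>\<omega>. s \<omega> 0 = 0 \<and> s' \<omega> 0 = 0) \<longrightarrow>
    comparable M q n s s' \<epsilon> (e/2)"
    using comparison_event[OF prob_space_axioms q shift.v_nonneg e] by blast
  have "\<epsilon>/2 > 0" using \<epsilon> by simp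
  then obtain n0 where n0: "n0 \<ge> 1" "\<forall>n\<ge>n0. prob {\<omega>\<in>space M. \<exists>l\<le>n. \<epsilon>/2 * sqrt (real n) < \<bar>\<eta> (int l + 1 - int (Suc m)) \<omega>\<bar>} \<le> e/2"
    using shift.maximum_small[of "\<epsilon>/2" "e/2" "Suc m"] e by blast
  show "\<exists>n0. \<forall>n\<ge>n0. \<exists>A\<in>sets M. measure M A \<le> e \<and> (\<forall>\<omega>\<in>space M - A. \<forall>f\<in>regressors q \<delta>. \<bar>shift_sum (Suc m) n \<omega> f - shift_sum m n \<omega> f\<bar> \<le> e)"
  proof (intro exI[of _ n0] allI impI)
    fix n assume n: "n \<ge> n0"
    then have n1: "n \<ge> 1" using n0 by simp
    have "comparable M q n (shift.scaled_sum (Suc m) n) (shift.scaled_sum m n) \<epsilon> (e/2)"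
      using \<epsilon>(2) n1 shift.energy_bounded_scaled_sum[OF n1] shift.scaled_sum_0 by blast
    then obtain A where A: "A \<in> sets M" "measure M A \<le> e/2"
      "\<forall>\<omega>\<in>space M - A. (\<forall>j\<le>n. \<bar>shift.scaled_sum (Suc m) n \<omega> j - shift.scaled_sum m n \<omega> j\<bar> \<le> \<epsilon>) \<longrightarrow>
          (\<forall>\<delta>. \<forall>f\<in>regressors q \<delta>. \<bar>shift_sum (Suc m) n \<omega> f - shift_sum m n \<omega> f\<bar> \<le> e/2)"
      unfolding comparable_def by blast
    define A' where "A' = {\<omega>\<in>space M. \<exists>l\<le>n. \<epsilon>/2 * sqrt (real n) < \<bar>\<eta> (int l + 1 - int (Suc m)) \<omega>\<bar>}"
    have A': "A' \<in> sets M" "measure M A' \<le> e/2"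
      using n0(2) n shift.rv[of "Suc m"] unfolding A'_def by (measurable, blast)
    show "\<exists>A\<in>sets M. measure M A \<le> e \<and> (\<forall>\<omega>\<in>space M - A. \<forall>f\<in>regressors q \<delta>. \<bar>shift_sum (Suc m) n \<omega> f - shift_sum m n \<omega> f\<bar> \<le> e)"
    proof (rule bexI[of _ "A \<union> A'"], intro conjI ballI)
      show "measure M (A \<union> A') \<le> e" using measure_Un_le[OF A(1) A'(1)] A(2) A'(2) by linarith
      fix \<omega> f assume \<omega>: "\<omega> \<in> space M - (A \<union> A')" and f: "f \<in> regressors q \<delta>"
      have small: "2 * \<bar>\<eta> (int l - int m) \<omega>\<bar> \<le> \<epsilon> * sqrt (real n)" if "l \<le> n" for l
      proof -
        have "\<not> (\<epsilon>/2 * sqrt (real n) < \<bar>\<eta> (int l + 1 - int (Suc m)) \<omega>\<bar>)" using \<omega> that unfolding A'_def by blast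
        then show ?thesis by simp
      qed
      have "\<forall>l\<le>n. \<bar>shift.scaled_sum (Suc m) n \<omega> l - shift.scaled_sum m n \<omega> l\<bar> \<le> \<epsilon>"
      proof (intro allI impI)
        fix l assume l: "l \<le> n"
        have "\<bar>\<eta> (- int m) \<omega> - \<eta> (int l - int m) \<omega>\<bar> \<le> \<epsilon> * sqrt (real n)"
        proof -
          have "2 * \<bar>\<eta> (- int m) \<omega>\<bar> \<le> \<epsilon> * sqrt (real n)" using small[of 0] by simp
          then show ?thesis using small[OF l] by linarith
        qed
        moreover have "shift.scaled_sum (Suc m) n \<omega> l - shift.scaled_sum m n \<omega> l = (\<eta> (- int m) \<omega> - \<eta> (int l - int m) \<omega>) / sqrt (real n)"
          unfolding shift.scaled_sum_def partial_sum_shift_diff[symmetric] by (simp add: diff_divide_distrib)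
        ultimately show "\<bar>shift.scaled_sum (Suc m) n \<omega> l - shift.scaled_sum m n \<omega> l\<bar> \<le> \<epsilon>"
          using n1 by (simp add: pos_divide_le_eq)
      qed
      then have "\<bar>shift_sum (Suc m) n \<omega> f - shift_sum m n \<omega> f\<bar> \<le> e/2" using A(3) \<omega> f by blast
      then show "\<bar>shift_sum (Suc m) n \<omega> f - shift_sum m n \<omega> f\<bar> \<le> e" using e by linarith
    qed (use A A' in auto)
  qed
qed

lemma shift_negligible:
  "negligible_in_prob M (regressors q \<delta>) (\<lambda>n \<omega> f. shift_sum m n \<omega> f - shift_sum 0 n \<omega> f)"
proof (induction m)
  case 0
  show ?case using negligible_in_prob_0 by simp
next
  case (Suc m)
  from negligible_in_prob_add[OF shift_one_negligible[of m] Suc] show ?case by simp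
qed

definition sup_bound_const :: real where "sup_bound_const = v + 1 + chain_const q v"

lemma sup_bound_const_pos: "sup_bound_const > 0"
  using shift.v_nonneg chain_const_pos[OF q shift.v_nonneg] by (simp add: sup_bound_const_def)

lemma AE_series_summable: "AE \<omega> in M. \<forall>j. summable (\<lambda>m. \<bar>\<psi> m * \<eta> (int (Suc j) - int m) \<omega>\<bar>)"
  unfolding AE_all_countable
proof
  fix j
  define c where "c = expectation (\<lambda>\<omega>. \<bar>\<eta> 1 \<omega>\<bar>)"
  have int: "integrable M (\<eta> (int (Suc j) - int m))" for m
    using shift.integrable_noise[where m = m and i = j] by (simp add: algebra_simps)
  have E: "expectation (\<lambda>\<omega>. \<bar>\<eta> (int (Suc j) - int m) \<omega>\<bar>) = c" for m
  proof -
    have rv: "\<eta> j \<in> borel_measurable M" for j using ind by (auto simp: indep_vars_def)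
    have "expectation (\<lambda>\<omega>. \<bar>\<eta> j \<omega>\<bar>) = (\<integral>x. \<bar>x\<bar> \<partial>distr M borel (\<eta> j))" for j
      by (rule integral_distr[symmetric]) (use rv in auto)
    then show ?thesis unfolding c_def by (simp only: same[of "int (Suc j) - int m"])
  qed
  show "AE \<omega> in M. summable (\<lambda>m. \<bar>\<psi> m * \<eta> (int (Suc j) - int m) \<omega>\<bar>)"
  proof (rule AE_summable_of_summable_integral)
    show "integrable M (\<lambda>\<omega>. \<bar>\<psi> m * \<eta> (int (Suc j) - int m) \<omega>\<bar>)" for m using int by simp
    have eq: "expectation (\<lambda>\<omega>. \<bar>\<psi> m * \<eta> (int (Suc j) - int m) \<omega>\<bar>) = \<bar>\<psi> m\<bar> * c" for m
      unfolding abs_mult by (subst integral_mult_right_zero) (simp only: E)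
    show "summable (\<lambda>m. expectation (\<lambda>\<omega>. \<bar>\<psi> m * \<eta> (int (Suc j) - int m) \<omega>\<bar>))"
      unfolding eq by (rule summable_mult2[OF \<psi>])
  qed simp
qed

lemma weighted_process_sums:
  assumes "\<forall>j. summable (\<lambda>m. \<bar>\<psi> m * \<eta> (int (Suc j) - int m) \<omega>\<bar>)"
  shows "(\<lambda>m. \<psi> m * shift_sum m n \<omega> f) sums weighted_process n \<omega> f"
proof -
  have "(\<lambda>m. f (real (Suc j) / real n) * (\<psi> m * \<eta> (int (Suc j) - int m) \<omega>)) sums
      (f (real (Suc j) / real n) * linear_process \<psi> \<eta> (int (Suc j)) \<omega>)" for j
    unfolding linear_process_def
    by (rule sums_mult[OF summable_sums[OF summable_rabs_cancel]]) (rule assms[rule_format])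
  then have "(\<lambda>m. (\<Sum>j<n. f (real (Suc j) / real n) * (\<psi> m * \<eta> (int (Suc j) - int m) \<omega>)) / sqrt n) sums weighted_process n \<omega> f"
    unfolding weighted_process_def by (rule sums_divide[OF sums_sum])
  moreover have "(\<Sum>j<n. f (real (Suc j) / real n) * (\<psi> m * \<eta> (int (Suc j) - int m) \<omega>)) / sqrt n = \<psi> m * shift_sum m n \<omega> f" for m
  proof -
    have "int (Suc j) - int m = int j + 1 - int m" for j by simp
    then have "(\<Sum>j<n. f (real (Suc j) / real n) * (\<psi> m * \<eta> (int (Suc j) - int m) \<omega>)) =
        \<psi> m * (\<Sum>j<n. f (real (Suc j) / real n) * \<eta> (int j + 1 - int m) \<omega>)"
      unfolding sum_distrib_left by (intro sum.cong refl) (simp only: mult.left_commute)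
    then show ?thesis unfolding shift.weighted_increments_scaled_sum by simp
  qed
  ultimately show ?thesis by simp
qed

lemma linear_reduction_negligible:
  "negligible_in_prob M (regressors q \<delta>) (\<lambda>n \<omega> f. weighted_process n \<omega> f - suminf \<psi> * shift_sum 0 n \<omega> f)"
  unfolding negligible_in_prob_def
proof (intro allI impI)
  fix e :: real assume e: "e > 0"
  have "\<forall>\<^sub>F N in sequentially. (\<Sum>m. \<bar>\<psi> (m + N)\<bar>) < e * e / (8 * sup_bound_const)"
    by (rule order_tendstoD(2)[OF suminf_exist_split2[OF \<psi>]]) (use e sup_bound_const_pos in simp)
  then obtain N where N: "(\<Sum>m. \<bar>\<psi> (m + N)\<bar>) < e * e / (8 * sup_bound_const)" by (auto simp: eventually_sequentially)
  have \<psi>N: "summable (\<lambda>m. \<bar>\<psi> (m + N)\<bar>)" by (rule summable_ignore_initial_segment[OF \<psi>])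
  have "negligible_in_prob M (regressors q \<delta>) (\<lambda>n \<omega> f. \<Sum>m<N. \<psi> m * (shift_sum m n \<omega> f - shift_sum 0 n \<omega> f))"
    by (rule negligible_in_prob_sum) (rule shift_negligible)
  moreover have e2: "e/2 > 0" using e by simp
  ultimately obtain n0 where n0: "\<forall>n\<ge>n0. \<exists>A\<in>sets M. measure M A \<le> e/2 \<and> (\<forall>\<omega>\<in>space M - A. \<forall>f\<in>regressors q \<delta>.
      \<bar>\<Sum>m<N. \<psi> m * (shift_sum m n \<omega> f - shift_sum 0 n \<omega> f)\<bar> \<le> e/2)"
    by (rule negligible_in_probD)
  show "\<exists>n0. \<forall>n\<ge>n0. \<exists>A\<in>sets M. measure M A \<le> e \<and> (\<forall>\<omega>\<in>space M - A. \<forall>f\<in>regressors q \<delta>. \<bar>weighted_process n \<omega> f - suminf \<psi> * shift_sum 0 n \<omega> f\<bar> \<le> e)"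
  proof (intro exI[of _ "max 1 n0"] allI impI)
    fix n assume "n \<ge> max 1 n0"
    then have n: "n \<ge> 1" "n \<ge> n0" by auto
    obtain A1 where A1: "A1 \<in> sets M" "measure M A1 \<le> e/2"
      "\<forall>\<omega>\<in>space M - A1. \<forall>f\<in>regressors q \<delta>. \<bar>\<Sum>m<N. \<psi> m * (shift_sum m n \<omega> f - shift_sum 0 n \<omega> f)\<bar> \<le> e/2"
      using n0 n(2) by blast
    define u where "u m \<omega> = \<bar>\<psi> (m + N)\<bar> * (shift.sup_bound (m + N) q n \<omega> + shift.sup_bound 0 q n \<omega>)" for m \<omega>
    have u0: "0 \<le> u m \<omega>" for m \<omega>
      unfolding u_def by (intro mult_nonneg_nonneg add_nonneg_nonneg shift.sup_bound(3)[OF q n(1)]) simp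
    have uint: "integrable M (u m)" for m
      unfolding u_def[abs_def] by (intro integrable_mult_right Bochner_Integration.integrable_add shift.sup_bound(1)[OF q n(1)])
    have uE: "expectation (u m) \<le> \<bar>\<psi> (m + N)\<bar> * (2 * sup_bound_const)" for m
    proof -
      have "expectation (u m) = \<bar>\<psi> (m + N)\<bar> * (expectation (shift.sup_bound (m + N) q n) + expectation (shift.sup_bound 0 q n))"
        unfolding u_def[abs_def]
        by (simp only: integral_mult_right_zero Bochner_Integration.integral_add[OF shift.sup_bound(1)[OF q n(1)] shift.sup_bound(1)[OF q n(1)]])
      also have "\<dots> \<le> \<bar>\<psi> (m + N)\<bar> * (sup_bound_const + sup_bound_const)"
        unfolding sup_bound_const_def by (intro mult_left_mono add_mono shift.sup_bound(2)[OF q n(1)]) simp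
      finally show ?thesis by simp
    qed
    have usum: "summable (\<lambda>m. expectation (u m))"
      by (rule summable_comparison_test'[OF summable_mult2[OF \<psi>N, of "2 * sup_bound_const"], of 0]) (use uE u0 in simp)
    have AEu: "AE \<omega> in M. summable (\<lambda>m. u m \<omega>)"
      by (rule AE_summable_of_summable_integral[OF uint u0 usum])
    define U where "U \<omega> = (\<Sum>m. u m \<omega>)" for \<omega>
    have norm_u: "norm (u m \<omega>) = u m \<omega>" for m \<omega> using u0[of m \<omega>] by simp
    have AEu': "AE \<omega> in M. summable (\<lambda>m. norm (u m \<omega>))" and usum': "summable (\<lambda>m. \<integral>\<omega>. norm (u m \<omega>) \<partial>M)"
      unfolding norm_u using AEu usum by simp_all
    have Uint: "integrable M U" unfolding U_def[abs_def] by (rule integrable_suminf[OF uint AEu' usum'])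
    have UE: "expectation U \<le> e * e / 4"
    proof -
      have "expectation U = (\<Sum>m. expectation (u m))" unfolding U_def[abs_def] by (rule integral_suminf[OF uint AEu' usum'])
      also have "\<dots> \<le> (\<Sum>m. \<bar>\<psi> (m + N)\<bar> * (2 * sup_bound_const))"
        by (rule suminf_le[OF uE usum summable_mult2[OF \<psi>N]])
      also have "\<dots> = (\<Sum>m. \<bar>\<psi> (m + N)\<bar>) * (2 * sup_bound_const)" by (rule suminf_mult2[OF \<psi>N, symmetric])
      also have "\<dots> \<le> e * e / (8 * sup_bound_const) * (2 * sup_bound_const)" using N sup_bound_const_pos by (intro mult_right_mono) auto
      also have "\<dots> = e * e / 4" using sup_bound_const_pos by simp
      finally show ?thesis .
    qed
    define A2 where "A2 = {\<omega>\<in>space M. e/2 \<le> U \<omega>}"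
    have [measurable]: "U \<in> borel_measurable M" using Uint by simp
    have A2: "A2 \<in> sets M" unfolding A2_def by measurable
    have "measure M A2 \<le> expectation U / (e/2)"
      unfolding A2_def
    proof (rule integral_Markov_inequality_measure[OF Uint sets.empty_sets _ e2])
      show "AE \<omega> in M. 0 \<le> U \<omega>" using AEu by eventually_elim (auto simp: U_def intro!: suminf_nonneg u0)
    qed
    also have "\<dots> \<le> (e * e / 4) / (e/2)" using UE e by (intro divide_right_mono) auto
    also have "\<dots> = e/2" using e by simp
    finally have PA2: "measure M A2 \<le> e/2" .
    have "AE \<omega> in M. (\<forall>j. summable (\<lambda>m. \<bar>\<psi> m * \<eta> (int (Suc j) - int m) \<omega>\<bar>)) \<and> summable (\<lambda>m. u m \<omega>)"
      using AE_series_summable AEu by eventually_elim simp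
    then obtain A3 where A3: "{\<omega>\<in>space M. \<not> ((\<forall>j. summable (\<lambda>m. \<bar>\<psi> m * \<eta> (int (Suc j) - int m) \<omega>\<bar>)) \<and> summable (\<lambda>m. u m \<omega>))} \<subseteq> A3"
      "emeasure M A3 = 0" "A3 \<in> sets M"
      by (rule AE_E)
    have PA3: "measure M A3 = 0" using A3(2) by (simp add: measure_def)
    show "\<exists>A\<in>sets M. measure M A \<le> e \<and> (\<forall>\<omega>\<in>space M - A. \<forall>f\<in>regressors q \<delta>. \<bar>weighted_process n \<omega> f - suminf \<psi> * shift_sum 0 n \<omega> f\<bar> \<le> e)"
    proof (rule bexI[of _ "A1 \<union> A2 \<union> A3"], intro conjI ballI)
      have "measure M (A1 \<union> A2 \<union> A3) \<le> measure M (A1 \<union> A2) + measure M A3" by (rule measure_Un_le) (use A1 A2 A3 in auto)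
      also have "measure M (A1 \<union> A2) \<le> measure M A1 + measure M A2" by (rule measure_Un_le) (use A1 A2 in auto)
      finally show "measure M (A1 \<union> A2 \<union> A3) \<le> e" using A1(2) PA2 PA3 by linarith
      fix \<omega> f assume \<omega>: "\<omega> \<in> space M - (A1 \<union> A2 \<union> A3)" and f: "f \<in> regressors q \<delta>"
      have sm: "\<forall>j. summable (\<lambda>m. \<bar>\<psi> m * \<eta> (int (Suc j) - int m) \<omega>\<bar>)" "summable (\<lambda>m. u m \<omega>)"
        using A3(1) \<omega> by blast+
      have Ue: "U \<omega> \<le> e/2" using \<omega> by (auto simp: A2_def)
      have "(\<lambda>m. \<psi> m * shift_sum m n \<omega> f - \<psi> m * shift_sum 0 n \<omega> f) sums (weighted_process n \<omega> f - suminf \<psi> * shift_sum 0 n \<omega> f)"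
        by (rule sums_diff[OF weighted_process_sums[OF sm(1)] sums_mult2[OF summable_sums[OF summable_rabs_cancel[OF \<psi>]]]])
      then have "(\<lambda>m. \<psi> m * (shift_sum m n \<omega> f - shift_sum 0 n \<omega> f)) sums (weighted_process n \<omega> f - suminf \<psi> * shift_sum 0 n \<omega> f)"
        by (simp only: right_diff_distrib)
      from sums_split_initial_segment[OF this, of N]
      have tail: "(\<lambda>m. \<psi> (m + N) * (shift_sum (m + N) n \<omega> f - shift_sum 0 n \<omega> f)) sums
        (weighted_process n \<omega> f - suminf \<psi> * shift_sum 0 n \<omega> f - (\<Sum>m<N. \<psi> m * (shift_sum m n \<omega> f - shift_sum 0 n \<omega> f)))" .
      have "norm (\<psi> (m + N) * (shift_sum (m + N) n \<omega> f - shift_sum 0 n \<omega> f)) \<le> u m \<omega>" for m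
      proof -
        have "\<bar>shift_sum (m + N) n \<omega> f - shift_sum 0 n \<omega> f\<bar> \<le> shift.sup_bound (m + N) q n \<omega> + shift.sup_bound 0 q n \<omega>"
          using shift.sup_bound(4)[OF q n(1) f, of "m + N" \<omega>] shift.sup_bound(4)[OF q n(1) f, of 0 \<omega>] by linarith
        then show ?thesis unfolding u_def real_norm_def abs_mult by (rule mult_left_mono) simp
      qed
      from norm_suminf_le[OF this sm(2)]
      have "\<bar>weighted_process n \<omega> f - suminf \<psi> * shift_sum 0 n \<omega> f - (\<Sum>m<N. \<psi> m * (shift_sum m n \<omega> f - shift_sum 0 n \<omega> f))\<bar> \<le> U \<omega>"
        unfolding U_def sums_unique[OF tail] real_norm_def .
      moreover have "\<bar>\<Sum>m<N. \<psi> m * (shift_sum m n \<omega> f - shift_sum 0 n \<omega> f)\<bar> \<le> e/2" using A1(3) \<omega> f by blast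
      ultimately show "\<bar>weighted_process n \<omega> f - suminf \<psi> * shift_sum 0 n \<omega> f\<bar> \<le> e" using Ue by linarith
    qed (use A1 A2 A3 in auto)
  qed
qed

definition mean_square :: "nat \<Rightarrow> (real \<Rightarrow> real) \<Rightarrow> real" where
  "mean_square n f = (\<Sum>j<n. (f (real (Suc j) / real n))\<^sup>2) / real n"

abbreviation integral_square :: "(real \<Rightarrow> real) \<Rightarrow> real" where
  "integral_square f \<equiv> integral {0..1} (\<lambda>x. (f x)\<^sup>2)"

lemma rate_tendsto: "(\<lambda>n. real n powr (- 1/q)) \<longlonglongrightarrow> 0"
  using tendsto_neg_powr[OF _ filterlim_real_sequentially, of "-1/q"] q by simp

lemma reciprocal_close:
  assumes f: "f \<in> regressors q \<delta>" and n: "n \<ge> 1" and small: "12 * real n powr (- 1/q) \<le> \<delta> / 2"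
  shows "mean_square n f \<ge> \<delta> / 2" and "\<bar>1 / mean_square n f - 1 / integral_square f\<bar> \<le> 24 * real n powr (- 1/q) / \<delta>\<^sup>2"
proof -
  have integral_square: "integral_square f > \<delta>" by (rule regressors_integral[OF f])
  have QI: "\<bar>mean_square n f - integral_square f\<bar> \<le> 12 * real n powr (- 1/q)"
    unfolding mean_square_def by (rule regressors_riemann_sum[OF f q(1) \<delta> n])
  show mean_square: "mean_square n f \<ge> \<delta> / 2" using QI integral_square small by linarith
  have "1 / mean_square n f - 1 / integral_square f = (integral_square f - mean_square n f) / (mean_square n f * integral_square f)" using mean_square integral_square \<delta> by (simp add: diff_divide_eq_iff divide_diff_eq_iff field_simps)
  then have "\<bar>1 / mean_square n f - 1 / integral_square f\<bar> = \<bar>mean_square n f - integral_square f\<bar> / (mean_square n f * integral_square f)" using mean_square integral_square \<delta> by (simp add: abs_minus_commute)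
  also have "\<dots> \<le> (12 * real n powr (- 1/q)) / (\<delta> / 2 * \<delta>)"
    using mean_square integral_square \<delta> QI by (intro frac_le mult_mono) auto
  also have "\<dots> = 24 * real n powr (- 1/q) / \<delta>\<^sup>2" by (simp add: power2_eq_square)
  finally show "\<bar>1 / mean_square n f - 1 / integral_square f\<bar> \<le> 24 * real n powr (- 1/q) / \<delta>\<^sup>2" .
qed

lemma eventually_rate_small:
  assumes "b > 0"
  shows "\<exists>n0\<ge>1. \<forall>n\<ge>n0. real n powr (- 1/q) \<le> b"
proof -
  have "\<forall>\<^sub>F n in sequentially. real n powr (- 1/q) < b" by (rule order_tendstoD(2)[OF rate_tendsto assms])
  then obtain n0 where "\<forall>n\<ge>n0. real n powr (- 1/q) < b" by (auto simp: eventually_sequentially)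
  then show ?thesis by (intro exI[of _ "max 1 n0"]) (auto intro: less_imp_le)
qed

lemma denominator_negligible:
  "negligible_in_prob M (regressors q \<delta>) (\<lambda>n \<omega> f. weighted_process n \<omega> f * (1 / mean_square n f - 1 / integral_square f))"
  unfolding negligible_in_prob_def
proof (intro allI impI)
  fix e :: real assume e: "e > 0"
  have e': "min 1 (e/2) > 0" using e by simp
  obtain n1 where n1: "\<forall>n\<ge>n1. \<exists>A\<in>sets M. measure M A \<le> min 1 (e/2) \<and> (\<forall>\<omega>\<in>space M - A. \<forall>f\<in>regressors q \<delta>.
      \<bar>weighted_process n \<omega> f - suminf \<psi> * shift_sum 0 n \<omega> f\<bar> \<le> min 1 (e/2))"
    by (rule negligible_in_probD[OF linear_reduction_negligible e'])
  define B where "B = 2 * sup_bound_const / e"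
  have B: "B > 0" using sup_bound_const_pos e by (simp add: B_def)
  define T where "T = \<bar>suminf \<psi>\<bar> * B + 1"
  have T: "T > 0" using B by (simp add: T_def add_nonneg_pos)
  have "min (\<delta> / 24) (e * \<delta>\<^sup>2 / (24 * T)) > 0" using \<delta> e T by simp
  then obtain n2 where n2: "n2 \<ge> 1" "\<forall>n\<ge>n2. real n powr (- 1/q) \<le> min (\<delta> / 24) (e * \<delta>\<^sup>2 / (24 * T))"
    using eventually_rate_small by blast
  show "\<exists>n0. \<forall>n\<ge>n0. \<exists>A\<in>sets M. measure M A \<le> e \<and> (\<forall>\<omega>\<in>space M - A. \<forall>f\<in>regressors q \<delta>. \<bar>weighted_process n \<omega> f * (1 / mean_square n f - 1 / integral_square f)\<bar> \<le> e)"
  proof (intro exI[of _ "max n1 n2"] allI impI)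
    fix n assume "n \<ge> max n1 n2"
    then have n: "n \<ge> n1" "n \<ge> n2" "n \<ge> 1" using n2(1) by auto
    obtain A1 where A1: "A1 \<in> sets M" "measure M A1 \<le> min 1 (e/2)"
      "\<forall>\<omega>\<in>space M - A1. \<forall>f\<in>regressors q \<delta>. \<bar>weighted_process n \<omega> f - suminf \<psi> * shift_sum 0 n \<omega> f\<bar> \<le> min 1 (e/2)"
      using n1 n(1) by blast
    define A2 where "A2 = {\<omega>\<in>space M. B \<le> shift.sup_bound 0 q n \<omega>}"
    have [measurable]: "shift.sup_bound 0 q n \<in> borel_measurable M" using shift.sup_bound(1)[OF q n(3), of 0] by simp
    have A2: "A2 \<in> sets M" unfolding A2_def by measurable
    have "measure M A2 \<le> sup_bound_const / B"
      by (rule markov_on_event[OF shift.sup_bound(1)[OF q n(3), of 0] shift.sup_bound(3)[OF q n(3)] _ B A2])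
        (use shift.sup_bound(2)[OF q n(3), of 0] in \<open>auto simp: A2_def sup_bound_const_def\<close>)
    also have "sup_bound_const / B = e / 2" using sup_bound_const_pos e by (simp add: B_def)
    finally have PA2: "measure M A2 \<le> e/2" .
    show "\<exists>A\<in>sets M. measure M A \<le> e \<and> (\<forall>\<omega>\<in>space M - A. \<forall>f\<in>regressors q \<delta>. \<bar>weighted_process n \<omega> f * (1 / mean_square n f - 1 / integral_square f)\<bar> \<le> e)"
    proof (rule bexI[of _ "A1 \<union> A2"], intro conjI ballI)
      show "measure M (A1 \<union> A2) \<le> e" using measure_Un_le[OF A1(1) A2] A1(2) PA2 by linarith
      fix \<omega> f assume \<omega>: "\<omega> \<in> space M - (A1 \<union> A2)" and f: "f \<in> regressors q \<delta>"
      have "\<bar>shift_sum 0 n \<omega> f\<bar> \<le> B"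
        using shift.sup_bound(4)[OF q n(3) f, of 0 \<omega>] \<omega> by (auto simp: A2_def)
      then have "\<bar>suminf \<psi> * shift_sum 0 n \<omega> f\<bar> \<le> \<bar>suminf \<psi>\<bar> * B" unfolding abs_mult by (rule mult_left_mono) simp
      moreover have "\<bar>weighted_process n \<omega> f - suminf \<psi> * shift_sum 0 n \<omega> f\<bar> \<le> 1" using A1(3) \<omega> f by fastforce
      ultimately have WT: "\<bar>weighted_process n \<omega> f\<bar> \<le> T" unfolding T_def by linarith
      have r: "real n powr (- 1/q) \<le> \<delta> / 24" "real n powr (- 1/q) \<le> e * \<delta>\<^sup>2 / (24 * T)" using n2(2) n(2) by auto
      have "\<bar>weighted_process n \<omega> f * (1 / mean_square n f - 1 / integral_square f)\<bar> \<le> T * (24 * real n powr (- 1/q) / \<delta>\<^sup>2)"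
        unfolding abs_mult using WT T r(1)
        by (intro mult_mono reciprocal_close(2)[OF f n(3)]) auto
      also have "\<dots> \<le> T * (24 * (e * \<delta>\<^sup>2 / (24 * T)) / \<delta>\<^sup>2)"
        using r(2) T by (intro mult_left_mono divide_right_mono) auto
      also have "\<dots> = e" using T \<delta> by simp
      finally show "\<bar>weighted_process n \<omega> f * (1 / mean_square n f - 1 / integral_square f)\<bar> \<le> e" .
    qed (use A1 A2 in auto)
  qed
qed

lemma leading_term_negligible:
  "negligible_in_prob M (regressors q \<delta>) (\<lambda>n \<omega> f. weighted_process n \<omega> f / mean_square n f - suminf \<psi> * shift_sum 0 n \<omega> f / integral_square f)"
proof -
  have "negligible_in_prob M (regressors q \<delta>) (\<lambda>n \<omega> f. (weighted_process n \<omega> f - suminf \<psi> * shift_sum 0 n \<omega> f) / integral_square f)"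
  proof (rule negligible_in_prob_scaled_le[OF linear_reduction_negligible, of "1/\<delta>"])
    fix n \<omega> f assume f: "f \<in> regressors q \<delta>"
    show "\<bar>(weighted_process n \<omega> f - suminf \<psi> * shift_sum 0 n \<omega> f) / integral_square f\<bar> \<le> 1/\<delta> * \<bar>weighted_process n \<omega> f - suminf \<psi> * shift_sum 0 n \<omega> f\<bar>"
      using divide_integral_le[OF q(1) \<delta> f order_refl, of "weighted_process n \<omega> f - suminf \<psi> * shift_sum 0 n \<omega> f"] by simp
  qed (use \<delta> in simp)
  from negligible_in_prob_add[OF denominator_negligible this]
  show ?thesis by (simp add: right_diff_distrib diff_divide_distrib)
qed

lemma regression_process_eq:
  assumes f: "f \<in> regressors q \<delta>" and n: "n \<ge> 1" and small: "12 * real n powr (- 1/q) \<le> \<delta> / 2"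
  shows "regression_process (regressors q \<delta>) \<beta> (linear_process \<psi> \<eta>) n \<omega> f = weighted_process n \<omega> f / mean_square n f"
proof -
  define S where "S = (\<Sum>j<n. (f (real (Suc j) / real n))\<^sup>2)"
  define R where "R = (\<Sum>j<n. f (real (Suc j) / real n) * linear_process \<psi> \<eta> (int (Suc j)) \<omega>)"
  have "mean_square n f > 0" using reciprocal_close(1)[OF f n small] \<delta> by simp
  then have S: "S \<noteq> 0" by (auto simp: mean_square_def S_def)
  have ls: "least_squares n (\<lambda>j. \<beta> * f (real j / real n) + linear_process \<psi> \<eta> (int j) \<omega>) f = inverse S * (\<beta> * S + R)"
    unfolding least_squares_def S_def R_def
    by (simp add: sum.atLeast1_atMost_eq sum_distrib_left sum.distrib[symmetric] power2_eq_square algebra_simps)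
  have "inverse S * (\<beta> * S + R) - \<beta> = R / S" using S by (simp add: field_simps)
  then have "regression_process (regressors q \<delta>) \<beta> (linear_process \<psi> \<eta>) n \<omega> f = sqrt (real n) * (R / S)"
    using f by (simp add: regression_process_def ls)
  also have "\<dots> = (R / sqrt n) / (S / real n)"
  proof -
    have "sqrt (real n) * sqrt (real n) = real n" by simp
    then show ?thesis using n S by (simp add: field_simps)
  qed
  finally show ?thesis by (simp add: weighted_process_def mean_square_def R_def S_def)
qed

lemma converges_to_limit_process:
  assumes \<sigma>: "\<sigma> > 0" "v = \<sigma>\<^sup>2" and AE: "AE x in white_noise. x \<in> haar_converging q s r"
    and h: "continuous_map (mtopology_of (linf (regressors q \<delta>))) euclideanreal h"
      "bounded (h ` mspace (linf (regressors q \<delta>)))"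
  shows "\<forall>\<^sub>F n in sequentially. regression_process (regressors q \<delta>) \<beta> (linear_process \<psi> \<eta>) n \<in> space M \<rightarrow> linf_space (regressors q \<delta>)"
    and "(\<lambda>n. outer_expectation M (\<lambda>\<omega>. ereal (h (regression_process (regressors q \<delta>) \<beta> (linear_process \<psi> \<eta>) n \<omega>))))
      \<longlonglongrightarrow> ereal (\<integral>x. h (limit_process q \<delta> s r (\<sigma> * suminf \<psi>) x) \<partial>white_noise)"
proof -
  let ?F = "regressors q \<delta>"
  let ?Z = "regression_process ?F \<beta> (linear_process \<psi> \<eta>)"
  let ?V = "\<lambda>n k \<omega>. weighted_average q \<delta> (suminf \<psi>) (2^k) (\<lambda>i. shift.block_sum 0 n (2^k) i \<omega>)"
  let ?L = "\<lambda>k x. weighted_average q \<delta> (\<sigma> * suminf \<psi>) (2^k) (\<lambda>i. haar k i x / sqrt (2^k))"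
  have "\<delta> / 24 > 0" using \<delta> by simp
  then obtain n1 where n1: "n1 \<ge> 1" "\<forall>n\<ge>n1. real n powr (- 1/q) \<le> \<delta> / 24" using eventually_rate_small by blast
  have small: "12 * real n powr (- 1/q) \<le> \<delta> / 2" if "n \<ge> n1" for n using n1(2) that by fastforce
  have Z_in: "?Z n \<omega> \<in> linf_space ?F" if n: "n \<ge> n1" for n \<omega>
  proof -
    have n': "n \<ge> 1" using n n1 by simp
    define R where "R = (\<Sum>j<n. \<bar>linear_process \<psi> \<eta> (int (Suc j)) \<omega>\<bar>) / sqrt n"
    have "?Z n \<omega> = (\<lambda>f\<in>?F. ?Z n \<omega> f)" by (auto simp: regression_process_def restrict_def fun_eq_iff)
    also have "\<dots> \<in> linf_space ?F"
    proof (rule linf_spaceI)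
      fix f assume f: "f \<in> ?F"
      have "\<bar>weighted_process n \<omega> f\<bar> \<le> R"
        unfolding weighted_process_def R_def abs_divide
      proof (intro divide_mono order_trans[OF sum_abs] sum_mono)
        fix j assume "j \<in> {..<n}"
        then have "\<bar>f (real (Suc j) / real n)\<bar> \<le> 1" by (intro regressors_le_1_variation_le_1(1)[OF f q(1)]) auto
        then show "\<bar>f (real (Suc j) / real n) * linear_process \<psi> \<eta> (int (Suc j)) \<omega>\<bar> \<le> \<bar>linear_process \<psi> \<eta> (int (Suc j)) \<omega>\<bar>"
          unfolding abs_mult by (intro mult_left_le_one_le) auto
      qed (use n' in \<open>auto intro: sum_nonneg\<close>)
      moreover have "mean_square n f \<ge> \<delta> / 2" by (rule reciprocal_close(1)[OF f n' small[OF n]])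
      ultimately have "\<bar>weighted_process n \<omega> f\<bar> / mean_square n f \<le> R / (\<delta> / 2)" using \<delta> by (intro frac_le) auto
      then show "\<bar>?Z n \<omega> f\<bar> \<le> R / (\<delta> / 2)"
        unfolding regression_process_eq[OF f n' small[OF n]] using \<open>mean_square n f \<ge> \<delta> / 2\<close> \<delta> by simp
    qed
    finally show ?thesis .
  qed
  then show ev: "\<forall>\<^sub>F n in sequentially. ?Z n \<in> space M \<rightarrow> linf_space ?F"
    unfolding eventually_sequentially by (intro exI[of _ n1]) auto
  have close: "\<exists>k0. \<forall>k\<ge>k0. \<exists>n0. \<forall>n\<ge>n0. \<exists>A\<in>sets M. measure M A \<le> e \<and>
      (\<forall>\<omega>\<in>space M - A. mdist (linf ?F) (?Z n \<omega>) (?V n k \<omega>) \<le> e)" if e: "e > 0" for e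
  proof -
    define e1 where "e1 = min (e/2) (e * \<delta> / (2 * (\<bar>suminf \<psi>\<bar> + 1)))"
    have e1: "e1 \<le> e/2" "e1 > 0" "\<bar>suminf \<psi>\<bar> * e1 / \<delta> \<le> e/2"
    proof -
      show "e1 \<le> e/2" unfolding e1_def by (rule min.cobounded1)
      show "e1 > 0" using e \<delta> by (auto simp: e1_def)
      have cancel: "c * (e * \<delta> / (2 * c)) = e/2 * \<delta>" if "c > 0" for c :: real using that by simp
      have "\<bar>suminf \<psi>\<bar> * e1 \<le> (\<bar>suminf \<psi>\<bar> + 1) * (e * \<delta> / (2 * (\<bar>suminf \<psi>\<bar> + 1)))"
        using \<open>e1 > 0\<close> by (intro mult_mono) (auto simp: e1_def)
      also have "\<dots> = e/2 * \<delta>" by (rule cancel) linarith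
      finally show "\<bar>suminf \<psi>\<bar> * e1 / \<delta> \<le> e/2" using \<delta> by (simp add: pos_divide_le_eq)
    qed
    obtain K0 where K0: "\<forall>K\<ge>K0. \<exists>n0\<ge>1. \<forall>n\<ge>n0. \<exists>A\<in>events. prob A \<le> e1 \<and> (\<forall>\<omega>\<in>space M - A. \<forall>f\<in>?F.
        \<bar>shift_sum 0 n \<omega> f - (\<Sum>i<K. f (real (Suc i) / real K) * shift.block_sum 0 n K i \<omega>)\<bar> \<le> e1)"
      using shift.block_approximation[OF q e1(2), of \<delta> 0] by blast
    have "e/2 > 0" using e by simp
    then obtain n2 where n2: "\<forall>n\<ge>n2. \<exists>A\<in>sets M. measure M A \<le> e/2 \<and> (\<forall>\<omega>\<in>space M - A. \<forall>f\<in>?F.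
        \<bar>weighted_process n \<omega> f / mean_square n f - suminf \<psi> * shift_sum 0 n \<omega> f / integral_square f\<bar> \<le> e/2)"
      by (rule negligible_in_probD[OF leading_term_negligible])
    show ?thesis
    proof (rule exI[of _ K0], intro allI impI)
      fix k assume k: "k \<ge> K0"
      have "2^k \<ge> K0" by (rule order_trans[OF k less_imp_le[OF less_exp]])
      then obtain n3 where n3: "\<forall>n\<ge>n3. \<exists>A\<in>events. prob A \<le> e1 \<and> (\<forall>\<omega>\<in>space M - A. \<forall>f\<in>?F.
        \<bar>shift_sum 0 n \<omega> f - (\<Sum>i<2^k. f (real (Suc i) / real (2^k)) * shift.block_sum 0 n (2^k) i \<omega>)\<bar> \<le> e1)"
        using K0 by blast
      show "\<exists>n0. \<forall>n\<ge>n0. \<exists>A\<in>sets M. measure M A \<le> e \<and> (\<forall>\<omega>\<in>space M - A. mdist (linf ?F) (?Z n \<omega>) (?V n k \<omega>) \<le> e)"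
      proof (rule exI[of _ "max n1 (max n2 n3)"], intro allI impI)
        fix n assume "n \<ge> max n1 (max n2 n3)"
        then have n: "n \<ge> n1" "n \<ge> n2" "n \<ge> n3" "n \<ge> 1" using n1(1) by auto
        obtain A where A: "A \<in> sets M" "measure M A \<le> e/2"
          "\<forall>\<omega>\<in>space M - A. \<forall>f\<in>?F. \<bar>weighted_process n \<omega> f / mean_square n f - suminf \<psi> * shift_sum 0 n \<omega> f / integral_square f\<bar> \<le> e/2"
          using n2 n(2) by blast
        obtain A' where A': "A' \<in> sets M" "measure M A' \<le> e1"
          "\<forall>\<omega>\<in>space M - A'. \<forall>f\<in>?F. \<bar>shift_sum 0 n \<omega> f - (\<Sum>i<2^k. f (real (Suc i) / real (2^k)) * shift.block_sum 0 n (2^k) i \<omega>)\<bar> \<le> e1"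
          using n3 n(3) by blast
        show "\<exists>A\<in>sets M. measure M A \<le> e \<and> (\<forall>\<omega>\<in>space M - A. mdist (linf ?F) (?Z n \<omega>) (?V n k \<omega>) \<le> e)"
        proof (rule bexI[of _ "A \<union> A'"], intro conjI ballI)
          show "measure M (A \<union> A') \<le> e" using measure_Un_le[OF A(1) A'(1)] A(2) A'(2) e1(1) by linarith
          fix \<omega> assume \<omega>: "\<omega> \<in> space M - (A \<union> A')"
          have "linf_dist ?F (?Z n \<omega>) (?V n k \<omega>) \<le> e"
          proof (rule linf_dist_le)
            fix f assume f: "f \<in> ?F"
            let ?S = "\<Sum>i<2^k. f (real (Suc i) / real (2^k)) * shift.block_sum 0 n (2^k) i \<omega>"
            have V: "?V n k \<omega> f = suminf \<psi> * ?S / integral_square f" using f by (simp add: weighted_average_def)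
            have Z: "?Z n \<omega> f = weighted_process n \<omega> f / mean_square n f" by (rule regression_process_eq[OF f n(4) small[OF n(1)]])
            have 1: "\<bar>weighted_process n \<omega> f / mean_square n f - suminf \<psi> * shift_sum 0 n \<omega> f / integral_square f\<bar> \<le> e/2" using A(3) \<omega> f by blast
            have "\<bar>shift_sum 0 n \<omega> f - ?S\<bar> \<le> e1" using A'(3) \<omega> f by blast
            then have "\<bar>suminf \<psi> * (shift_sum 0 n \<omega> f - ?S)\<bar> \<le> \<bar>suminf \<psi>\<bar> * e1" unfolding abs_mult by (rule mult_left_mono) simp
            from order_trans[OF divide_integral_le[OF q(1) \<delta> f this] e1(3)]
            have 2: "\<bar>suminf \<psi> * shift_sum 0 n \<omega> f / integral_square f - suminf \<psi> * ?S / integral_square f\<bar> \<le> e/2"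
              by (simp only: right_diff_distrib diff_divide_distrib)
            show "\<bar>?Z n \<omega> f - ?V n k \<omega> f\<bar> \<le> e" unfolding V Z using 1 2 by linarith
          qed (use e in simp)
          then show "mdist (linf ?F) (?Z n \<omega>) (?V n k \<omega>) \<le> e" by simp
        qed (use A A' in auto)
      qed
    qed
  qed
  interpret W: prob_space white_noise by (rule prob_space_white_noise)
  have scale: "weighted_average q \<delta> (suminf \<psi>) K (\<lambda>i. \<sigma> * y i) = weighted_average q \<delta> (\<sigma> * suminf \<psi>) K y" for K y
    unfolding weighted_average_def by (simp add: sum_distrib_left mult_ac)
  have V_conv: "(\<lambda>n. \<integral>\<omega>. g (?V n k \<omega>) \<partial>M) \<longlonglongrightarrow> (\<integral>x. g (?L k x) \<partial>white_noise)"
    if g: "continuous_map (mtopology_of (linf ?F)) euclideanreal g" "bounded (g ` mspace (linf ?F))" for g k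
  proof -
    obtain C where C: "\<And>y. y \<in> linf_space ?F \<Longrightarrow> \<bar>g y\<bar> \<le> C"
      using g(2) unfolding bounded_iff mspace_linf by (metis image_eqI real_norm_def)
    have "v > 0" using \<sigma> by simp
    then have "(\<lambda>n. expectation (\<lambda>\<omega>. (\<lambda>y. g (weighted_average q \<delta> (suminf \<psi>) (2^k) y)) (\<lambda>i. shift.block_sum 0 n (2^k) i \<omega>))) \<longlonglongrightarrow>
      (\<integral>x. (\<lambda>y. g (weighted_average q \<delta> (suminf \<psi>) (2^k) y)) (\<lambda>i. sqrt v * (haar k i x / sqrt (2^k))) \<partial>white_noise)"
    proof (rule shift.block_sums_converge)
      show "continuous_on UNIV (\<lambda>y. g (weighted_average q \<delta> (suminf \<psi>) (2^k) y))"
        by (rule continuous_weighted_average[OF q(1) \<delta> g(1)])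
      show "\<bar>g (weighted_average q \<delta> (suminf \<psi>) (2^k) y)\<bar> \<le> C" for y
        by (rule C[OF weighted_average_in_linf[OF q(1) \<delta>]])
      fix y y' :: "nat \<Rightarrow> real" assume "\<And>i. i < 2^k \<Longrightarrow> y i = y' i"
      then have "weighted_average q \<delta> (suminf \<psi>) (2^k) y = weighted_average q \<delta> (suminf \<psi>) (2^k) y'"
        unfolding weighted_average_def by (intro restrict_ext arg_cong2[where f = "(/)"] arg_cong2[where f = "(*)"] sum.cong refl) simp
      then show "g (weighted_average q \<delta> (suminf \<psi>) (2^k) y) = g (weighted_average q \<delta> (suminf \<psi>) (2^k) y')" by simp
    qed
    moreover have "sqrt v = \<sigma>" using \<sigma> by simp
    ultimately show ?thesis by (simp only: scale)
  qed
  interpret approximated_convergence M white_noise "linf ?F" ?Z "limit_process q \<delta> s r (\<sigma> * suminf \<psi>)" ?V ?L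
  proof (unfold_locales, goal_cases)
    case 1 show ?case using ev by simp
  next
    case 2 show ?case by (simp add: limit_process_in_linf[OF q(1) \<delta>])
  next
    case 3 show ?case by (simp add: weighted_average_in_linf[OF q(1) \<delta>])
  next
    case 4 show ?case by (simp add: weighted_average_in_linf[OF q(1) \<delta>])
  next
    case (5 g n k)
    have "(\<lambda>\<omega> i. shift.block_sum 0 n (2^k) i \<omega>) \<in> M \<rightarrow>\<^sub>M PiM UNIV (\<lambda>_. borel)"
      by (rule measurable_PiM_single'[OF shift.block_sum_measurable]) simp
    from measurable_compose[OF this measurable_weighted_average[OF q(1) \<delta> 5]] show ?case .
  next
    case (6 g k) show ?case by (rule measurable_haar_average[OF q(1) \<delta> 6])
  next
    case (7 g) show ?case by (rule measurable_limit_process[OF q(1) \<delta> 7])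
  next
    case (8 e) then show ?case by (rule close)
  next
    case (9 g k) then show ?case by (rule V_conv)
  next
    case 10 show ?case using AE
    proof eventually_elim
      case (elim x)
      then show ?case using limit_process_tendsto[OF q(1) \<delta> elim] by simp
    qed
  qed
  show "(\<lambda>n. outer_expectation M (\<lambda>\<omega>. ereal (h (?Z n \<omega>)))) \<longlonglongrightarrow> ereal (\<integral>x. h (limit_process q \<delta> s r (\<sigma> * suminf \<psi>) x) \<partial>white_noise)"
    by (rule outer_expectation_tendsto[OF h])
qed

end

lemma limit_process_scale:
  "(\<lambda>f\<in>regressors q \<delta>. c * limit_process q \<delta> s r 1 x f) = limit_process q \<delta> s r c x"
  unfolding limit_process_def by (auto simp: fun_eq_iff restrict_def)

theorem theorem13:
  fixes M :: "'a measure" and \<eta> :: "int \<Rightarrow> 'a \<Rightarrow> real" and \<psi> :: "nat \<Rightarrow> real"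
    and \<sigma> \<beta> q \<delta> :: real
  assumes "1 \<le> q" "q < 2" "0 < \<delta>" "\<delta> < 1"
    and "prob_space M"
    and "prob_space.indep_vars M (\<lambda>_. borel) \<eta> UNIV"
    and "\<And>j. distr M borel (\<eta> j) = distr M borel (\<eta> 1)"
    and "integrable M (\<lambda>\<omega>. (\<eta> 1 \<omega>)\<^sup>2)"
    and "(\<integral>\<omega>. \<eta> 1 \<omega> \<partial>M) = 0"
    and "(\<integral>\<omega>. (\<eta> 1 \<omega>)\<^sup>2 \<partial>M) = \<sigma>\<^sup>2" "\<sigma> > 0"
    and "summable (\<lambda>j. \<bar>\<psi> j\<bar>)"
    and "(\<Sum>j. \<psi> j) \<noteq> 0"
  shows "\<exists>(N :: (nat \<Rightarrow> real) measure) (\<nu> :: (nat \<Rightarrow> real) \<Rightarrow> (real \<Rightarrow> real) \<Rightarrow> real).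
    gaussian_process N (regressors q \<delta>) \<nu> \<and>
    separably_valued (linf (regressors q \<delta>)) N \<nu> \<and>
    borel_on_range (linf (regressors q \<delta>)) N \<nu> \<and>
    converges_in_outer_distribution (linf (regressors q \<delta>))
      (\<lambda>_. M) (regression_process (regressors q \<delta>) \<beta> (linear_process \<psi> \<eta>))
      N (\<lambda>\<omega>. \<lambda>f\<in>regressors q \<delta>. \<sigma> * (\<Sum>j. \<psi> j) * \<nu> \<omega> f)"
proof -
  interpret short_memory M \<eta> \<psi> "\<sigma>\<^sup>2" q \<delta>
    using assms by (simp add: short_memory_def short_memory_axioms_def)
  obtain s r where AE: "AE x in white_noise. x \<in> haar_converging q s r"
    using AE_haar_converging[OF assms(1,2)] by blast
  note q' = assms(1) and \<delta>' = assms(3)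
  have range: "borel_on_range (linf (regressors q \<delta>)) white_noise (limit_process q \<delta> s r c)" for c
    by (rule borel_on_rangeI)
      (auto simp: limit_process_in_linf[OF q' \<delta>'] intro: measurable_limit_process[OF q' \<delta>'])
  have scale: "(\<lambda>x. \<lambda>f\<in>regressors q \<delta>. \<sigma> * (\<Sum>j. \<psi> j) * limit_process q \<delta> s r 1 x f) = limit_process q \<delta> s r (\<sigma> * suminf \<psi>)"
    by (intro ext) (simp only: limit_process_scale)
  have "\<forall>\<^sub>F n in sequentially. regression_process (regressors q \<delta>) \<beta> (linear_process \<psi> \<eta>) n \<in> space M \<rightarrow> linf_space (regressors q \<delta>)"
  proof (rule converges_to_limit_process(1)[OF assms(11) refl AE])
    show "continuous_map (mtopology_of (linf (regressors q \<delta>))) euclideanreal (\<lambda>_. 0)" by simp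
    show "bounded ((\<lambda>_. 0::real) ` mspace (linf (regressors q \<delta>)))" by (auto simp: bounded_iff)
  qed
  then have "converges_in_outer_distribution (linf (regressors q \<delta>)) (\<lambda>_. M)
      (regression_process (regressors q \<delta>) \<beta> (linear_process \<psi> \<eta>)) white_noise (limit_process q \<delta> s r (\<sigma> * suminf \<psi>))"
    unfolding converges_in_outer_distribution_def
    using assms(5) prob_space_white_noise separably_valued_limit_process[OF q' \<delta>'] range
      converges_to_limit_process(2)[OF assms(11) refl AE] by simp
  then show ?thesis
    unfolding scale[symmetric]
    using gaussian_process_limit_process[OF q' \<delta>' AE] separably_valued_limit_process[OF q' \<delta>'] range by blast
qed

end
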